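(* For every integer $n\ge2$, there is a polynomially convex compact set $K_n\subset\mathbb C^n$ that is non-pluripolar at every point and non-plurithin at every point and has the following property. Put $Z_n=\{2\}\times\overline{\mathbb D}^{\,n-1}$. Then $Z_n\subset K_n$, the set of locally pluriregular points of $K_n$ is $K_n\setminus Z_n$, and for every $\tau>0$ there exists $\Psi_\tau\in C^\infty(\mathbb C^n)\cap\mathcal L_\tau^+$ such that, with $\psi_\tau=\Psi_\tau|_{K_n}$, $$\Lambda(K_n,\psi_\tau)=[\tau,\infty),\qquad \Lambda_{\mathrm{reg}}(K_n,\psi_\tau)=\{\tau\},$$ and, with $F_\delta=V_{\delta,K_n,\psi_\tau}^*$, $$F_\delta(a)-\psi_\tau(a)\ge\tfrac49(\delta-\tau)\log2>0\qquad(a\in Z_n,\ \delta>\tau).$$ Moreover the nonnegative $(1,1)$-form $dd^c\Psi_\tau$ (equivalently, the complex Hessian of $\Psi_\tau$) has rank $n-1$ on a neighborhood of $Z_n$.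
   Context: $\overline{\mathbb D}$ is the closed unit disk in $\mathbb C$. Write $\log^+t=\max\{\log t,0\}$, $\log^+0=0$; $\|\cdot\|$ is the Euclidean norm. For $\delta>0$, $\mathcal L_\delta=\{u\in \mathrm{PSH}(\mathbb C^n): u(z)\le\delta\log^+\|z\|+C_u\text{ on }\mathbb C^n\}$ and $\mathcal L_\delta^+=\{u\in\mathcal L_\delta:u(z)\ge\delta\log^+\|z\|-C_u\text{ on }\mathbb C^n\}$, for some constants depending on $u$. $f^*(z)=\limsup_{\zeta\to z}f(\zeta)$ is the upper semicontinuous regularization. For compact $K$ and bounded $\psi:K\to\mathbb R$, $V_{\delta,K,\psi}(z)=\sup\{u(z):u\in\mathcal L_\delta,\ u\le\psi\text{ on }K\}$, $F_\delta=V_{\delta,K,\psi}^*$, $V_K=V_{1,K,0}$; $\Lambda(K,\psi)=\{\delta>0:V_{\delta,K,\psi}|_K=\psi\}$, $\Lambda_{\mathrm{reg}}(K,\psi)=\{\delta\in\Lambda(K,\psi):F_\delta|_K=\psi\}$. A set is pluripolar if near each point it lies in the $-\infty$ locus of a plurisubharmonic function not identically $-\infty$; $K$ is non-pluripolar at every point if $K\cap B(a,r)$ is non-pluripolar for all $a\in K$, $r>0$ ($B(a,r)$ the open Euclidean ball). $K$ is locally pluriregular at $a\in K$ if $V_{K\cap\overline B(a,r)}^*(a)=0$ for every $r>0$. A set $E\subset\mathbb C^n$ is plurithin at $a$ if $a$ is not an accumulation point of $E\setminus\{a\}$, or there is a plurisubharmonic function $u$ near $a$ with $\limsup_{E\setminus\{a\}\ni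 z\to a}u(z)<u(a)$; otherwise it is non-plurithin at $a$. "Non-plurithin at every point" means at every point of $K$. $dd^c=\frac i2\partial\bar\partial$. *)

theory Defs
  imports "HOL-Analysis.Analysis"
begin

text \<open>
  Points of \<open>\<complex>\<^sup>n\<close> are vectors of type \<open>complex ^ 'n\<close> with \<open>n = CARD('n)\<close>; \<open>norm\<close>, \<open>ball\<close> and \<open>cball\<close>
  on this type are Euclidean. Functions with values in \<open>[-\<infinity>, \<infinity>)\<close>, as well as upper envelopes,
  which may take the value \<open>\<infinity>\<close>, are \<open>ereal\<close>-valued.
\<close>

text \<open>
  The mean over \<open>[0, 2\<pi>]\<close> is the difference of the integrals of the positive and of the negative
  part (\<open>e2ennreal\<close> sends negative values to 0). It is used only for functions that are bounded
  above, so the first integral is finite and \<open>\<infinity> - \<infinity>\<close> does not arise.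
\<close>

definition circle_mean :: "(real \<Rightarrow> ereal) \<Rightarrow> ereal" where
  "circle_mean f =
     (enn2ereal (\<integral>\<^sup>+\<theta>\<in>{0..2*pi}. e2ennreal (f \<theta>) \<partial>lborel)
      - enn2ereal (\<integral>\<^sup>+\<theta>\<in>{0..2*pi}. e2ennreal (- f \<theta>) \<partial>lborel)) / ereal (2 * pi)"

text \<open>
  The constant \<open>-\<infinity>\<close> counts as plurisubharmonic. Values of \<open>u\<close> outside \<open>\<Omega>\<close> are irrelevant.
\<close>

definition psh_on :: "(complex ^ 'n::finite) set \<Rightarrow> (complex ^ 'n \<Rightarrow> ereal) \<Rightarrow> bool" where
  "psh_on \<Omega> u \<longleftrightarrow>
     open \<Omega> \<and>
     (\<forall>z\<in>\<Omega>. u z < \<infinity>) \<and>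
     (\<forall>z\<in>\<Omega>. Limsup (at z) u \<le> u z) \<and>
     (\<forall>a b. (\<forall>\<zeta>. norm \<zeta> \<le> 1 \<longrightarrow> a + \<zeta> *s b \<in> \<Omega>) \<longrightarrow>
        u a \<le> circle_mean (\<lambda>\<theta>. u (a + cis \<theta> *s b)))"

text \<open>
  Connectedness of \<open>U\<close> is required so that ``not identically \<open>-\<infinity>\<close>'' has its usual strength.
\<close>

definition pluripolar :: "(complex ^ 'n::finite) set \<Rightarrow> bool" where
  "pluripolar E \<longleftrightarrow>
     (\<forall>a\<in>E. \<exists>U u. open U \<and> connected U \<and> a \<in> U \<and> psh_on U u \<and>
        (\<exists>z\<in>U. u z \<noteq> -\<infinity>) \<and> (\<forall>z\<in>E \<inter> U. u z = -\<infinity>))"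

definition nonpluripolar_everywhere :: "(complex ^ 'n::finite) set \<Rightarrow> bool" where
  "nonpluripolar_everywhere K \<longleftrightarrow> (\<forall>a\<in>K. \<forall>r>0. \<not> pluripolar (K \<inter> ball a r))"

definition plurithin_at :: "(complex ^ 'n::finite) set \<Rightarrow> complex ^ 'n \<Rightarrow> bool" where
  "plurithin_at E a \<longleftrightarrow>
     \<not> a islimpt (E - {a}) \<or>
     (\<exists>U u. a \<in> U \<and> psh_on U u \<and> Limsup (at a within (E - {a})) u < u a)"

inductive complex_polynomial_fun :: "(complex ^ 'n::finite \<Rightarrow> complex) \<Rightarrow> bool" where
  const: "complex_polynomial_fun (\<lambda>z. c)"
| coord: "complex_polynomial_fun (\<lambda>z. z $ i)"
| add: "complex_polynomial_fun p \<Longrightarrow> complex_polynomial_fun q \<Longrightarrow>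
    complex_polynomial_fun (\<lambda>z. p z + q z)"
| mult: "complex_polynomial_fun p \<Longrightarrow> complex_polynomial_fun q \<Longrightarrow>
    complex_polynomial_fun (\<lambda>z. p z * q z)"

definition polynomial_hull :: "(complex ^ 'n::finite) set \<Rightarrow> (complex ^ 'n) set" where
  "polynomial_hull K =
     {z. \<forall>p. complex_polynomial_fun p \<longrightarrow> ereal (norm (p z)) \<le> (SUP w\<in>K. ereal (norm (p w)))}"

definition polynomially_convex :: "(complex ^ 'n::finite) set \<Rightarrow> bool" where
  "polynomially_convex K \<longleftrightarrow> polynomial_hull K = K"

definition log_plus :: "real \<Rightarrow> real" where
  "log_plus t = (if t = 0 then 0 else max (ln t) 0)"

definition lelong_class :: "real \<Rightarrow> (complex ^ 'n::finite \<Rightarrow> ereal) set" where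
  "lelong_class \<delta> =
     {u. psh_on UNIV u \<and> (\<exists>C::real. \<forall>z. u z \<le> ereal (\<delta> * log_plus (norm z) + C))}"

definition lelong_class_plus :: "real \<Rightarrow> (complex ^ 'n::finite \<Rightarrow> ereal) set" where
  "lelong_class_plus \<delta> =
     {u \<in> lelong_class \<delta>. \<exists>C::real. \<forall>z. u z \<ge> ereal (\<delta> * log_plus (norm z) - C)}"

text \<open>
  The limit superior includes the value at the point itself (\<open>nhds\<close> rather than \<open>at\<close>), so
  \<open>usc_reg f\<close> is the least upper semicontinuous majorant of \<open>f\<close>.
\<close>

definition usc_reg :: "(complex ^ 'n::finite \<Rightarrow> ereal) \<Rightarrow> complex ^ 'n \<Rightarrow> ereal" where
  "usc_reg f z = Limsup (nhds z) f"

text \<open>Only the values of the weight \<open>\<psi>\<close> on \<open>K\<close> matter below.\<close>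

definition extremal_fun ::
  "real \<Rightarrow> (complex ^ 'n::finite) set \<Rightarrow> (complex ^ 'n \<Rightarrow> real) \<Rightarrow> complex ^ 'n \<Rightarrow> ereal" where
  "extremal_fun \<delta> K \<psi> z = (SUP u \<in> {u \<in> lelong_class \<delta>. \<forall>w\<in>K. u w \<le> ereal (\<psi> w)}. u z)"

definition extremal_fun_reg ::
  "real \<Rightarrow> (complex ^ 'n::finite) set \<Rightarrow> (complex ^ 'n \<Rightarrow> real) \<Rightarrow> complex ^ 'n \<Rightarrow> ereal" where
  "extremal_fun_reg \<delta> K \<psi> = usc_reg (extremal_fun \<delta> K \<psi>)"

definition Lambda :: "(complex ^ 'n::finite) set \<Rightarrow> (complex ^ 'n \<Rightarrow> real) \<Rightarrow> real set" where
  "Lambda K \<psi> = {\<delta>. \<delta> > 0 \<and> (\<forall>z\<in>K. extremal_fun \<delta> K \<psi> z = ereal (\<psi> z))}"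

definition Lambda_reg :: "(complex ^ 'n::finite) set \<Rightarrow> (complex ^ 'n \<Rightarrow> real) \<Rightarrow> real set" where
  "Lambda_reg K \<psi> = {\<delta> \<in> Lambda K \<psi>. \<forall>z\<in>K. extremal_fun_reg \<delta> K \<psi> z = ereal (\<psi> z)}"

definition locally_pluriregular_at :: "(complex ^ 'n::finite) set \<Rightarrow> complex ^ 'n \<Rightarrow> bool" where
  "locally_pluriregular_at K a \<longleftrightarrow>
     a \<in> K \<and> (\<forall>r>0. extremal_fun_reg 1 (K \<inter> cball a r) (\<lambda>_. 0) a = 0)"

primrec C_times :: "nat \<Rightarrow> ('a::euclidean_space \<Rightarrow> 'b::real_normed_vector) \<Rightarrow> bool" where
  "C_times 0 f \<longleftrightarrow> continuous_on UNIV f"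
| "C_times (Suc k) f \<longleftrightarrow>
     (\<forall>x. f differentiable (at x)) \<and> (\<forall>v. C_times k (\<lambda>x. frechet_derivative f (at x) v))"

definition C_infinity :: "('a::euclidean_space \<Rightarrow> 'b::real_normed_vector) \<Rightarrow> bool" where
  "C_infinity f \<longleftrightarrow> (\<forall>k. C_times k f)"

text \<open>
  The Wirtinger derivatives \<open>\<partial>/\<partial>z\<^sub>j = (\<partial>/\<partial>x\<^sub>j - i \<partial>/\<partial>y\<^sub>j)/2\<close> and
  \<open>\<partial>/\<partial>zbar\<^sub>j = (\<partial>/\<partial>x\<^sub>j + i \<partial>/\<partial>y\<^sub>j)/2\<close>.
\<close>

definition wirtinger :: "'n \<Rightarrow> (complex ^ 'n::finite \<Rightarrow> complex) \<Rightarrow> complex ^ 'n \<Rightarrow> complex" where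
  "wirtinger j f z =
     (frechet_derivative f (at z) (axis j 1) - \<i> * frechet_derivative f (at z) (axis j \<i>)) / 2"

definition wirtinger_bar :: "'n \<Rightarrow> (complex ^ 'n::finite \<Rightarrow> complex) \<Rightarrow> complex ^ 'n \<Rightarrow> complex" where
  "wirtinger_bar j f z =
     (frechet_derivative f (at z) (axis j 1) + \<i> * frechet_derivative f (at z) (axis j \<i>)) / 2"

text \<open>
  \<open>complex_hessian u z\<close> is the coefficient matrix \<open>H\<close> of
  \<open>dd\<^sup>c u = (i/2) \<partial> dbar u = (i/2) \<Sum>\<^sub>j\<^sub>k H\<^sub>j\<^sub>k dz\<^sub>j \<and> dzbar\<^sub>k\<close> at \<open>z\<close>.
\<close>

definition complex_hessian :: "(complex ^ 'n::finite \<Rightarrow> real) \<Rightarrow> complex ^ 'n \<Rightarrow> complex ^ 'n ^ 'n" where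
  "complex_hessian u z = (\<chi> j k. wirtinger j (wirtinger_bar k (\<lambda>w. complex_of_real (u w))) z)"

text \<open>
  Nonnegativity of the form \<open>(i/2) \<Sum>\<^sub>j\<^sub>k H\<^sub>j\<^sub>k dz\<^sub>j \<and> dzbar\<^sub>k\<close>: its value on \<open>(v, iv)\<close> is
  \<open>\<Sum>\<^sub>j\<^sub>k H\<^sub>j\<^sub>k v\<^sub>j cnj v\<^sub>k\<close>.
\<close>

definition nonneg_11_form :: "complex ^ 'n ^ 'n::finite \<Rightarrow> bool" where
  "nonneg_11_form H \<longleftrightarrow>
     (\<forall>v :: complex ^ 'n. (\<Sum>j\<in>UNIV. \<Sum>k\<in>UNIV. H $ j $ k * v $ j * cnj (v $ k)) \<in> \<real>\<^sub>\<ge>\<^sub>0)"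

text \<open>
  \<open>{2} \<times> closed unit polydisk\<close>; the index \<open>i\<close> plays the role of the first coordinate, since the
  index type carries no order.
\<close>

definition Z_set :: "'n \<Rightarrow> (complex ^ 'n::finite) set" where
  "Z_set i = {z. z $ i = 2 \<and> (\<forall>j. j \<noteq> i \<longrightarrow> z $ j \<in> cball 0 1)}"

end

theory Submission
  imports Defs "HOL-Complex_Analysis.Cauchy_Integral_Formula" "HOL-Computational_Algebra.Polynomial"
begin

text \<open>
  Let \<open>A\<close> be the closed unit disc together with the point \<open>2\<close> and a sequence of closed discs with real centres
  \<open>2 + 2^(-k)\<close> and very small radii, and let \<open>K\<close> be the product of \<open>A\<close>, in the coordinate \<open>i\<close>, and the closed
  unit polydisc in the others. The plane set \<open>A\<close> is thin at \<open>2\<close> in the sense of potential theory: there are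
  logarithmic potentials (\<open>probe\<close>) of total mass at most \<open>1\<close> that do not exceed \<open>0\<close> on \<open>A\<close> and are at least
  \<open>1/2 ln 2\<close> at points arbitrarily close to \<open>2\<close>. As functions of one coordinate of \<open>\<complex>\<^sup>n\<close> they show that \<open>K\<close> is not
  locally pluriregular at the points over \<open>2\<close>, which form \<open>Z_set i\<close>. Every other point of \<open>K\<close> lies in arbitrarily
  small polydiscs contained in \<open>K\<close>, and polydiscs are regular by the Bernstein-Walsh inequality
  (\<open>extremal_fun_reg_polydisc\<close>).

  The other properties of \<open>K\<close> are insensitive to this thinness. \<open>K\<close> is the closure of its interior, hence
  nowhere locally pluripolar. Through every point of \<open>K\<close>, also over \<open>2\<close>, passes a unit disc in a coordinate
  \<open>j \<noteq> i\<close> that lies in \<open>K\<close>; such a disc occupies a fixed proportion of small circles around the point, and the mean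
  value inequality excludes plurithinness (\<open>not_plurithin_at_if_sector\<close>). Polynomial convexity reduces to \<open>A\<close>, where
  poles are pushed to infinity along vertical rays (\<open>real_centred_discs_peak\<close>).

  The weight \<open>\<Psi>\<close> is \<open>\<tau> ln (norm z)\<close> outside the unit ball, smoothed inside (\<open>weight\<close>). It is harmonic there on the
  complex lines through the origin, so its Hessian degenerates in that direction and has rank \<open>n - 1\<close>. Each such line meets the unit polydisc, a subset
  of \<open>K\<close>, in a disc whose boundary circle lies outside the open unit ball; the Bernstein-Walsh inequality on these
  lines shows that every function of growth \<open>\<tau>\<close> bounded by \<open>\<Psi>\<close> on \<open>K\<close> is bounded by \<open>\<Psi>\<close> everywhere
  (\<open>weight_dominates\<close>). Thus for \<open>\<delta> = \<tau>\<close> the extremal function is \<open>\<Psi>\<close> itself, which is continuous.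
  For \<open>\<delta> > \<tau>\<close> it still agrees with \<open>\<Psi>\<close> on \<open>K\<close>, but \<open>\<Psi>\<close> plus \<open>(\<delta> - \<tau>)\<close> times the potentials above are
  competitors, and they lift its regularization over \<open>2\<close> by at least \<open>4/9 (\<delta> - \<tau>) ln 2\<close>
  (\<open>extremal_fun_reg_weight_gap\<close>). For \<open>\<delta> < \<tau>\<close> the growth from the unit circle to the point \<open>2\<close> on the axis of
  the coordinate \<open>i\<close> is too slow to reach \<open>\<Psi>\<close>.
\<close>

section \<open>Averages over circles\<close>

definition circle_average :: "(real \<Rightarrow> real) \<Rightarrow> real" where
  "circle_average g = integral {0..2*pi} g / (2*pi)"

lemma circle_mean_mono:
  assumes "\<And>\<theta>. \<theta> \<in> {0..2*pi} \<Longrightarrow> f \<theta> \<le> g \<theta>"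
  shows "circle_mean f \<le> circle_mean g"
proof -
  have "(\<integral>\<^sup>+\<theta>\<in>{0..2*pi}. e2ennreal (f \<theta>) \<partial>lborel) \<le> (\<integral>\<^sup>+\<theta>\<in>{0..2*pi}. e2ennreal (g \<theta>) \<partial>lborel)"
    using assms by (intro nn_integral_mono) (auto simp: indicator_def intro: e2ennreal_mono)
  moreover have "(\<integral>\<^sup>+\<theta>\<in>{0..2*pi}. e2ennreal (- g \<theta>) \<partial>lborel) \<le> (\<integral>\<^sup>+\<theta>\<in>{0..2*pi}. e2ennreal (- f \<theta>) \<partial>lborel)"
    using assms by (intro nn_integral_mono) (auto simp: indicator_def intro: e2ennreal_mono)
  ultimately show ?thesis
    unfolding circle_mean_def
    by (intro ereal_divide_right_mono ereal_minus_mono) (auto simp: less_eq_ennreal.rep_eq[symmetric])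
qed

lemma circle_mean_integrable:
  assumes "set_integrable lborel {0..2*pi} g"
  shows "circle_mean (\<lambda>\<theta>. ereal (g \<theta>)) = ereal ((LINT \<theta>:{0..2*pi}|lborel. g \<theta>) / (2*pi))"
proof -
  have part: "enn2ereal (\<integral>\<^sup>+\<theta>\<in>{0..2*pi}. e2ennreal (ereal (h \<theta>)) \<partial>lborel)
      = ereal (LINT \<theta>|lborel. max 0 (indicator {0..2*pi} \<theta> * h \<theta>))"
    if "set_integrable lborel {0..2*pi} h" for h
  proof -
    have int: "integrable lborel (\<lambda>\<theta>. max 0 (indicator {0..2*pi} \<theta> * h \<theta>))"
      using that unfolding set_integrable_def by (auto intro!: integrable_max)
    have "(\<integral>\<^sup>+\<theta>\<in>{0..2*pi}. e2ennreal (ereal (h \<theta>)) \<partial>lborel)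
        = (\<integral>\<^sup>+\<theta>. ennreal (max 0 (indicator {0..2*pi} \<theta> * h \<theta>)) \<partial>lborel)"
      by (intro nn_integral_cong) (auto simp: indicator_def max_def ennreal_neg)
    also have "\<dots> = ennreal (LINT \<theta>|lborel. max 0 (indicator {0..2*pi} \<theta> * h \<theta>))"
      using int by (intro nn_integral_eq_integral) auto
    finally show ?thesis
      by (simp add: enn2ereal_ennreal integral_nonneg_AE)
  qed
  have neg: "set_integrable lborel {0..2*pi} (\<lambda>\<theta>. - g \<theta>)"
    using assms set_integrable_mult_right[of "-1" lborel "{0..2*pi}" g] by simp
  have "(LINT \<theta>|lborel. max 0 (indicator {0..2*pi} \<theta> * g \<theta>))
      - (LINT \<theta>|lborel. max 0 (indicator {0..2*pi} \<theta> * - g \<theta>))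
      = (LINT \<theta>|lborel. max 0 (indicator {0..2*pi} \<theta> * g \<theta>)
          - max 0 (indicator {0..2*pi} \<theta> * - g \<theta>))"
    using assms neg unfolding set_integrable_def
    by (intro Bochner_Integration.integral_diff[symmetric]) (auto intro!: integrable_max)
  also have "\<dots> = (LINT \<theta>:{0..2*pi}|lborel. g \<theta>)"
    unfolding set_lebesgue_integral_def
    by (intro Bochner_Integration.integral_cong) (auto simp: indicator_def max_def)
  finally show ?thesis
    using part[OF assms] part[OF neg] unfolding circle_mean_def by simp
qed

lemma circle_mean_continuous:
  assumes "continuous_on {0..2*pi} g"
  shows "circle_mean (\<lambda>\<theta>. ereal (g \<theta>)) = ereal (circle_average g)"
proof -
  have int: "set_integrable lborel {0..2*pi} g"
    using assms by (rule borel_integrable_atLeastAtMost')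
  show ?thesis
    unfolding circle_mean_integrable[OF int] circle_average_def
    by (simp add: set_borel_integral_eq_integral(2)[OF int])
qed

text \<open>
  With \<open>u\<close> replaced on the circle by a continuous real majorant, the extended-real mean becomes an ordinary
  integral.
\<close>

lemma psh_on_submean:
  assumes "psh_on \<Omega> u" and "\<And>\<zeta>. norm \<zeta> \<le> 1 \<Longrightarrow> a + \<zeta> *s b \<in> \<Omega>"
    and "continuous_on {0..2*pi} g"
    and "\<And>\<theta>. \<theta> \<in> {0..2*pi} \<Longrightarrow> u (a + cis \<theta> *s b) \<le> ereal (g \<theta>)"
  shows "u a \<le> ereal (circle_average g)"
proof -
  have "u a \<le> circle_mean (\<lambda>\<theta>. u (a + cis \<theta> *s b))"
    using assms(1,2) unfolding psh_on_def by blast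
  also have "\<dots> \<le> circle_mean (\<lambda>\<theta>. ereal (g \<theta>))"
    using assms(4) by (rule circle_mean_mono)
  finally show ?thesis
    by (simp add: circle_mean_continuous[OF assms(3)])
qed

text \<open>
  A better bound on an arc of the circle improves the bound at the centre in proportion to the length of
  the arc. The results on pluripolar and plurithin sets rest on this: a set of positive angular density
  already controls the value at the centre.
\<close>

lemma psh_on_arc_bound:
  assumes "psh_on \<Omega> u" and "\<And>\<zeta>. norm \<zeta> \<le> 1 \<Longrightarrow> a + \<zeta> *s b \<in> \<Omega>"
    and \<alpha>: "0 \<le> \<alpha>" "\<alpha> \<le> 2 * pi"
    and M: "\<And>\<theta>. \<theta> \<in> {0..2*pi} \<Longrightarrow> u (a + cis \<theta> *s b) \<le> ereal M"
    and m: "\<And>\<theta>. \<theta> \<in> {0..\<alpha>} \<Longrightarrow> u (a + cis \<theta> *s b) \<le> ereal m"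
  shows "u a \<le> ereal (M + (m - M) * (\<alpha> / (2 * pi)))"
proof -
  define g :: "real \<Rightarrow> real" where "g \<theta> = M + (m - M) * indicator {0..\<alpha>} \<theta>" for \<theta>
  have eq: "indicator {0..2*pi} \<theta> *\<^sub>R g \<theta> = M * indicator {0..2*pi} \<theta> + (m - M) * indicator {0..\<alpha>} \<theta>" for \<theta>
    using \<alpha> by (auto simp: g_def indicator_def)
  have int: "set_integrable lborel {0..2*pi} g"
    unfolding set_integrable_def eq using \<alpha>
    by (intro Bochner_Integration.integrable_add integrable_mult_right integrable_real_indicator) auto
  have "(LINT \<theta>:{0..2*pi}|lborel. g \<theta>) = M * (2 * pi) + (m - M) * \<alpha>"
    unfolding set_lebesgue_integral_def eq using \<alpha> by (subst Bochner_Integration.integral_add) auto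
  hence avg: "circle_mean (\<lambda>\<theta>. ereal (g \<theta>)) = ereal (M + (m - M) * (\<alpha> / (2 * pi)))"
    unfolding circle_mean_integrable[OF int] by (simp add: field_simps)
  have "u a \<le> circle_mean (\<lambda>\<theta>. u (a + cis \<theta> *s b))"
    using assms(1,2) unfolding psh_on_def by blast
  also have "\<dots> \<le> circle_mean (\<lambda>\<theta>. ereal (g \<theta>))"
    using M m by (intro circle_mean_mono) (auto simp: g_def indicator_def)
  finally show ?thesis unfolding avg .
qed

lemma circle_average_mono:
  assumes "continuous_on {0..2*pi} f" "continuous_on {0..2*pi} g"
    and "\<And>\<theta>. \<theta> \<in> {0..2*pi} \<Longrightarrow> f \<theta> \<le> g \<theta>"
  shows "circle_average f \<le> circle_average g"
  unfolding circle_average_def using assms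
  by (intro divide_right_mono integral_le integrable_continuous_real) auto

lemma circle_average_add:
  assumes "continuous_on {0..2*pi} f" "continuous_on {0..2*pi} g"
  shows "circle_average (\<lambda>\<theta>. f \<theta> + g \<theta>) = circle_average f + circle_average g"
  unfolding circle_average_def using assms
  by (simp add: Henstock_Kurzweil_Integration.integral_add integrable_continuous_real add_divide_distrib)

lemma circle_average_cmult: "circle_average (\<lambda>\<theta>. c * f \<theta>) = c * circle_average f"
  unfolding circle_average_def by simp

lemma circle_average_const: "circle_average (\<lambda>\<theta>. c) = c"
  unfolding circle_average_def by simp

text \<open>
  After division by \<open>p\<close> the integrand is the real part of the principal logarithm of a holomorphic function
  with positive real part, so the Cauchy integral formula gives the mean.
\<close>

lemma circle_average_ln_norm:
  assumes "norm q < norm p"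
  shows "circle_average (\<lambda>\<theta>. ln (norm (p + cis \<theta> * q))) = ln (norm p)"
proof -
  define w where "w = q / p"
  have p: "p \<noteq> 0" using assms by auto
  have w: "norm w < 1" using assms p by (simp add: w_def norm_divide)
  have re: "Re (1 + z * w) > 0" if "norm z \<le> 1" for z
  proof -
    have "norm (z * w) < 1"
      using that w by (simp add: norm_mult) (metis mult_left_le_one_le norm_ge_zero order_le_less_trans)
    thus ?thesis using abs_Re_le_cmod[of "z * w"] by simp
  qed
  define f where "f z = Ln (1 + z * w)" for z
  have "f holomorphic_on cball 0 1"
    unfolding f_def using re by (intro holomorphic_intros) (force simp: complex_nonpos_Reals_iff)
  hence "((\<lambda>u. f u / (u - 0)) has_contour_integral (2 * of_real pi * \<i> * f 0)) (circlepath 0 1)"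
    by (intro Cauchy_integral_circlepath_simple) auto
  hence "((\<lambda>t. f (cis t) / cis t * \<i> * cis t) has_integral 0) {0..2*pi}"
    unfolding circlepath_def by (subst (asm) has_contour_integral_part_circlepath_iff) (auto simp: f_def)
  hence "((\<lambda>t. Im (f (cis t) / cis t * \<i> * cis t)) has_integral Im 0) {0..2*pi}"
    by (rule has_integral_Im)
  moreover have "Im (f (cis t) / cis t * \<i> * cis t) = ln (norm (p + cis t * q)) - ln (norm p)" for t
  proof -
    have ne: "1 + cis t * w \<noteq> 0" using re[of "cis t"] by (metis norm_cis order_refl order_less_irrefl zero_complex.sel(1))
    have "f (cis t) / cis t * \<i> * cis t = \<i> * f (cis t)" by simp
    hence "Im (f (cis t) / cis t * \<i> * cis t) = Re (f (cis t))" by simp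
    also have "\<dots> = ln (norm (1 + cis t * w))" using ne by (simp add: f_def Re_Ln)
    also have "1 + cis t * w = (p + cis t * q) / p" using p by (simp add: w_def field_simps)
    also have "ln (norm ((p + cis t * q) / p)) = ln (norm (p + cis t * q)) - ln (norm p)"
    proof -
      have "p + cis t * q \<noteq> 0" using ne p by (auto simp: w_def field_simps)
      thus ?thesis using p by (simp add: norm_divide ln_div)
    qed
    finally show ?thesis .
  qed
  ultimately have "((\<lambda>t. ln (norm (p + cis t * q)) - ln (norm p)) has_integral 0) {0..2*pi}"
    by simp
  from has_integral_add[OF this has_integral_const_real[of "ln (norm p)" 0 "2*pi"]]
  have "((\<lambda>t. ln (norm (p + cis t * q))) has_integral 2 * pi * ln (norm p)) {0..2*pi}"
    by simp
  thus ?thesis by (simp add: circle_average_def integral_unique)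
qed

lemma continuous_ln_norm_circle:
  assumes "norm q < norm p"
  shows "continuous_on S (\<lambda>\<theta>. ln (norm (p + cis \<theta> * q)))"
proof -
  have "p + cis \<theta> * q \<noteq> 0" for \<theta>
    using assms by (metis add.right_neutral add_cancel_right_left add_diff_cancel_left' diff_0 mult.commute
        norm_cis norm_minus_cancel norm_mult mult.right_neutral order_less_irrefl)
  thus ?thesis by (intro continuous_intros) auto
qed

text \<open>
  Jensen's inequality for a linear function, applied to a continuous majorant \<open>w\<close> of a truncated logarithm.
  If \<open>norm q > norm p\<close>, the reflection \<open>p + cis \<theta> * q \<mapsto> cnj q + cis \<theta> * cnj p\<close> preserves the modulus on
  the circle and exchanges the two coefficients. If \<open>norm q \<le> norm p\<close>, one shrinks \<open>q\<close> by a factor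
  \<open>\<rho> < 1\<close>; the truncation at \<open>\<eta>\<close> controls the error when \<open>norm q = norm p\<close>, where the linear function may
  vanish on the circle.
\<close>

lemma circle_average_ge_ln_norm:
  fixes p q :: complex
  assumes cont: "continuous_on {0..2*pi} w" and "\<kappa> \<ge> 0" "\<eta> > 0" "p \<noteq> 0"
    and lower: "\<And>\<theta>. w \<theta> \<ge> \<kappa> * ln (max \<eta> (norm (p + cis \<theta> * q))) + c"
  shows "circle_average w \<ge> \<kappa> * ln (norm p) + c"
proof -
  have main: "circle_average w \<ge> \<kappa> * ln (norm p') + d"
    if "norm q' < norm p'" and "\<And>\<theta>. w \<theta> \<ge> \<kappa> * ln (norm (p' + cis \<theta> * q')) + d" for p' q' d
  proof -
    have c: "continuous_on S (\<lambda>\<theta>. ln (norm (p' + cis \<theta> * q')))" for S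
      using that(1) by (rule continuous_ln_norm_circle)
    have "circle_average (\<lambda>\<theta>. \<kappa> * ln (norm (p' + cis \<theta> * q')) + d) \<le> circle_average w"
      using that(2) by (intro circle_average_mono cont continuous_intros c) auto
    thus ?thesis
      by (subst (asm) circle_average_add)
         (auto intro!: continuous_intros c simp: circle_average_cmult circle_average_const
            circle_average_ln_norm[OF that(1)])
  qed
  show ?thesis
  proof (cases "norm q \<le> norm p")
    case True
    have lim: "((\<lambda>\<rho>. \<kappa> * ln (norm p) + (c - \<kappa> * ln (1 + (1 - \<rho>) * norm q / \<eta>))) \<longlongrightarrow>
        \<kappa> * ln (norm p) + (c - \<kappa> * ln (1 + (1 - 1) * norm q / \<eta>))) (at_left (1::real))"
      using \<open>\<eta> > 0\<close> by (intro tendsto_intros) auto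
    have "eventually (\<lambda>\<rho>. \<kappa> * ln (norm p) + (c - \<kappa> * ln (1 + (1 - \<rho>) * norm q / \<eta>)) \<le> circle_average w) (at_left 1)"
    proof (rule eventually_mono[OF eventually_at_left_real[of 0 1]])
      fix \<rho> :: real assume elim: "\<rho> \<in> {0<..<1}"
      have less: "norm (of_real \<rho> * q) < norm p"
        using elim True \<open>p \<noteq> 0\<close>
        by (cases "q = 0") (auto simp: norm_mult intro: order_less_le_trans[of _ "norm q"])
      show "\<kappa> * ln (norm p) + (c - \<kappa> * ln (1 + (1 - \<rho>) * norm q / \<eta>)) \<le> circle_average w"
      proof (rule main[OF less])
        fix \<theta>
        define X where "X = max \<eta> (norm (p + cis \<theta> * q))"
        have X: "X \<ge> \<eta>" "X > 0" using \<open>\<eta> > 0\<close> by (auto simp: X_def)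
        have nz: "p + cis \<theta> * (of_real \<rho> * q) \<noteq> 0"
        proof
          assume "p + cis \<theta> * (of_real \<rho> * q) = 0"
          hence "p = - (cis \<theta> * (of_real \<rho> * q))" by (simp add: eq_neg_iff_add_eq_0)
          hence "norm p = norm (of_real \<rho> * q)" by (simp add: norm_mult)
          thus False using less by simp
        qed
        have "p + cis \<theta> * (of_real \<rho> * q) = (p + cis \<theta> * q) - of_real (1 - \<rho>) * (cis \<theta> * q)"
          by (simp add: algebra_simps)
        hence "norm (p + cis \<theta> * (of_real \<rho> * q)) \<le> norm (p + cis \<theta> * q) + norm (of_real (1 - \<rho>) * (cis \<theta> * q))"
          by (simp only: norm_triangle_ineq4)
        also have "norm (of_real (1 - \<rho>) * (cis \<theta> * q)) = (1 - \<rho>) * norm q"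
          using elim by (simp only: norm_mult norm_of_real norm_cis) auto
        also have "norm (p + cis \<theta> * q) + (1 - \<rho>) * norm q \<le> X + (1 - \<rho>) * norm q * (X / \<eta>)"
        proof (intro add_mono)
          have "1 \<le> X / \<eta>" using X \<open>\<eta> > 0\<close> by simp
          thus "(1 - \<rho>) * norm q \<le> (1 - \<rho>) * norm q * (X / \<eta>)"
            using elim mult_left_mono[of 1 "X / \<eta>" "(1 - \<rho>) * norm q"] by simp
        qed (simp add: X_def)
        also have "\<dots> = (1 + (1 - \<rho>) * norm q / \<eta>) * X"
          using \<open>\<eta> > 0\<close> by (simp add: field_simps)
        finally have "ln (norm (p + cis \<theta> * (of_real \<rho> * q))) \<le> ln ((1 + (1 - \<rho>) * norm q / \<eta>) * X)"
          using nz by (intro ln_mono) (auto)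
        also have "\<dots> = ln (1 + (1 - \<rho>) * norm q / \<eta>) + ln X"
          using X elim \<open>\<eta> > 0\<close> by (intro ln_mult_pos) (auto intro!: add_pos_nonneg)
        finally have "\<kappa> * ln (norm (p + cis \<theta> * (of_real \<rho> * q))) \<le> \<kappa> * (ln (1 + (1 - \<rho>) * norm q / \<eta>) + ln X)"
          using \<open>\<kappa> \<ge> 0\<close> by (intro mult_left_mono)
        thus "\<kappa> * ln (norm (p + cis \<theta> * (of_real \<rho> * q))) + (c - \<kappa> * ln (1 + (1 - \<rho>) * norm q / \<eta>)) \<le> w \<theta>"
          using lower[of \<theta>] by (simp add: X_def algebra_simps)
      qed
    qed simp
    from tendsto_upperbound[OF lim this] show ?thesis by simp
  next
    case False
    have refl: "norm (p + cis \<theta> * q) = norm (cnj q + cis \<theta> * cnj p)" for \<theta>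
    proof -
      have "cnj (cis \<theta>) * cis \<theta> = 1" by (simp add: cis_cnj cis_mult)
      hence "cnj q + cis \<theta> * cnj p = cnj (p + cis \<theta> * q) * cis \<theta>"
        by (simp add: algebra_simps)
      thus ?thesis by (simp add: norm_mult del: complex_cnj_add)
    qed
    have "\<kappa> * ln (norm (cnj q)) + c \<le> circle_average w"
    proof (rule main[of "cnj p"])
      fix \<theta>
      have "cnj q + cis \<theta> * cnj p \<noteq> 0"
      proof
        assume "cnj q + cis \<theta> * cnj p = 0"
        hence "cnj q = - (cis \<theta> * cnj p)" by (simp add: eq_neg_iff_add_eq_0)
        hence "norm (cnj q) = norm (cnj p)" by (simp only: norm_minus_cancel norm_mult norm_cis)
        thus False using False by simp
      qed
      hence "ln (norm (p + cis \<theta> * q)) \<le> ln (max \<eta> (norm (p + cis \<theta> * q)))"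
        unfolding refl by (intro ln_mono) auto
      hence "\<kappa> * ln (norm (p + cis \<theta> * q)) \<le> \<kappa> * ln (max \<eta> (norm (p + cis \<theta> * q)))"
        using \<open>\<kappa> \<ge> 0\<close> by (intro mult_left_mono)
      thus "\<kappa> * ln (norm (cnj q + cis \<theta> * cnj p)) + c \<le> w \<theta>"
        using lower[of \<theta>] by (simp add: refl[symmetric])
    qed (use False in auto)
    moreover have "\<kappa> * ln (norm p) \<le> \<kappa> * ln (norm q)"
      using False \<open>\<kappa> \<ge> 0\<close> \<open>p \<noteq> 0\<close> by (intro mult_left_mono ln_mono) auto
    ultimately show ?thesis by simp
  qed
qed

section \<open>Continuous plurisubharmonic functions\<close>

text \<open>
  Every test function below is real-valued and continuous. For such functions the mean value inequality is
  a statement about ordinary integrals, which makes sums and positive multiples immediate.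
\<close>

definition psh_cont :: "(complex ^ 'n::finite \<Rightarrow> real) \<Rightarrow> bool" where
  "psh_cont u \<longleftrightarrow> continuous_on UNIV u \<and>
     (\<forall>a b. u a \<le> circle_average (\<lambda>\<theta>. u (a + cis \<theta> *s b)))"

lemma norm_vector_smult: "norm (\<zeta> *s d) = norm \<zeta> * norm (d :: complex ^ 'n::finite)"
  by (simp add: norm_vec_def norm_mult L2_set_right_distrib)

lemma continuous_on_vector_smult [continuous_intros]:
  fixes d :: "'a::topological_space \<Rightarrow> complex ^ 'n::finite"
  assumes "continuous_on S f" "continuous_on S d"
  shows "continuous_on S (\<lambda>x. f x *s d x)"
  unfolding vector_scalar_mult_def by (intro continuous_intros assms)

lemma tendsto_vector_smult [tendsto_intros]:
  fixes d :: "'a \<Rightarrow> complex ^ 'n::finite"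
  assumes "(f \<longlongrightarrow> x) F" "(d \<longlongrightarrow> y) F"
  shows "((\<lambda>x. f x *s d x) \<longlongrightarrow> x *s y) F"
  unfolding vector_scalar_mult_def by (intro tendsto_intros assms)

lemma continuous_on_circle:
  assumes "continuous_on UNIV (u :: complex ^ 'n::finite \<Rightarrow> real)"
  shows "continuous_on S (\<lambda>\<theta>. u (a + cis \<theta> *s b))"
  by (intro continuous_on_compose2[OF assms] continuous_intros) auto

lemma psh_cont_const: "psh_cont (\<lambda>z. c)"
  by (simp add: psh_cont_def circle_average_const)

lemma psh_cont_add: "psh_cont u \<Longrightarrow> psh_cont v \<Longrightarrow> psh_cont (\<lambda>z. u z + v z)"
  unfolding psh_cont_def
  by (auto intro!: continuous_intros add_mono simp: circle_average_add continuous_on_circle)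

lemma psh_cont_cmult: "psh_cont u \<Longrightarrow> c \<ge> 0 \<Longrightarrow> psh_cont (\<lambda>z. c * u z)"
  unfolding psh_cont_def
  by (auto intro!: continuous_intros mult_left_mono simp: circle_average_cmult)

lemma psh_cont_sum:
  assumes "\<And>k. k \<in> I \<Longrightarrow> psh_cont (u k)"
  shows "psh_cont (\<lambda>z. \<Sum>k\<in>I. u k z)"
  using assms by (induction I rule: infinite_finite_induct) (auto intro: psh_cont_const psh_cont_add)

lemma psh_cont_imp_psh_on:
  assumes "psh_cont u"
  shows "psh_on UNIV (\<lambda>z. ereal (u z))"
proof -
  have c: "continuous_on UNIV u" using assms by (simp add: psh_cont_def)
  have "Limsup (at z) (\<lambda>z. ereal (u z)) = ereal (u z)" for z
  proof (rule lim_imp_Limsup)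
    show "((\<lambda>z. ereal (u z)) \<longlongrightarrow> ereal (u z)) (at z)"
      using c by (intro tendsto_intros) (simp add: continuous_on_eq_continuous_at isContD)
    show "at z \<noteq> bot" by simp
  qed
  moreover have "ereal (u a) \<le> circle_mean (\<lambda>\<theta>. ereal (u (a + cis \<theta> *s b)))" for a b
    using assms by (simp add: circle_mean_continuous[OF continuous_on_circle[OF c]] psh_cont_def)
  ultimately show ?thesis by (simp add: psh_on_def)
qed

text \<open>
  The standard Hermitian form of \<open>\<complex>\<^sup>n\<close>, linear in the first argument; \<open>x \<bullet> y\<close> is its real part.
\<close>

definition hinner :: "complex ^ 'n::finite \<Rightarrow> complex ^ 'n \<Rightarrow> complex" where
  "hinner x y = (\<Sum>j\<in>UNIV. x $ j * cnj (y $ j))"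

lemma norm_hinner_le: "norm (hinner x y) \<le> norm x * norm y"
proof -
  have "norm (hinner x y) \<le> (\<Sum>j\<in>UNIV. norm (x $ j) * norm (y $ j))"
    unfolding hinner_def by (rule order_trans[OF norm_sum]) (simp add: norm_mult)
  also have "\<dots> = (\<Sum>j\<in>UNIV. \<bar>norm (x $ j)\<bar> * \<bar>norm (y $ j)\<bar>)" by simp
  also have "\<dots> \<le> norm x * norm y"
    unfolding norm_vec_def by (rule L2_set_mult_ineq)
  finally show ?thesis .
qed

lemma hinner_self: "hinner x x = of_real ((norm x)\<^sup>2)"
proof -
  have "(norm x)\<^sup>2 = (\<Sum>j\<in>UNIV. (norm (x $ j))\<^sup>2)"
    unfolding norm_vec_def L2_set_def by (simp add: sum_nonneg)
  thus ?thesis by (simp add: hinner_def complex_norm_square flip: of_real_power)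
qed

lemma hinner_add_smult: "hinner (x + c *s y) z = hinner x z + c * hinner y z"
  by (simp add: hinner_def sum.distrib distrib_right sum_distrib_left mult.assoc)

text \<open>
  The support hypothesis says that \<open>g\<close> is a convex nondecreasing function of the logarithm: at each \<open>t\<close> it is
  supported from below by \<open>\<kappa> ln s + const\<close>, truncated below so that it makes sense at \<open>0\<close>. By the
  Cauchy-Schwarz inequality \<open>norm (F z)\<close> is at least the modulus of the affine function
  \<open>z \<mapsto> hinner (F z) (F a) / norm (F a)\<close>, with equality at \<open>a\<close>; so Jensen's inequality for affine functions
  suffices.
\<close>

lemma psh_cont_radial:
  fixes F G :: "complex ^ 'n::finite \<Rightarrow> complex ^ 'n"
  assumes g: "continuous_on {0..} g" and F: "continuous_on UNIV F"
    and aff: "\<And>a b \<zeta>. F (a + \<zeta> *s b) = F a + \<zeta> *s G b"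
    and min: "\<And>s. s \<ge> 0 \<Longrightarrow> g 0 \<le> g s"
    and supp: "\<And>t. t > 0 \<Longrightarrow> \<exists>\<kappa>\<ge>0. \<exists>\<eta>>0. \<forall>s\<ge>0. g s \<ge> g t + \<kappa> * (ln (max \<eta> s) - ln t)"
  shows "psh_cont (\<lambda>z. g (norm (F z)))"
proof -
  have cont: "continuous_on UNIV (\<lambda>z. g (norm (F z)))"
    by (rule continuous_on_compose2[OF g]) (auto intro!: continuous_intros F)
  have "g (norm (F a)) \<le> circle_average (\<lambda>\<theta>. g (norm (F (a + cis \<theta> *s b))))" for a b
  proof (cases "F a = 0")
    case True
    have "circle_average (\<lambda>\<theta>. g (norm (F a))) \<le> circle_average (\<lambda>\<theta>. g (norm (F (a + cis \<theta> *s b))))"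
      using True by (intro circle_average_mono continuous_on_circle[OF cont] min continuous_intros) (auto intro: min)
    thus ?thesis by (simp add: circle_average_const)
  next
    case False
    define t where "t = norm (F a)"
    have t: "t > 0" using False by (simp add: t_def)
    obtain \<kappa> \<eta> where k: "\<kappa> \<ge> 0" "\<eta> > 0" and
      le: "\<And>s. s \<ge> 0 \<Longrightarrow> g s \<ge> g t + \<kappa> * (ln (max \<eta> s) - ln t)"
      using supp[OF t] by blast
    define q where "q = hinner (G b) (F a) / of_real t"
    have "\<kappa> * ln (norm (complex_of_real t)) + (g t - \<kappa> * ln t)
        \<le> circle_average (\<lambda>\<theta>. g (norm (F (a + cis \<theta> *s b))))"
    proof (rule circle_average_ge_ln_norm[OF continuous_on_circle[OF cont] k, where p = "of_real t" and q = q])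
      fix \<theta>
      have "of_real t + cis \<theta> * q = hinner (F (a + cis \<theta> *s b)) (F a) / of_real t"
        using t unfolding aff hinner_add_smult hinner_self q_def
        by (simp add: t_def[symmetric] field_simps power2_eq_square)
      also have "norm \<dots> \<le> norm (F (a + cis \<theta> *s b)) * norm (F a) / t"
        using t norm_hinner_le[of "F (a + cis \<theta> *s b)" "F a"] by (simp add: norm_divide divide_right_mono)
      finally have "norm (of_real t + cis \<theta> * q) \<le> norm (F (a + cis \<theta> *s b))"
        using t by (simp add: t_def)
      hence "\<kappa> * ln (max \<eta> (norm (of_real t + cis \<theta> * q))) \<le> \<kappa> * ln (max \<eta> (norm (F (a + cis \<theta> *s b))))"
        using k by (intro mult_left_mono ln_mono) auto
      thus "\<kappa> * ln (max \<eta> (norm (of_real t + cis \<theta> * q))) + (g t - \<kappa> * ln t) \<le> g (norm (F (a + cis \<theta> *s b)))"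
        using le[of "norm (F (a + cis \<theta> *s b))"] by (simp add: algebra_simps)
    qed (use t in auto)
    thus ?thesis using t by (simp add: t_def)
  qed
  thus ?thesis using cont by (simp add: psh_cont_def)
qed

section \<open>The Bernstein-Walsh inequality on complex lines\<close>

lemma log_plus_eq_ln_max: "t \<ge> 0 \<Longrightarrow> log_plus t = ln (max 1 t)"
  by (auto simp: log_plus_def max_def)

lemma psh_on_usc:
  assumes "psh_on \<Omega> u" "z \<in> \<Omega>" "u z < y"
  shows "eventually (\<lambda>w. u w < y) (nhds z)"
proof -
  have "Limsup (at z) u < y" using assms by (auto simp: psh_on_def intro: order_le_less_trans)
  hence "eventually (\<lambda>w. u w < y) (at z)" by (rule Limsup_lessD)
  thus ?thesis using assms(3) by (auto simp: eventually_at_filter elim!: eventually_mono)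
qed

lemma usc_attains_max:
  fixes f :: "'a::topological_space \<Rightarrow> 'b::linorder"
  assumes "compact X" "X \<noteq> {}"
    and usc: "\<And>x y. x \<in> X \<Longrightarrow> f x < y \<Longrightarrow> eventually (\<lambda>w. f w < y) (nhds x)"
  shows "\<exists>p\<in>X. \<forall>x\<in>X. f x \<le> f p"
proof (rule ccontr)
  assume "\<not> ?thesis"
  hence ex: "\<And>p. p \<in> X \<Longrightarrow> \<exists>x\<in>X. f p < f x" by force
  have "X \<subseteq> (\<Union>x\<in>X. interior {p. f p < f x})"
  proof
    fix p assume p: "p \<in> X"
    then obtain x where x: "x \<in> X" "f p < f x" using ex by blast
    have "p \<in> interior {p. f p < f x}"
      using usc[OF p x(2)] by (auto simp: eventually_nhds interior_def)
    thus "p \<in> (\<Union>x\<in>X. interior {p. f p < f x})" using x(1) by blast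
  qed
  then obtain Y where Y: "Y \<subseteq> X" "finite Y" "X \<subseteq> (\<Union>x\<in>Y. interior {p. f p < f x})"
    using compactE_image[OF \<open>compact X\<close>, of X "\<lambda>x. interior {p. f p < f x}"] by auto
  hence "Y \<noteq> {}" using \<open>X \<noteq> {}\<close> by auto
  then obtain m where m: "m \<in> Y" "\<And>x. x \<in> Y \<Longrightarrow> f x \<le> f m"
  proof -
    have "Max (f ` Y) \<in> f ` Y" using Y(2) \<open>Y \<noteq> {}\<close> by simp
    then obtain m where "m \<in> Y" "f m = Max (f ` Y)" by auto
    thus ?thesis using that Y(2) by (metis Max_ge finite_imageI imageI)
  qed
  then obtain x where "x \<in> Y" "m \<in> interior {p. f p < f x}" using Y by auto
  hence "f m < f x" using interior_subset by blast
  with m \<open>x \<in> Y\<close> show False by (simp add: leD)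
qed

lemma circle_average_Re: "circle_average (\<lambda>\<theta>. Re (q * cis \<theta>)) = 0"
proof -
  have "((\<lambda>\<theta>. Re (q * cis \<theta>)) has_integral
      (Re q * sin (2*pi) + Im q * cos (2*pi)) - (Re q * sin 0 + Im q * cos 0)) {0..2*pi}"
    by (rule fundamental_theorem_of_calculus)
       (auto intro!: derivative_eq_intros simp flip: has_real_derivative_iff_has_vector_derivative)
  thus ?thesis by (simp add: circle_average_def integral_unique)
qed

text \<open>
  Upper semicontinuity at \<open>x\<close> is written as: every bound that holds strictly at \<open>x\<close> holds near \<open>x\<close>. This form
  carries over to sums without a case distinction for \<open>-\<infinity>\<close>.
\<close>

lemma usc_add_continuous:
  fixes f :: "'a::t2_space \<Rightarrow> ereal"
  assumes usc: "\<And>y. f x < y \<Longrightarrow> eventually (\<lambda>w. f w < y) (nhds x)"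
    and h: "isCont h x" and less: "f x + ereal (h x) < y"
  shows "eventually (\<lambda>w. f w + ereal (h w) < y) (nhds x)"
proof -
  have "f x < y - ereal (h x)" using less by (simp add: ereal_less_minus_iff)
  then obtain r where r: "f x < ereal r" "ereal r < y - ereal (h x)"
    using ereal_dense2 by blast
  hence "ereal (r + h x) < y" by (cases y) auto
  moreover have "((\<lambda>w. ereal (r + h w)) \<longlongrightarrow> ereal (r + h x)) (nhds x)"
    using h by (intro tendsto_intros) (simp add: tendsto_at_iff_tendsto_nhds continuous_at)
  ultimately have "eventually (\<lambda>w. ereal (r + h w) < y) (nhds x)"
    using order_tendstoD(2) by blast
  with usc[OF r(1)] show ?thesis
  proof eventually_elim
    case (elim w)
    hence "f w + ereal (h w) \<le> ereal r + ereal (h w)" by (intro add_right_mono) auto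
    thus ?case using elim by simp
  qed
qed

lemma lelong_class_growth_line:
  assumes "u \<in> lelong_class \<delta>" "\<delta> \<ge> 0"
  obtains C where "\<And>\<zeta>. norm \<zeta> \<ge> 1 \<Longrightarrow> u (b + \<zeta> *s d) \<le> ereal (\<delta> * ln (norm \<zeta>) + C)"
proof -
  obtain C where C: "\<And>z. u z \<le> ereal (\<delta> * log_plus (norm z) + C)"
    using assms(1) by (auto simp: lelong_class_def)
  define B where "B = 1 + norm b + norm d"
  have B: "B \<ge> 1" by (simp add: B_def)
  have "u (b + \<zeta> *s d) \<le> ereal (\<delta> * ln (norm \<zeta>) + (\<delta> * ln B + C))" if z: "norm \<zeta> \<ge> 1" for \<zeta>
  proof -
    have "norm (b + \<zeta> *s d) \<le> norm b + norm \<zeta> * norm d"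
      by (metis norm_triangle_ineq norm_vector_smult)
    also have "\<dots> \<le> norm \<zeta> * norm b + norm \<zeta> * norm d"
      using z mult_right_mono[of 1 "norm \<zeta>" "norm b"] by simp
    also have "\<dots> \<le> norm \<zeta> * B" using z by (simp add: B_def algebra_simps)
    finally have "max 1 (norm (b + \<zeta> *s d)) \<le> norm \<zeta> * B"
      using z B mult_mono[of 1 "norm \<zeta>" 1 B] by simp
    hence "ln (max 1 (norm (b + \<zeta> *s d))) \<le> ln (norm \<zeta> * B)" by (intro ln_mono) auto
    also have "\<dots> = ln (norm \<zeta>) + ln B" using z B by (intro ln_mult_pos) auto
    finally have "\<delta> * log_plus (norm (b + \<zeta> *s d)) \<le> \<delta> * (ln (norm \<zeta>) + ln B)"
      using assms(2) by (intro mult_left_mono) (auto simp: log_plus_eq_ln_max)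
    thus ?thesis using C[of "b + \<zeta> *s d"] by (elim order_trans) (simp add: algebra_simps)
  qed
  thus ?thesis using that by blast
qed

text \<open>
  On the line, \<open>u - c - \<delta> ln \<bar>\<zeta>\<bar>\<close> is subharmonic outside the unit disc, bounded above at infinity, and at most
  \<open>0\<close> on the unit circle. If it were positive at \<open>\<zeta>0\<close>, it would stay so after two small perturbations:
  subtracting \<open>\<epsilon> ln \<bar>\<zeta>\<bar>\<close> makes it nonpositive on a large circle, and adding \<open>\<epsilon>' \<bar>\<zeta>\<bar>\<^sup>2\<close> makes it strictly
  subharmonic.
  An upper semicontinuous function on the annulus has a maximum point, here an interior one, and strict
  subharmonicity excludes that.
\<close>

lemma bernstein_walsh_line:
  fixes u :: "complex ^ 'n::finite \<Rightarrow> ereal"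
  assumes u: "u \<in> lelong_class \<delta>" and "\<delta> \<ge> 0"
    and c: "\<And>\<zeta>. norm \<zeta> = 1 \<Longrightarrow> u (b + \<zeta> *s d) \<le> ereal c"
    and z0: "norm \<zeta>0 \<ge> 1"
  shows "u (b + \<zeta>0 *s d) \<le> ereal (c + \<delta> * ln (norm \<zeta>0))"
proof (rule ccontr)
  define f where "f \<zeta> = u (b + \<zeta> *s d)" for \<zeta>
  have psh: "psh_on UNIV u" using u by (simp add: lelong_class_def)
  assume "\<not> ?thesis"
  hence "ereal (c + \<delta> * ln (norm \<zeta>0)) < f \<zeta>0" by (simp add: f_def)
  then obtain m where m: "c + \<delta> * ln (norm \<zeta>0) < m" "ereal m < f \<zeta>0"
    using ereal_dense2 by (metis less_ereal.simps(1))
  define t where "t = (m - c - \<delta> * ln (norm \<zeta>0)) / 2"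
  have t: "t > 0" using m by (simp add: t_def)
  define \<epsilon> where "\<epsilon> = t / (1 + ln (norm \<zeta>0))"
  have L0: "ln (norm \<zeta>0) \<ge> 0" using z0 by simp
  have e: "\<epsilon> > 0" using t L0 by (simp add: \<epsilon>_def)
  have e2: "\<epsilon> * ln (norm \<zeta>0) \<le> t"
    using t L0 by (simp add: \<epsilon>_def field_simps)
  define D where "D = \<delta> + \<epsilon>"
  have f0: "ereal (c + D * ln (norm \<zeta>0) + t) < f \<zeta>0"
  proof -
    have "c + D * ln (norm \<zeta>0) + t \<le> m"
      using e2 unfolding D_def t_def by (simp add: field_simps)
    thus ?thesis using m(2) by (meson ereal_less_eq(3) order_le_less_trans)
  qed
  obtain C where C: "\<And>\<zeta>. norm \<zeta> \<ge> 1 \<Longrightarrow> f \<zeta> \<le> ereal (\<delta> * ln (norm \<zeta>) + C)"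
    using lelong_class_growth_line[OF u \<open>\<delta> \<ge> 0\<close>, of b d] unfolding f_def by blast
  \<comment> \<open>On the circle of radius \<open>R\<close> the extra \<open>\<epsilon> ln R\<close> beats the additive constant of the growth bound.\<close>
  define R where "R = max (norm \<zeta>0 + 1) (exp ((C - c) / \<epsilon>))"
  have R: "R > norm \<zeta>0" "R > 1" using z0 by (auto simp: R_def)
  have "(C - c) / \<epsilon> \<le> ln R"
    using R by (subst ln_ge_iff) (auto simp: R_def)
  hence growR: "\<delta> * ln R + C \<le> c + D * ln R"
    using e by (simp add: D_def field_simps)
  \<comment> \<open>Small enough that the quadratic term stays below the surplus \<open>t\<close> at \<open>\<zeta>0\<close> on both boundary circles.\<close>
  define \<epsilon>' where "\<epsilon>' = t / R\<^sup>2"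
  have e': "\<epsilon>' > 0" "\<epsilon>' * R\<^sup>2 = t" using t R by (auto simp: \<epsilon>'_def)
  define h where "h \<zeta> = - c - D * ln (norm \<zeta>) + \<epsilon>' * (norm \<zeta>)\<^sup>2" for \<zeta> :: complex
  define X where "X = cball 0 R - ball (0::complex) 1"
  have X: "compact X" "\<zeta>0 \<in> X"
    using z0 R unfolding X_def by (auto intro!: compact_diff)
  have uscf: "eventually (\<lambda>w. f w < y) (nhds \<zeta>)" if "f \<zeta> < y" for \<zeta> y
  proof -
    have "filterlim (\<lambda>\<zeta>. b + \<zeta> *s d) (nhds (b + \<zeta> *s d)) (nhds \<zeta>)"
      by (intro tendsto_intros filterlim_ident)
    from eventually_compose_filterlim[OF psh_on_usc[OF psh, of "b + \<zeta> *s d" y] this]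
    show ?thesis using that unfolding f_def by simp
  qed
  have "\<exists>p\<in>X. \<forall>\<zeta>\<in>X. f \<zeta> + ereal (h \<zeta>) \<le> f p + ereal (h p)"
  proof (rule usc_attains_max)
    fix \<zeta> y assume "\<zeta> \<in> X" "f \<zeta> + ereal (h \<zeta>) < y"
    thus "eventually (\<lambda>w. f w + ereal (h w) < y) (nhds \<zeta>)"
      by (intro usc_add_continuous uscf) (auto simp: h_def X_def intro!: continuous_intros)
  qed (use X in auto)
  then obtain p where p: "p \<in> X" and
    pmax: "\<And>\<zeta>. \<zeta> \<in> X \<Longrightarrow> f \<zeta> + ereal (h \<zeta>) \<le> f p + ereal (h p)" by blast
  have "ereal t < f \<zeta>0 + ereal (h \<zeta>0)"
  proof -
    have "ereal t \<le> ereal (c + D * ln (norm \<zeta>0) + t) + ereal (h \<zeta>0)"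
      using e' by (simp add: h_def)
    also have "\<dots> < f \<zeta>0 + ereal (h \<zeta>0)"
      using f0 by (cases "f \<zeta>0") auto
    finally show ?thesis .
  qed
  also have "\<dots> \<le> f p + ereal (h p)" using X(2) by (rule pmax)
  finally have pt: "ereal t < f p + ereal (h p)" .
  have "f p < \<infinity>" using psh by (simp add: f_def psh_on_def)
  then obtain P where P: "f p = ereal P" using pt by (cases "f p") auto
  have p1: "norm p \<noteq> 1"
  proof
    assume n: "norm p = 1"
    have "f p \<le> ereal c" using c[OF n] by (simp add: f_def)
    hence "t < \<epsilon>'" using pt P n by (simp add: h_def)
    thus False using e' t R by (metis less_le_not_le mult_le_cancel_left1 one_le_power order_less_imp_le)
  qed
  have pR: "norm p \<noteq> R"
  proof
    assume n: "norm p = R"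
    have "f p \<le> ereal (\<delta> * ln R + C)" using C[of p] n R by simp
    hence "P \<le> c + D * ln R" using P growR by simp
    hence "t < \<epsilon>' * R\<^sup>2" using pt P n by (simp add: h_def)
    thus False using e' by simp
  qed
  have pn: "norm p > 1" "norm p < R" using p p1 pR by (auto simp: X_def)
  define \<rho> where "\<rho> = min (norm p - 1) (R - norm p)"
  have \<rho>: "\<rho> > 0" "\<rho> < norm p" "\<rho> \<le> norm p - 1" "\<rho> \<le> R - norm p" using pn by (auto simp: \<rho>_def)
  define g where "g \<theta> = P + (D * ln (norm (p + cis \<theta> * of_real \<rho>)) + (- D * ln (norm p) + (- \<epsilon>' * \<rho>\<^sup>2
      + - 2 * \<epsilon>' * \<rho> * Re (cnj p * cis \<theta>))))" for \<theta>
  have cl: "continuous_on S (\<lambda>\<theta>. ln (norm (p + cis \<theta> * of_real \<rho>)))" for S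
    using \<rho> by (intro continuous_ln_norm_circle) auto
  have "f p \<le> ereal (circle_average g)"
    unfolding f_def
  proof (rule psh_on_submean[OF psh, of _ "of_real \<rho> *s d"])
    show "continuous_on {0..2*pi} g"
      unfolding g_def by (intro continuous_intros cl)
    fix \<theta>
    define q where "q = p + cis \<theta> * of_real \<rho>"
    have nq: "(norm q)\<^sup>2 = (norm p)\<^sup>2 + \<rho>\<^sup>2 + 2 * \<rho> * Re (cnj p * cis \<theta>)"
    proof -
      have "(norm q)\<^sup>2 = (Re p + cos \<theta> * \<rho>)\<^sup>2 + (Im p + sin \<theta> * \<rho>)\<^sup>2"
        by (simp add: q_def cmod_power2)
      also have "\<dots> = (Re p)\<^sup>2 + (Im p)\<^sup>2 + \<rho>\<^sup>2 * ((sin \<theta>)\<^sup>2 + (cos \<theta>)\<^sup>2) + 2 * \<rho> * (Re p * cos \<theta> + Im p * sin \<theta>)"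
        by algebra
      finally show ?thesis by (simp add: cmod_power2)
    qed
    have "norm q \<le> norm p + \<rho>" "norm q \<ge> norm p - \<rho>"
      using norm_triangle_ineq[of p "cis \<theta> * of_real \<rho>"] norm_diff_ineq[of p "cis \<theta> * of_real \<rho>"] \<rho>
      by (auto simp: q_def norm_mult)
    hence "q \<in> X" using \<rho> by (auto simp: X_def)
    hence "f q + ereal (h q) \<le> ereal (P + h p)" using pmax[of q] P by simp
    hence "f q \<le> ereal (P + h p - h q)" by (cases "f q") auto
    also have "P + h p - h q = g \<theta>"
      using nq by (simp add: h_def g_def q_def[symmetric] algebra_simps)
    also have "f q = u (b + p *s d + cis \<theta> *s (of_real \<rho> *s d))"
      by (simp add: f_def q_def vector_smult_assoc add.assoc vec.scale_left_distrib)
    finally show "u (b + p *s d + cis \<theta> *s (of_real \<rho> *s d)) \<le> ereal (g \<theta>)" .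
  qed auto
  also have "circle_average g = P - \<epsilon>' * \<rho>\<^sup>2"
  proof -
    have ln: "circle_average (\<lambda>\<theta>. ln (norm (p + cis \<theta> * of_real \<rho>))) = ln (norm p)"
      using \<rho> by (intro circle_average_ln_norm) auto
    have "circle_average g = P + (D * ln (norm p) + (- D * ln (norm p) + (- \<epsilon>' * \<rho>\<^sup>2
      + - 2 * \<epsilon>' * \<rho> * 0)))"
      unfolding g_def
      by (simp only: circle_average_add circle_average_cmult circle_average_const circle_average_Re ln
          continuous_intros cl)
    thus ?thesis by simp
  qed
  finally have "\<epsilon>' * \<rho>\<^sup>2 \<le> 0" using P by simp
  thus False using e' \<rho> by (simp add: mult_le_0_iff)
qed

text \<open>
  The inequality on the line through \<open>c\<close> and \<open>z\<close>, read at the point \<open>z\<close>: if \<open>z\<close> lies in the dilation with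
  factor \<open>r\<close> and centre \<open>c\<close> of a circled set on which \<open>u \<le> B\<close>, then \<open>u z \<le> B + \<delta> ln r\<close>.
\<close>

lemma lelong_class_rescale:
  assumes "u \<in> lelong_class \<delta>" "\<delta> \<ge> 0" "r \<ge> 1"
    and "\<And>\<zeta>. norm \<zeta> = 1 \<Longrightarrow> u (c + (\<zeta> / of_real r) *s (z - c)) \<le> ereal B"
  shows "u z \<le> ereal (B + \<delta> * ln r)"
proof -
  have "u (c + of_real r *s ((1 / of_real r) *s (z - c))) \<le> ereal (B + \<delta> * ln (norm (complex_of_real r)))"
    using assms by (intro bernstein_walsh_line) (auto simp: vector_smult_assoc)
  thus ?thesis using assms(3) by (simp add: vector_smult_assoc)
qed

section \<open>Pluripolar and plurithin sets\<close>

text \<open>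
  The circle with centre \<open>z\<close> through \<open>q\<close> contains an arc on which \<open>u\<close> is \<open>-\<infinity>\<close>, and \<open>u\<close> is bounded above on the
  whole circle, so the arc bound tends to \<open>-\<infinity>\<close>.
\<close>

lemma psh_on_minus_infinity_spreads:
  assumes psh: "psh_on U u" and q: "q \<in> interior {z \<in> U. u z = -\<infinity>}"
    and sub: "ball q (2 * \<rho>) \<subseteq> U" and z: "z \<in> ball q \<rho>"
  shows "u z = -\<infinity>"
proof -
  define b where "b = q - z"
  have disc: "z + \<zeta> *s b \<in> U" if "norm \<zeta> \<le> 1" for \<zeta>
  proof -
    have "q - (z + \<zeta> *s b) = (1 - \<zeta>) *s b" by (simp add: b_def vec.scale_left_diff_distrib)
    hence "dist q (z + \<zeta> *s b) = norm (1 - \<zeta>) * norm b" by (simp only: dist_norm norm_vector_smult)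
    also have "\<dots> \<le> 2 * norm b"
      using that norm_triangle_ineq4[of 1 \<zeta>] by (intro mult_right_mono) auto
    also have "\<dots> < 2 * \<rho>" using z by (simp add: b_def dist_norm)
    finally show ?thesis using sub by auto
  qed
  have lim: "((\<lambda>\<theta>. z + cis \<theta> *s b) \<longlongrightarrow> z + cis \<theta>0 *s b) (nhds \<theta>0)" for \<theta>0
    by (intro tendsto_intros filterlim_ident)
  have "\<exists>p\<in>{0..2*pi}. \<forall>\<theta>\<in>{0..2*pi}. u (z + cis \<theta> *s b) \<le> u (z + cis p *s b)"
  proof (rule usc_attains_max)
    fix \<theta> y assume "u (z + cis \<theta> *s b) < y"
    thus "eventually (\<lambda>w. u (z + cis w *s b) < y) (nhds \<theta>)"
      using eventually_compose_filterlim[OF psh_on_usc[OF psh disc] lim] by simp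
  qed auto
  then obtain p where p: "\<And>\<theta>. \<theta> \<in> {0..2*pi} \<Longrightarrow> u (z + cis \<theta> *s b) \<le> u (z + cis p *s b)" by blast
  have "u (z + cis p *s b) < \<infinity>" using psh disc by (simp add: psh_on_def)
  then obtain M where M: "u (z + cis p *s b) \<le> ereal M" by (cases "u (z + cis p *s b)") auto
  have "eventually (\<lambda>\<theta>. z + cis \<theta> *s b \<in> interior {z \<in> U. u z = -\<infinity>}) (nhds 0)"
    using lim[of 0] q by (auto simp: b_def elim!: topological_tendstoD)
  then obtain d where d: "d > 0" "\<And>\<theta>. dist \<theta> 0 < d \<Longrightarrow> z + cis \<theta> *s b \<in> interior {z \<in> U. u z = -\<infinity>}"
    by (auto simp: eventually_nhds_metric)
  define \<alpha> where "\<alpha> = min (d / 2) pi"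
  have \<alpha>: "\<alpha> > 0" "\<alpha> \<le> 2 * pi" using d(1) pi_gt_zero by (auto simp: \<alpha>_def min_def)
  have low: "u (z + cis \<theta> *s b) = -\<infinity>" if "\<theta> \<in> {0..\<alpha>}" for \<theta>
    using d(2)[of \<theta>] that d(1) interior_subset[of "{z \<in> U. u z = -\<infinity>}"] by (auto simp: \<alpha>_def)
  have "u z \<le> ereal B" for B
  proof -
    \<comment> \<open>The value on the arc for which the arc bound is exactly \<open>B\<close>.\<close>
    define m where "m = M + (B - M) * (2 * pi / \<alpha>)"
    have "u z \<le> ereal (M + (m - M) * (\<alpha> / (2 * pi)))"
      by (rule psh_on_arc_bound[OF psh disc]) (use \<alpha> low p M in \<open>auto intro: order_trans\<close>)
    thus ?thesis using \<alpha> by (simp add: m_def)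
  qed
  thus ?thesis by (metis ereal_bot)
qed

text \<open>
  The interior of the \<open>-\<infinity>\<close> locus is open by definition and relatively closed because \<open>-\<infinity>\<close> spreads over
  balls of a fixed proportion; in a connected open set it is therefore empty or everything.
\<close>

lemma not_pluripolar_if_ball_subset:
  assumes "ball c s \<subseteq> E" "s > 0"
  shows "\<not> pluripolar E"
proof
  assume "pluripolar E"
  have "c \<in> E" using assms by auto
  have "\<exists>U u. open U \<and> connected U \<and> c \<in> U \<and> psh_on U u \<and> (\<exists>z\<in>U. u z \<noteq> -\<infinity>) \<and>
      (\<forall>z\<in>E \<inter> U. u z = -\<infinity>)"
    using \<open>pluripolar E\<close> \<open>c \<in> E\<close> unfolding pluripolar_def by (rule bspec)
  then obtain U u where U: "open U" "connected U" "c \<in> U" and psh: "psh_on U u"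
    and ne: "\<exists>z\<in>U. u z \<noteq> -\<infinity>" and inf: "\<forall>z\<in>E \<inter> U. u z = -\<infinity>"
    by (elim exE conjE) (rule that)
  define W where "W = interior {z \<in> U. u z = -\<infinity>}"
  have "open (ball c s \<inter> U)" using U(1) by auto
  moreover have "ball c s \<inter> U \<subseteq> {z \<in> U. u z = -\<infinity>}" using assms inf by auto
  ultimately have "ball c s \<inter> U \<subseteq> W" unfolding W_def by (rule interior_maximal[rotated])
  hence cW: "c \<in> W" using U(3) assms(2) by auto
  have WU: "W \<subseteq> U" using interior_subset by (force simp: W_def)
  have "p \<in> W" if p: "p \<in> U" "p \<in> closure W" for p
  proof -
    obtain r where r: "r > 0" "ball p r \<subseteq> U" using U(1) p(1) openE by blast
    obtain q where q: "q \<in> W" "dist q p < r / 4"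
      using closure_approachable[THEN iffD1, OF p(2), rule_format, of "r / 4"] r(1) by auto
    have "ball q (2 * (r / 3)) \<subseteq> ball p r"
    proof
      fix x assume "x \<in> ball q (2 * (r / 3))"
      thus "x \<in> ball p r" using q(2) r(1) dist_triangle[of p x q] by (auto simp: dist_commute)
    qed
    hence "ball q (2 * (r / 3)) \<subseteq> U" using r(2) by auto
    hence "u z = -\<infinity>" if "z \<in> ball q (r / 3)" for z
      using psh_on_minus_infinity_spreads[OF psh q(1)[unfolded W_def] _ that] by blast
    hence "ball q (r / 3) \<subseteq> {z \<in> U. u z = -\<infinity>}"
      using \<open>ball q (2 * (r / 3)) \<subseteq> U\<close> r(1) subset_ball[of "r / 3" "2 * (r / 3)" q] by auto
    hence "ball q (r / 3) \<subseteq> W" unfolding W_def by (intro interior_maximal) auto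
    thus "p \<in> W" using q(2) r(1) by auto
  qed
  hence "closedin (top_of_set U) W"
    using WU closure_subset[of W] by (auto simp: closedin_closed intro!: exI[of _ "closure W"])
  moreover have "openin (top_of_set U) W"
    using WU by (simp add: W_def open_subset)
  ultimately have "W = U" using U(2) cW unfolding connected_clopen by blast
  thus False using ne interior_subset[of "{z \<in> U. u z = -\<infinity>}"] by (auto simp: W_def)
qed

text \<open>
  If \<open>u\<close> stayed below \<open>m < u a\<close> on \<open>K\<close> near \<open>a\<close>, a sixth of each small circle around \<open>a\<close> would lie where \<open>u < m\<close>,
  while upper semicontinuity keeps the rest barely above \<open>u a\<close>; the mean would be less than \<open>u a\<close>. No
  capacity estimate is involved, only positive angular density.
\<close>

lemma not_plurithin_at_if_sector:
  assumes "b \<noteq> 0"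
    and sector: "\<And>r \<theta>. 0 < r \<Longrightarrow> r \<le> 1 \<Longrightarrow> \<theta> \<in> {0..pi/3} \<Longrightarrow> a + cis \<theta> *s (of_real r *s b) \<in> K"
  shows "\<not> plurithin_at K a"
proof -
  have nb: "norm b > 0" using assms(1) by simp
  have islim: "a islimpt (K - {a})"
    unfolding islimpt_approachable
  proof (intro allI impI)
    fix e :: real assume e: "e > 0"
    define r where "r = min 1 (e / (2 * norm b))"
    have r: "0 < r" "r \<le> 1" "r * norm b \<le> e / 2" using e nb by (auto simp: r_def min_def field_simps)
    have "a + of_real r *s b \<in> K" using sector[of r 0] r by simp
    moreover have "dist (a + of_real r *s b) a = r * norm b"
      using r by (simp add: dist_norm norm_vector_smult)
    ultimately show "\<exists>x'\<in>K - {a}. x' \<noteq> a \<and> dist x' a < e"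
      using r nb e by (intro bexI[of _ "a + of_real r *s b"]) auto
  qed
  have False if aU: "a \<in> U" and psh: "psh_on U u" and thin: "Limsup (at a within (K - {a})) u < u a" for U u
  proof -
    obtain m where m: "Limsup (at a within (K - {a})) u < ereal m" "ereal m < u a"
      using ereal_dense2[OF thin] by blast
    have "u a < \<infinity>" using psh aU by (simp add: psh_on_def)
    then obtain A where A: "u a = ereal A" using m(2) by (cases "u a") auto
    \<comment> \<open>The excess over \<open>u a\<close> on five sixths of the circle must not outweigh the deficit on one sixth.\<close>
    define M where "M = A + (A - m) / 10"
    have "m < A" using m(2) A by simp
    hence "u a < ereal M" by (simp add: A M_def)
    hence "eventually (\<lambda>z. u z < ereal M) (nhds a)" using psh_on_usc[OF psh aU] by blast
    moreover have "eventually (\<lambda>z. z \<in> K - {a} \<longrightarrow> u z < ereal m) (nhds a)"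
      using Limsup_lessD[OF m(1)] unfolding eventually_at_filter by (rule eventually_mono) auto
    moreover have "eventually (\<lambda>z. z \<in> U) (nhds a)"
      using psh aU by (simp add: psh_on_def eventually_nhds_in_open)
    ultimately have "eventually (\<lambda>z. u z < ereal M \<and> (z \<in> K - {a} \<longrightarrow> u z < ereal m) \<and> z \<in> U) (nhds a)"
      by eventually_elim auto
    then obtain d where d: "d > 0" "\<And>z. dist z a < d \<Longrightarrow> u z < ereal M"
        "\<And>z. dist z a < d \<Longrightarrow> z \<in> K - {a} \<Longrightarrow> u z < ereal m" "\<And>z. dist z a < d \<Longrightarrow> z \<in> U"
      unfolding eventually_nhds_metric by blast
    define r where "r = min 1 (d / (2 * norm b))"
    have r: "0 < r" "r \<le> 1" "r * norm b \<le> d / 2" using d(1) nb by (auto simp: r_def min_def field_simps)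
    have near: "dist (a + \<zeta> *s (of_real r *s b)) a < d" if "norm \<zeta> \<le> 1" for \<zeta>
    proof -
      have "dist (a + \<zeta> *s (of_real r *s b)) a = norm \<zeta> * (r * norm b)"
        using r by (simp add: dist_norm norm_vector_smult norm_mult del: vector_smult_assoc)
      also have "\<dots> \<le> 1 * (r * norm b)" using that r nb by (intro mult_right_mono) auto
      finally show ?thesis using r d(1) by simp
    qed
    have ne: "a + cis \<theta> *s (of_real r *s b) \<noteq> a" for \<theta>
    proof -
      have "norm (cis \<theta> *s (of_real r *s b)) = r * norm b"
        using r by (simp add: norm_vector_smult norm_mult del: vector_smult_assoc)
      thus ?thesis using r nb by (metis add_cancel_left_right mult_pos_pos norm_zero order_less_irrefl)
    qed
    have "u a \<le> ereal (M + (m - M) * (pi / 3 / (2 * pi)))"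
    proof (rule psh_on_arc_bound[OF psh])
      fix \<theta> assume "\<theta> \<in> {0..pi/3}"
      hence "a + cis \<theta> *s (of_real r *s b) \<in> K - {a}" using sector[OF r(1,2)] ne by blast
      thus "u (a + cis \<theta> *s (of_real r *s b)) \<le> ereal m"
        using d(3)[OF near[of "cis \<theta>"]] by (simp add: less_imp_le)
    next
      fix \<theta>
      show "u (a + cis \<theta> *s (of_real r *s b)) \<le> ereal M"
        using d(2)[OF near[of "cis \<theta>"]] by (simp add: less_imp_le)
    qed (use d(4) near in \<open>auto simp del: vector_smult_assoc\<close>)
    hence "A \<le> M + (m - M) / 6" by (simp add: A)
    thus False using \<open>m < A\<close> by (simp add: M_def field_simps)
  qed
  thus ?thesis using islim unfolding plurithin_at_def by blast
qed

section \<open>Upper regularization and locally pluriregular points\<close>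

lemma usc_reg_ge: "f a \<le> usc_reg f a"
  unfolding usc_reg_def
  by (rule Limsup_greatest) (auto intro!: SUP_upper dest: eventually_nhds_x_imp_x)

lemma usc_reg_ge_frequently:
  assumes "frequently (\<lambda>z. y \<le> f z) (nhds a)"
  shows "y \<le> usc_reg f a"
  unfolding usc_reg_def
proof (rule Limsup_greatest)
  fix P assume "eventually P (nhds a)"
  hence "\<exists>z. y \<le> f z \<and> P z"
    using frequently_ex[OF frequently_eventually_frequently[OF assms]] by blast
  thus "y \<le> (SUP x\<in>Collect P. f x)" by (auto intro: SUP_upper2)
qed

lemma usc_reg_le:
  assumes "\<And>e. e > 0 \<Longrightarrow> eventually (\<lambda>z. f z \<le> ereal (y + e)) (nhds a)"
  shows "usc_reg f a \<le> ereal y"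
proof (rule ereal_le_epsilon2)
  fix e :: real assume "e > 0"
  from Limsup_bounded[OF assms[OF this]] show "usc_reg f a \<le> ereal y + ereal e"
    by (simp add: usc_reg_def)
qed

lemma lelong_class_const: "\<delta> \<ge> 0 \<Longrightarrow> (\<lambda>z. ereal c) \<in> lelong_class \<delta>"
  unfolding lelong_class_def
  by (auto intro!: psh_cont_imp_psh_on psh_cont_const exI[of _ c] simp: log_plus_eq_ln_max)

text \<open>
  A point near the polydisc lies in its dilation by \<open>1 + e\<close>, so every competitor is at most \<open>ln (1 + e)\<close> there.
\<close>

lemma extremal_fun_reg_polydisc:
  fixes a c :: "complex ^ 'n::finite"
  assumes t: "t > 0" and sub: "{z. \<forall>j. norm (z $ j - c $ j) \<le> t} \<subseteq> E"
    and a: "\<And>j. norm (a $ j - c $ j) \<le> t"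
  shows "extremal_fun_reg 1 E (\<lambda>_. 0) a = 0"
proof (rule antisym)
  have "usc_reg (extremal_fun 1 E (\<lambda>_. 0)) a \<le> ereal 0"
  proof (rule usc_reg_le)
    fix e :: real assume e: "e > 0"
    have "eventually (\<lambda>z. dist z a < t * e) (nhds a)"
      unfolding eventually_nhds_metric using mult_pos_pos[OF t e] by blast
    thus "eventually (\<lambda>z. extremal_fun 1 E (\<lambda>_. 0) z \<le> ereal (0 + e)) (nhds a)"
    proof eventually_elim
      case (elim z)
      have z: "norm (z $ j - c $ j) \<le> t * (1 + e)" for j
      proof -
        have "norm (z $ j - c $ j) \<le> norm ((z - a) $ j) + norm (a $ j - c $ j)"
          using norm_triangle_ineq[of "z $ j - a $ j" "a $ j - c $ j"] by simp
        also have "norm ((z - a) $ j) \<le> t * e"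
          using elim Finite_Cartesian_Product.norm_nth_le[of "z - a" j] by (simp add: dist_norm)
        finally show ?thesis using a[of j] by (simp add: algebra_simps)
      qed
      show ?case
        unfolding extremal_fun_def
      proof (rule SUP_least)
        fix u assume u: "u \<in> {u \<in> lelong_class 1. \<forall>w\<in>E. u w \<le> ereal 0}"
        have "u z \<le> ereal (0 + 1 * ln (1 + e))"
        proof (rule lelong_class_rescale)
          fix \<zeta> :: complex assume \<zeta>: "norm \<zeta> = 1"
          have "c + (\<zeta> / of_real (1 + e)) *s (z - c) \<in> E"
          proof (rule subsetD[OF sub], rule CollectI, rule allI)
            fix j
            have "norm ((c + (\<zeta> / of_real (1 + e)) *s (z - c)) $ j - c $ j) = norm (z $ j - c $ j) / (1 + e)"
              using \<zeta> e by (simp only: vector_add_component vector_smult_component vector_minus_component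
                  add_diff_cancel_left' norm_mult norm_divide norm_of_real) simp
            also have "\<dots> \<le> t" using z[of j] e by (simp add: field_simps)
            finally show "norm ((c + (\<zeta> / of_real (1 + e)) *s (z - c)) $ j - c $ j) \<le> t" .
          qed
          thus "u (c + (\<zeta> / of_real (1 + e)) *s (z - c)) \<le> ereal 0" using u by blast
        qed (use u e in auto)
        also have "ln (1 + e) \<le> e" using e by (simp add: ln_add_one_self_le_self)
        finally show "u z \<le> ereal (0 + e)" by simp
      qed
    qed
  qed
  thus "extremal_fun_reg 1 E (\<lambda>_. 0) a \<le> 0" by (simp add: extremal_fun_reg_def zero_ereal_def)
  have "(0::ereal) \<le> extremal_fun 1 E (\<lambda>_. 0) a"
    unfolding extremal_fun_def
    by (rule SUP_upper2[of "\<lambda>_. ereal 0"]) (auto intro: lelong_class_const)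
  also have "\<dots> \<le> extremal_fun_reg 1 E (\<lambda>_. 0) a"
    unfolding extremal_fun_reg_def by (rule usc_reg_ge)
  finally show "0 \<le> extremal_fun_reg 1 E (\<lambda>_. 0) a" .
qed

section \<open>Smooth functions\<close>

text \<open>
  The derivatives of \<open>exp (- 1/x) / 4\<close> on \<open>x > 0\<close> are \<open>P (1/x) * exp (- 1/x)\<close> for polynomials \<open>P\<close>. The
  factor \<open>1/4\<close> makes the first derivative at most \<open>1/2\<close>, which the monotonicity of the weight needs.
\<close>

primrec flat_poly :: "nat \<Rightarrow> real poly" where
  "flat_poly 0 = [:1/4:]"
| "flat_poly (Suc k) = [:0, 0, 1:] * (flat_poly k - pderiv (flat_poly k))"

definition flat :: "nat \<Rightarrow> real \<Rightarrow> real" where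
  "flat k x = (if x > 0 then poly (flat_poly k) (1 / x) * exp (- (1 / x)) else 0)"

lemma poly_times_exp_minus_tendsto_0: "((\<lambda>y::real. poly p y * exp (- y)) \<longlongrightarrow> 0) at_top"
proof -
  have "((\<lambda>y::real. \<Sum>i\<le>degree p. coeff p i * (y ^ i / exp y)) \<longlongrightarrow> (\<Sum>i\<le>degree p. coeff p i * 0)) at_top"
    by (intro tendsto_intros tendsto_power_div_exp_0)
  thus ?thesis by (simp add: poly_altdef sum_distrib_right exp_minus field_simps sum_divide_distrib)
qed

lemma flat_has_derivative: "(flat k has_real_derivative flat (Suc k) x) (at x)"
proof -
  consider "x > 0" | "x < 0" | "x = 0" by linarith
  thus ?thesis
  proof cases
    case 1
    have "((\<lambda>x. poly (flat_poly k) (1 / x) * exp (- (1 / x))) has_real_derivative flat (Suc k) x) (at x)"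
      using 1 by (auto intro!: derivative_eq_intros simp: flat_def field_simps power2_eq_square)
    thus ?thesis
      by (rule has_field_derivative_transform_within_open[of _ _ _ "{0<..}"]) (use 1 in \<open>auto simp: flat_def\<close>)
  next
    case 2
    have "((\<lambda>x. 0) has_real_derivative 0) (at x)" by simp
    hence "(flat k has_real_derivative 0) (at x)"
      by (rule has_field_derivative_transform_within_open[of _ _ _ "{..<0}"]) (use 2 in \<open>auto simp: flat_def\<close>)
    thus ?thesis using 2 by (simp add: flat_def)
  next
    case 3
    have "((\<lambda>h. poly (pCons 0 (flat_poly k)) (inverse h) * exp (- inverse h)) \<longlongrightarrow> 0) (at_right (0::real))"
      by (rule filterlim_compose[OF poly_times_exp_minus_tendsto_0 filterlim_inverse_at_top_right])
    hence "((\<lambda>h. flat k h / h) \<longlongrightarrow> 0) (at_right 0)"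
      by (rule Lim_transform_eventually) (auto simp: eventually_at_filter flat_def field_simps)
    moreover have "((\<lambda>h. flat k h / h) \<longlongrightarrow> 0) (at_left 0)"
      by (rule tendsto_eventually) (auto simp: eventually_at_filter flat_def)
    ultimately have "((\<lambda>h. flat k h / h) \<longlongrightarrow> 0) (at 0)"
      by (simp add: filterlim_split_at)
    thus ?thesis using 3 by (simp add: DERIV_def flat_def)
  qed
qed

lemma C_times_Suc_imp: "C_times (Suc k) f \<Longrightarrow> C_times k f"
proof (induction k arbitrary: f)
  case 0
  thus ?case by (auto intro!: differentiable_imp_continuous_on simp: differentiable_on_def)
qed auto

lemma C_times_add: "C_times k f \<Longrightarrow> C_times k g \<Longrightarrow> C_times k (\<lambda>x. f x + g x)"
proof (induction k arbitrary: f g)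
  case 0
  thus ?case by (auto intro: continuous_intros)
next
  case (Suc k)
  have "frechet_derivative (\<lambda>x. f x + g x) (at x) v
      = frechet_derivative f (at x) v + frechet_derivative g (at x) v" for x v
    using Suc.prems by (subst frechet_derivative_at[symmetric, OF has_derivative_add])
      (auto simp: frechet_derivative_works[symmetric])
  thus ?case using Suc by auto
qed

lemma C_times_const: "C_times k (\<lambda>x. c)"
  by (induction k arbitrary: c) auto

lemma C_times_bounded_linear:
  assumes "bounded_linear f"
  shows "C_times k f"
proof (cases k)
  case 0
  thus ?thesis using assms by (simp add: linear_continuous_on)
next
  case (Suc k')
  have "(f has_derivative f) (at x)" for x
    using assms by (rule bounded_linear_imp_has_derivative)
  hence "frechet_derivative f (at x) = f" for x
    using frechet_derivative_at by metis
  thus ?thesis using Suc bounded_linear_imp_differentiable[OF assms] by (simp add: C_times_const)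
qed

lemma C_times_mult:
  fixes f g :: "'a::euclidean_space \<Rightarrow> real"
  shows "C_times k f \<Longrightarrow> C_times k g \<Longrightarrow> C_times k (\<lambda>x. f x * g x)"
proof (induction k arbitrary: f g)
  case 0
  thus ?case by (auto intro: continuous_intros)
next
  case (Suc k)
  have "frechet_derivative (\<lambda>x. f x * g x) (at x) v
      = f x * frechet_derivative g (at x) v + frechet_derivative f (at x) v * g x" for x v
    using Suc.prems by (subst frechet_derivative_at[symmetric, OF has_derivative_mult])
      (auto simp: frechet_derivative_works[symmetric])
  moreover have "C_times k f" "C_times k g" using Suc.prems by (auto intro: C_times_Suc_imp)
  ultimately show ?case using Suc.prems
    by (auto intro!: C_times_add Suc.IH differentiable_mult)
qed

lemma C_times_sum:
  assumes "\<And>i. i \<in> I \<Longrightarrow> C_times k (f i)"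
  shows "C_times k (\<lambda>x. \<Sum>i\<in>I. f i x)"
  using assms by (induction I rule: infinite_finite_induct) (auto intro: C_times_const C_times_add)

text \<open>
  Here \<open>D\<close> is a sequence of successive derivatives on \<open>S\<close>. The induction on \<open>k\<close> runs over all \<open>j\<close> at once,
  because the chain rule replaces \<open>D j\<close> by \<open>D (Suc j)\<close>.
\<close>

lemma C_times_compose:
  fixes u :: "'a::euclidean_space \<Rightarrow> real"
  assumes D: "\<And>j x. x \<in> S \<Longrightarrow> (D j has_real_derivative D (Suc j) x) (at x)"
    and u: "\<And>x. u x \<in> S"
  shows "C_times k u \<Longrightarrow> C_times k (\<lambda>x. D j (u x))"
proof (induction k arbitrary: j)
  case 0
  have "isCont (D j) (u x)" for x using D[OF u] by (rule DERIV_isCont)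
  thus ?case using 0 by (auto simp: continuous_on_eq_continuous_at intro: isCont_o2)
next
  case (Suc k)
  have deriv: "((\<lambda>x. D j (u x)) has_derivative (\<lambda>v. D (Suc j) (u x) * frechet_derivative u (at x) v)) (at x)" for x
  proof -
    have "(u has_derivative frechet_derivative u (at x)) (at x)"
      using Suc.prems by (simp add: frechet_derivative_works[symmetric])
    moreover have "(D j has_derivative (*) (D (Suc j) (u x))) (at (u x))"
      using D[OF u] by (simp add: has_field_derivative_def)
    ultimately show ?thesis by (rule has_derivative_compose)
  qed
  have "C_times k (\<lambda>x. D (Suc j) (u x) * frechet_derivative u (at x) v)" for v
    using Suc.prems Suc.IH[of "Suc j"] C_times_Suc_imp[OF Suc.prems] by (intro C_times_mult) auto
  thus ?case
    using deriv by (auto simp: frechet_derivative_at[OF deriv, symmetric] differentiable_def)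
qed

lemma C_times_norm_squared: "C_times k (\<lambda>x::'a::euclidean_space. (norm x)\<^sup>2)"
proof -
  have "(norm x)\<^sup>2 = (\<Sum>b\<in>Basis. (x \<bullet> b) * (x \<bullet> b))" for x :: 'a
    by (metis euclidean_inner power2_norm_eq_inner)
  thus ?thesis
    by (simp only:) (intro C_times_sum C_times_mult C_times_bounded_linear bounded_linear_inner_left)
qed

section \<open>The weight\<close>

text \<open>
  A smooth positive modification of \<open>t\<close> on \<open>[0, 1]\<close> that agrees with \<open>t\<close> on \<open>[1, \<infinity>)\<close>. Its logarithm
  replaces \<open>ln t\<close>. No real-analytic choice is possible: the Hessian determinant of the weight vanishes on an open
  set, but its total Monge-Ampere mass is positive.
\<close>

definition cutoff :: "real \<Rightarrow> real" where "cutoff t = t + flat 0 (1 - t)"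
definition rlog :: "real \<Rightarrow> real" where "rlog t = ln (cutoff t)"
definition rlog' :: "real \<Rightarrow> real" where "rlog' t = (1 - flat 1 (1 - t)) / cutoff t"
definition rlog'' :: "real \<Rightarrow> real" where
  "rlog'' t = (flat 2 (1 - t) * cutoff t - (1 - flat 1 (1 - t))\<^sup>2) / (cutoff t)\<^sup>2"

lemma flat_nonpos: "x \<le> 0 \<Longrightarrow> flat k x = 0" by (simp add: flat_def)

lemma flat_0_pos: "x > 0 \<Longrightarrow> flat 0 x > 0" by (simp add: flat_def)

lemma flat_1_eq: "flat 1 x = flat 0 x / x\<^sup>2"
  by (simp add: flat_def power2_eq_square)

lemma flat_2_eq: "flat 2 x = flat 0 x * (1 - 2 * x) / x ^ 4"
  by (simp add: flat_def numeral_2_eq_2 pderiv_pCons field_simps power_numeral_reduce)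

lemma flat_0_le: "flat 0 x \<le> x\<^sup>2 / 2"
proof (cases "x > 0")
  case True
  have "(1 / x)\<^sup>2 / 2 \<le> exp (1 / x)"
    using exp_lower_Taylor_quadratic[of "1 / x"] True by (smt (verit) divide_nonneg_pos zero_le_one)
  hence "1 \<le> 2 * x\<^sup>2 * exp (1 / x)" using True by (simp add: field_simps power2_eq_square)
  thus ?thesis using True by (simp add: flat_def exp_minus field_simps)
qed (simp add: flat_nonpos)

lemma flat_1_le: "flat 1 x \<le> 1 / 2"
proof (cases "x = 0")
  case False
  thus ?thesis using flat_0_le[of x] unfolding flat_1_eq by (simp add: field_simps)
qed (simp add: flat_def)

lemma cutoff_pos: "t \<ge> 0 \<Longrightarrow> cutoff t > 0"
  using flat_0_pos[of "1 - t"] by (cases "t < 1") (auto simp: cutoff_def flat_nonpos)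

lemma cutoff_ge_1: "t \<ge> 1 \<Longrightarrow> cutoff t = t"
  by (simp add: cutoff_def flat_nonpos)

lemma cutoff_has_derivative: "(cutoff has_real_derivative 1 - flat 1 (1 - t)) (at t)"
  unfolding cutoff_def
  by (auto intro!: derivative_eq_intros DERIV_chain2[OF flat_has_derivative])

lemma rlog_has_derivative: "t \<ge> 0 \<Longrightarrow> (rlog has_real_derivative rlog' t) (at t)"
  unfolding rlog_def[abs_def] rlog'_def using cutoff_pos[of t]
  by (auto intro!: derivative_eq_intros cutoff_has_derivative)

lemma rlog'_has_derivative: "t \<ge> 0 \<Longrightarrow> (rlog' has_real_derivative rlog'' t) (at t)"
  unfolding rlog'_def[abs_def] rlog''_def using cutoff_pos[of t]
  by (auto intro!: derivative_eq_intros cutoff_has_derivative DERIV_chain2[OF flat_has_derivative]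
      simp: power2_eq_square numeral_2_eq_2)

lemma rlog'_pos: "t \<ge> 0 \<Longrightarrow> rlog' t > 0"
  using cutoff_pos[of t] flat_1_le[of "1 - t"] by (simp add: rlog'_def)

text \<open>
  With \<open>t = exp s\<close>, this is the second derivative of \<open>rlog (exp s)\<close>, divided by \<open>exp s\<close>: the composition is convex,
  so \<open>rlog ((norm z)\<^sup>2)\<close> is plurisubharmonic. For \<open>t < 1/2\<close> the flat function is concave in the relevant range,
  and its negative contribution is absorbed by the term from the first derivative.
\<close>

lemma rlog_levi_nonneg:
  assumes "t \<ge> 0"
  shows "rlog' t + t * rlog'' t \<ge> 0"
proof (cases "t < 1")
  case False
  thus ?thesis
    by (simp add: rlog'_def rlog''_def flat_nonpos cutoff_ge_1 power2_eq_square field_simps)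
next
  case True
  define x where "x = 1 - t"
  define E where "E = flat 0 x"
  define p where "p = flat 1 x"
  define q where "q = flat 2 x"
  have x: "0 < x" "x \<le> 1" and t: "t = 1 - x" using True assms by (auto simp: x_def)
  have E: "E > 0" "E \<le> x\<^sup>2 / 2" using flat_0_pos flat_0_le x by (auto simp: E_def)
  have p: "p = E / x\<^sup>2" "p \<le> 1 / 2" "p > 0" using flat_1_eq flat_1_le E x by (auto simp: p_def E_def)
  have q: "q = E * (1 - 2 * x) / x ^ 4" using flat_2_eq by (simp add: q_def E_def)
  have main: "(1 - p) * (E + t * p) + t * q * (t + E) \<ge> 0"
  proof (cases "x \<le> 1 / 2")
    case True
    thus ?thesis using E p x t unfolding q by (intro add_nonneg_nonneg mult_nonneg_nonneg) auto
  next
    case False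
    \<comment> \<open>The difference of the two sides is a quadratic polynomial in \<open>x\<close> with minimum \<open>1/10\<close>, at \<open>x = 3/5\<close>.\<close>
    have a: "(1 - x) * (2 * x - 1) \<le> x\<^sup>2 / 2"
      using zero_le_square[of "5 * x - 3"] by (simp add: power2_eq_square algebra_simps)
    have "(1 - x) * (2 * x - 1) * (t + E) \<le> (1 - x) * (2 * x - 1) * (t + x\<^sup>2)"
      using False x E by (intro mult_left_mono mult_nonneg_nonneg add_mono) auto
    also have "\<dots> \<le> x\<^sup>2 / 2 * (t + x\<^sup>2)"
      using a assms by (intro mult_right_mono) auto
    finally have "E / x ^ 4 * ((1 - x) * (2 * x - 1) * (t + E)) \<le> E / x ^ 4 * (x\<^sup>2 / 2 * (t + x\<^sup>2))"
      using E x by (intro mult_left_mono) auto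
    also have "\<dots> = 1 / 2 * (E + t * p)"
      using x by (simp add: p field_simps power2_eq_square power_numeral_reduce)
    also have "\<dots> \<le> (1 - p) * (E + t * p)"
      using p E assms by (intro mult_right_mono) auto
    also have "E / x ^ 4 * ((1 - x) * (2 * x - 1) * (t + E)) = - (t * q * (t + E))"
      using x by (simp add: q t field_simps)
    finally show ?thesis by simp
  qed
  have c: "cutoff t = t + E" "t + E > 0" using cutoff_pos[OF assms] by (auto simp: cutoff_def E_def x_def)
  have frac: "a / s + t * (b / s\<^sup>2) = (a * s + t * b) / s\<^sup>2" if "s \<noteq> 0" for a b s :: real
    using that by (simp add: field_simps power2_eq_square)
  have "rlog' t + t * rlog'' t = ((1 - p) * (t + E) + t * (q * (t + E) - (1 - p)\<^sup>2)) / (t + E)\<^sup>2"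
    unfolding rlog'_def rlog''_def x_def[symmetric] p_def[symmetric] q_def[symmetric] c(1)
    using c(2) by (intro frac) simp
  also have "(1 - p) * (t + E) + t * (q * (t + E) - (1 - p)\<^sup>2) = (1 - p) * (E + t * p) + t * q * (t + E)"
    by (simp add: power2_eq_square algebra_simps)
  finally show ?thesis using main by simp
qed

lemma rlog_ge_1: "t \<ge> 1 \<Longrightarrow> rlog t = ln t" "t \<ge> 1 \<Longrightarrow> rlog' t = 1 / t" "t \<ge> 1 \<Longrightarrow> rlog'' t = - 1 / t\<^sup>2"
  by (auto simp: rlog_def rlog'_def rlog''_def cutoff_ge_1 flat_nonpos)

lemma rlog_mono:
  assumes "0 \<le> s" "s \<le> t"
  shows "rlog s \<le> rlog t"
  using assms(2)
proof (rule DERIV_nonneg_imp_nondecreasing)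
  fix x assume "s \<le> x" "x \<le> t"
  hence "x \<ge> 0" using assms(1) by simp
  thus "\<exists>y. (rlog has_real_derivative y) (at x) \<and> 0 \<le> y"
    using rlog_has_derivative[of x] rlog'_pos[of x] by (auto intro: less_imp_le)
qed

lemma t_rlog'_mono:
  assumes "0 \<le> s" "s \<le> t"
  shows "s * rlog' s \<le> t * rlog' t"
  using assms(2)
proof (rule DERIV_nonneg_imp_nondecreasing)
  fix x assume "s \<le> x" "x \<le> t"
  hence "x \<ge> 0" using assms(1) by simp
  hence "((\<lambda>x. x * rlog' x) has_real_derivative rlog' x + x * rlog'' x) (at x)"
    by (auto intro!: derivative_eq_intros rlog'_has_derivative)
  thus "\<exists>y. ((\<lambda>x. x * rlog' x) has_real_derivative y) (at x) \<and> 0 \<le> y"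
    using rlog_levi_nonneg[OF \<open>x \<ge> 0\<close>] by blast
qed

text \<open>
  The difference \<open>rlog x - a * rlog' a * ln x\<close> has derivative \<open>(x * rlog' x - a * rlog' a) / x\<close>, which changes
  sign from minus to plus at \<open>a\<close>.
\<close>

lemma rlog_supporting_log:
  assumes "a > 0" "b > 0"
  shows "rlog b \<ge> rlog a + a * rlog' a * (ln b - ln a)"
proof -
  define k where "k = a * rlog' a"
  define f where "f x = rlog x - k * ln x" for x
  have d: "(f has_real_derivative rlog' x - k / x) (at x)" if "x > 0" for x
    using that unfolding f_def by (auto intro!: derivative_eq_intros rlog_has_derivative)
  have "f a \<le> f b"
  proof (cases "a \<le> b")
    case True
    thus ?thesis
    proof (rule DERIV_nonneg_imp_nondecreasing)
      fix x assume x: "a \<le> x" "x \<le> b"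
      hence "k \<le> x * rlog' x" using t_rlog'_mono[of a x] assms by (simp add: k_def)
      hence "0 \<le> rlog' x - k / x" using x assms by (simp add: field_simps)
      thus "\<exists>y. (f has_real_derivative y) (at x) \<and> 0 \<le> y" using d[of x] x assms by auto
    qed
  next
    case False
    hence "b \<le> a" by simp
    thus ?thesis
    proof (rule DERIV_nonpos_imp_nonincreasing)
      fix x assume x: "b \<le> x" "x \<le> a"
      hence "x * rlog' x \<le> k" using t_rlog'_mono[of x a] assms by (simp add: k_def)
      hence "rlog' x - k / x \<le> 0" using x assms by (simp add: field_simps)
      thus "\<exists>y. (f has_real_derivative y) (at x) \<and> y \<le> 0" using d[of x] x assms by auto
    qed
  qed
  thus ?thesis by (simp add: f_def k_def algebra_simps)
qed

text \<open>
  It equals \<open>\<tau> ln (norm z)\<close> outside the unit ball, hence is harmonic there on each complex line through the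
  origin: its Levi form degenerates in the radial direction, and functions of growth \<open>\<tau>\<close> that it bounds on the
  unit polydisc cannot exceed it on these lines.
\<close>

definition weight :: "real \<Rightarrow> complex ^ 'n::finite \<Rightarrow> real" where
  "weight \<tau> z = \<tau> / 2 * rlog ((norm z)\<^sup>2)"

lemma weight_outside: "norm z \<ge> 1 \<Longrightarrow> weight \<tau> z = \<tau> * ln (norm z)"
  by (simp add: weight_def rlog_ge_1 ln_realpow)

lemma psh_cont_weight:
  assumes "\<tau> \<ge> 0"
  shows "psh_cont (weight \<tau> :: complex ^ 'n::finite \<Rightarrow> real)"
proof -
  have "psh_cont (\<lambda>z :: complex ^ 'n. (\<lambda>s. rlog (s\<^sup>2)) (norm (id z)))"
  proof (rule psh_cont_radial[where G = id])
    show "continuous_on {0..} (\<lambda>s. rlog (s\<^sup>2))"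
    proof (rule continuous_on_compose2[where g = rlog and t = "{0..}"])
      show "continuous_on {0..} rlog"
        using rlog_has_derivative by (intro continuous_at_imp_continuous_on) (auto intro: DERIV_isCont)
    qed (auto intro!: continuous_intros)
  next
    fix t :: real assume t: "t > 0"
    define k where "k = 2 * (t\<^sup>2 * rlog' (t\<^sup>2))"
    have k: "k > 0" using t rlog'_pos[of "t\<^sup>2"] by (simp add: k_def)
    \<comment> \<open>The truncation at which the supporting logarithm takes the value \<open>rlog 0\<close>, the minimum of the profile.\<close>
    define \<eta> where "\<eta> = exp (ln t - (rlog (t\<^sup>2) - rlog 0) / k)"
    have "rlog (s\<^sup>2) \<ge> rlog (t\<^sup>2) + k * (ln (max \<eta> s) - ln t)" if "s \<ge> 0" for s
    proof (cases "s \<ge> \<eta>")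
      case True
      hence "s > 0" by (simp add: \<eta>_def) (meson exp_gt_zero less_le_trans)
      thus ?thesis using rlog_supporting_log[of "t\<^sup>2" "s\<^sup>2"] t True
        by (simp add: k_def ln_realpow max_def algebra_simps)
    next
      case False
      have "rlog (t\<^sup>2) + k * (ln (max \<eta> s) - ln t) = rlog 0"
        using False k by (simp add: max_def \<eta>_def)
      also have "\<dots> \<le> rlog (s\<^sup>2)" by (rule rlog_mono) auto
      finally show ?thesis .
    qed
    thus "\<exists>\<kappa>\<ge>0. \<exists>\<eta>>0. \<forall>s\<ge>0. rlog (s\<^sup>2) \<ge> rlog (t\<^sup>2) + \<kappa> * (ln (max \<eta> s) - ln t)"
      using k by (intro exI[of _ k] conjI exI[of _ \<eta>]) (auto simp: \<eta>_def)
  qed (auto intro: rlog_mono)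
  from psh_cont_cmult[OF this, of "\<tau> / 2"] assms show ?thesis
    by (simp add: weight_def[abs_def])
qed

lemma continuous_on_weight: "\<tau> \<ge> 0 \<Longrightarrow> continuous_on UNIV (weight \<tau> :: complex ^ 'n::finite \<Rightarrow> real)"
  using psh_cont_weight[where 'n = 'n] by (simp add: psh_cont_def)

lemma weight_in_lelong_class_plus:
  assumes "\<tau> \<ge> 0"
  shows "(\<lambda>z. ereal (weight \<tau> z)) \<in> lelong_class_plus \<tau>"
proof -
  have bounds: "\<tau> / 2 * rlog 0 \<le> weight \<tau> z - \<tau> * log_plus (norm z) \<and> weight \<tau> z - \<tau> * log_plus (norm z) \<le> 0"
    for z :: "complex ^ 'n"
  proof (cases "norm z \<ge> 1")
    case True
    have "rlog 0 \<le> rlog 1" by (rule rlog_mono) auto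
    thus ?thesis using True assms
      by (simp add: weight_outside log_plus_eq_ln_max rlog_ge_1 mult_nonneg_nonpos)
  next
    case False
    have "rlog 0 \<le> rlog ((norm z)\<^sup>2)" "rlog ((norm z)\<^sup>2) \<le> rlog 1"
      using False by (auto intro!: rlog_mono simp: power_le_one)
    thus ?thesis using False assms
      by (auto simp: weight_def log_plus_eq_ln_max rlog_ge_1 mult_nonneg_nonpos mult_left_mono)
  qed
  have "weight \<tau> z \<le> \<tau> * log_plus (norm z) + 0" "weight \<tau> z \<ge> \<tau> * log_plus (norm z) - (- (\<tau> / 2 * rlog 0))"
    for z :: "complex ^ 'n"
    using bounds[of z] by auto
  hence "(\<forall>z :: complex ^ 'n. ereal (weight \<tau> z) \<le> ereal (\<tau> * log_plus (norm z) + 0)) \<and>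
      (\<forall>z :: complex ^ 'n. ereal (weight \<tau> z) \<ge> ereal (\<tau> * log_plus (norm z) - (- (\<tau> / 2 * rlog 0))))"
    by (simp only: ereal_less_eq) blast
  thus ?thesis
    unfolding lelong_class_plus_def lelong_class_def
    using psh_cont_imp_psh_on[OF psh_cont_weight[OF assms]] by blast
qed

lemma C_infinity_weight: "C_infinity (weight \<tau> :: complex ^ 'n::finite \<Rightarrow> real)"
  unfolding C_infinity_def
proof
  fix k
  define L :: "nat \<Rightarrow> real \<Rightarrow> real"
    where "L j x = (case j of 0 \<Rightarrow> ln x | Suc i \<Rightarrow> (-1) ^ i * fact i / x ^ Suc i)" for j x
  have L: "(L j has_real_derivative L (Suc j) x) (at x)" if "x > 0" for j x
  proof (cases j)
    case 0
    thus ?thesis using that by (auto simp: L_def[abs_def] intro!: derivative_eq_intros)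
  next
    case (Suc i)
    have pow: "((\<lambda>x. x ^ Suc i) has_real_derivative real (Suc i) * x ^ i) (at x)"
      using DERIV_pow[of "Suc i" x] by simp
    have "((\<lambda>x. (-1) ^ i * fact i * inverse (x ^ Suc i)) has_real_derivative L (Suc (Suc i)) x) (at x)"
      by (rule DERIV_cong[OF DERIV_cmult[OF DERIV_inverse'[OF pow]]])
         (use that in \<open>auto simp: L_def field_simps\<close>)
    hence "((\<lambda>x. (-1) ^ i * fact i / x ^ Suc i) has_real_derivative L (Suc (Suc i)) x) (at x)"
      by (simp only: divide_inverse)
    thus ?thesis using Suc by (simp add: L_def[abs_def])
  qed
  have one_minus: "C_times k (\<lambda>z :: complex ^ 'n. 1 + (-1) * (norm z)\<^sup>2)"
    by (intro C_times_add C_times_mult C_times_const C_times_norm_squared)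
  have "C_times k (\<lambda>z :: complex ^ 'n. flat 0 (1 + (-1) * (norm z)\<^sup>2))"
    by (rule C_times_compose[where D = flat and S = UNIV, OF flat_has_derivative _ one_minus]) auto
  hence "C_times k (\<lambda>z :: complex ^ 'n. cutoff ((norm z)\<^sup>2))"
    unfolding cutoff_def using C_times_add[OF C_times_norm_squared] by auto
  hence "C_times k (\<lambda>z :: complex ^ 'n. L 0 (cutoff ((norm z)\<^sup>2)))"
    by (rule C_times_compose[where S = "{0<..}", rotated 2]) (auto intro!: L cutoff_pos)
  hence "C_times k (\<lambda>z :: complex ^ 'n. \<tau> / 2 * L 0 (cutoff ((norm z)\<^sup>2)))"
    by (intro C_times_mult C_times_const)
  thus "C_times k (weight \<tau> :: complex ^ 'n \<Rightarrow> real)"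
    by (simp add: weight_def[abs_def] rlog_def L_def)
qed

lemma complex_hessian_weight:
  fixes z :: "complex ^ 'n::finite"
  shows "complex_hessian (weight \<tau>) z $ j $ k =
     of_real (\<tau> / 2 * rlog'' ((norm z)\<^sup>2)) * cnj (z $ j) * z $ k
     + (if j = k then of_real (\<tau> / 2 * rlog' ((norm z)\<^sup>2)) else 0)"
proof -
  have sq: "((\<lambda>w. f ((norm w)\<^sup>2)) has_derivative (\<lambda>v. f' * (2 * (w \<bullet> v)))) (at w)"
    if "(f has_real_derivative f') (at ((norm w)\<^sup>2))" for f f' and w :: "complex ^ 'n"
  proof -
    have "((\<lambda>w. (norm w)\<^sup>2) has_derivative (\<lambda>v. 2 * (w \<bullet> v))) (at w)"
      unfolding power2_norm_eq_inner
      by (auto intro!: derivative_eq_intros simp: inner_commute)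
    from has_derivative_compose[OF this that[unfolded has_field_derivative_def]] show ?thesis by simp
  qed
  have Wbar: "wirtinger_bar k (\<lambda>w. complex_of_real (weight \<tau> w)) w
      = of_real (\<tau> / 2 * rlog' ((norm w)\<^sup>2)) * w $ k" for w :: "complex ^ 'n"
  proof -
    have "((\<lambda>w. complex_of_real (weight \<tau> w)) has_derivative
        (\<lambda>v. complex_of_real (\<tau> / 2 * (rlog' ((norm w)\<^sup>2) * (2 * (w \<bullet> v)))))) (at w)"
      unfolding weight_def
      by (intro has_derivative_of_real has_derivative_mult_right sq rlog_has_derivative) auto
    from frechet_derivative_at[OF this, symmetric] show ?thesis
      by (simp add: wirtinger_bar_def inner_axis complex_eq_iff)
  qed
  have "((\<lambda>w. of_real (\<tau> / 2 * rlog' ((norm w)\<^sup>2)) * w $ k) has_derivative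
      (\<lambda>v. of_real (\<tau> / 2 * rlog' ((norm z)\<^sup>2)) * v $ k
        + complex_of_real (\<tau> / 2 * (rlog'' ((norm z)\<^sup>2) * (2 * (z \<bullet> v)))) * z $ k)) (at z)"
    by (intro has_derivative_mult has_derivative_of_real has_derivative_mult_right sq
        rlog'_has_derivative bounded_linear_imp_has_derivative bounded_linear_vec_nth) auto
  note D = frechet_derivative_at[OF this, symmetric]
  have ax: "axis j c $ k = (if j = k then c else 0)" for c :: complex
    by (simp add: axis_def)
  have "complex_hessian (weight \<tau>) z $ j $ k = wirtinger j (\<lambda>w. of_real (\<tau> / 2 * rlog' ((norm w)\<^sup>2)) * w $ k) z"
    by (simp add: complex_hessian_def Wbar[abs_def])
  also have "\<dots> = of_real (\<tau> / 2 * rlog'' ((norm z)\<^sup>2)) * cnj (z $ j) * z $ k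
     + (if j = k then of_real (\<tau> / 2 * rlog' ((norm z)\<^sup>2)) else 0)"
    unfolding wirtinger_def D ax by (auto simp: inner_axis complex_eq_iff field_simps)
  finally show ?thesis .
qed

lemma nonneg_complex_hessian_weight:
  fixes z :: "complex ^ 'n::finite"
  assumes "\<tau> \<ge> 0"
  shows "nonneg_11_form (complex_hessian (weight \<tau>) z)"
  unfolding nonneg_11_form_def
proof
  fix v :: "complex ^ 'n"
  define t where "t = (norm z)\<^sup>2"
  have t: "t \<ge> 0" by (simp add: t_def)
  define c where "c = rlog'' t * (norm (hinner v z))\<^sup>2 + rlog' t * (norm v)\<^sup>2"
  have "(\<Sum>j\<in>UNIV. \<Sum>k\<in>UNIV. complex_hessian (weight \<tau>) z $ j $ k * v $ j * cnj (v $ k))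
      = (\<Sum>j\<in>UNIV. \<Sum>k\<in>UNIV. of_real (\<tau> / 2 * rlog'' t) * ((v $ j * cnj (z $ j)) * cnj (v $ k * cnj (z $ k))))
        + (\<Sum>j\<in>UNIV. \<Sum>k\<in>UNIV. if k = j then of_real (\<tau> / 2 * rlog' t) * (v $ j * cnj (v $ j)) else 0)"
    unfolding sum.distrib[symmetric] complex_hessian_weight t_def[symmetric]
    by (intro sum.cong refl) (auto simp: algebra_simps)
  also have "(\<Sum>j\<in>UNIV. \<Sum>k\<in>UNIV. of_real (\<tau> / 2 * rlog'' t) * ((v $ j * cnj (z $ j)) * cnj (v $ k * cnj (z $ k))))
      = of_real (\<tau> / 2 * rlog'' t) * (hinner v z * cnj (hinner v z))"
    by (simp only: hinner_def cnj_sum sum_product) (simp only: sum_distrib_left)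
  also have "\<dots> = of_real (\<tau> / 2 * (rlog'' t * (norm (hinner v z))\<^sup>2))"
    by (simp add: complex_norm_square flip: of_real_power)
  also have "(\<Sum>j\<in>UNIV. \<Sum>k\<in>UNIV. if k = j then of_real (\<tau> / 2 * rlog' t) * (v $ j * cnj (v $ j)) else 0)
      = of_real (\<tau> / 2 * rlog' t) * hinner v v"
    by (simp add: hinner_def sum_distrib_left)
  also have "\<dots> = of_real (\<tau> / 2 * (rlog' t * (norm v)\<^sup>2))"
    by (simp add: hinner_self)
  finally have eq: "(\<Sum>j\<in>UNIV. \<Sum>k\<in>UNIV. complex_hessian (weight \<tau>) z $ j $ k * v $ j * cnj (v $ k))
      = of_real (\<tau> / 2 * c)"
    by (simp add: c_def algebra_simps)
  have "c \<ge> 0"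
  proof (cases "rlog'' t \<ge> 0")
    case True
    thus ?thesis using rlog'_pos[OF t] by (simp add: c_def)
  next
    case False
    have "(norm (hinner v z))\<^sup>2 \<le> (norm v * norm z)\<^sup>2"
      by (intro power_mono norm_hinner_le) auto
    also have "\<dots> = (norm v)\<^sup>2 * t" by (simp add: t_def power_mult_distrib)
    finally have "rlog'' t * ((norm v)\<^sup>2 * t) \<le> rlog'' t * (norm (hinner v z))\<^sup>2"
      using False by (intro mult_left_mono_neg) auto
    moreover have "0 \<le> (norm v)\<^sup>2 * (rlog' t + t * rlog'' t)"
      using rlog_levi_nonneg[OF t] by simp
    ultimately show ?thesis by (simp add: c_def algebra_simps)
  qed
  thus "(\<Sum>j\<in>UNIV. \<Sum>k\<in>UNIV. complex_hessian (weight \<tau>) z $ j $ k * v $ j * cnj (v $ k)) \<in> \<real>\<^sub>\<ge>\<^sub>0"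
    unfolding eq nonneg_Reals_of_real_iff using assms by simp
qed

text \<open>
  For \<open>norm w \<ge> 1\<close> the Hessian is a positive multiple of the identity minus the projection to the line of \<open>w\<close>:
  its rows lie in the hyperplane orthogonal to \<open>w\<close>, and together with \<open>w\<close> they span everything.
\<close>

lemma rank_complex_hessian_weight:
  fixes w :: "complex ^ 'n::finite"
  assumes "\<tau> > 0" "norm w \<ge> 1"
  shows "rank (complex_hessian (weight \<tau>) w) = CARD('n) - 1"
proof -
  define H where "H = complex_hessian (weight \<tau>) w"
  define t where "t = (norm w)\<^sup>2"
  define c where "c = \<tau> / (2 * t)"
  have t: "t \<ge> 1" using assms(2) by (simp add: t_def)
  have c: "c > 0" using assms(1) t by (simp add: c_def)
  have coeffs: "\<tau> / 2 * rlog'' t = - (c / t)" "\<tau> / 2 * rlog' t = c"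
    using t by (simp_all add: rlog_ge_1 c_def field_simps power2_eq_square)
  have row: "row j H = of_real c *s (axis j 1 - (cnj (w $ j) / of_real t) *s w)" for j
    using t unfolding vec_eq_iff row_def H_def complex_hessian_weight t_def[symmetric] coeffs
    by (auto simp: axis_def field_simps)
  have w: "w \<noteq> 0" using assms(2) by auto
  define N where "N = {x :: complex ^ 'n. hinner x w = 0}"
  have N: "vec.subspace N"
    unfolding N_def by (rule vec.subspaceI) (auto simp: hinner_def distrib_right sum.distrib mult.assoc simp flip: sum_distrib_left)
  have "row j H \<in> N" for j
  proof -
    have "hinner (axis j 1) w = cnj (w $ j)"
      by (simp add: hinner_def axis_def if_distrib[of "\<lambda>x. x * _"] cong: if_cong)
    moreover have "hinner (axis j 1 - (cnj (w $ j) / of_real t) *s w) w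
        = hinner (axis j 1) w - (cnj (w $ j) / of_real t) * hinner w w"
      using hinner_add_smult[of "axis j 1" "- (cnj (w $ j) / of_real t)" w w] by simp
    ultimately have "hinner (axis j 1 - (cnj (w $ j) / of_real t) *s w) w = 0"
      using t by (simp add: hinner_self t_def[symmetric])
    thus ?thesis using N unfolding row by (intro vec.subspace_scale) (auto simp: N_def)
  qed
  hence rowsN: "rows H \<subseteq> N" by (auto simp: rows_def)
  have "w \<notin> N" using w by (simp add: N_def hinner_self)
  have "vec.dim (insert w (rows H)) = vec.dim (UNIV :: (complex ^ 'n) set)"
  proof (rule vec.span_eq_dim)
    have "axis j 1 \<in> vec.span (insert w (rows H))" for j
    proof -
      have "axis j 1 = (1 / of_real c) *s row j H + (cnj (w $ j) / of_real t) *s w"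
        using c by (simp add: row)
      moreover have "row j H \<in> rows H" by (auto simp: rows_def)
      ultimately show ?thesis
        by (metis insertI1 insertI2 vec.span_add vec.span_base vec.span_scale)
    qed
    hence "x \<in> vec.span (insert w (rows H))" for x
      by (subst basis_expansion[symmetric]) (intro vec.span_sum vec.span_scale)
    thus "vec.span (insert w (rows H)) = vec.span UNIV" by auto
  qed
  hence "vec.dim (insert w (rows H)) = CARD('n)" by (simp add: vec.dim_UNIV card_cart_basis)
  moreover have "w \<notin> vec.span (rows H)"
    using vec.span_minimal[OF rowsN N] \<open>w \<notin> N\<close> by blast
  ultimately have "Suc (vec.dim (rows H)) = CARD('n)"
    by (simp add: vec.dim_insert)
  thus ?thesis by (simp add: row_rank_def_gen H_def[symmetric])
qed

section \<open>Polynomial convexity of unions of discs with real centres\<close>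

text \<open>
  Uniform approximation on \<open>A\<close> of the function with a simple pole at \<open>b\<close>, as in Runge's theorem.
\<close>

definition poly_approx :: "complex set \<Rightarrow> complex \<Rightarrow> bool" where
  "poly_approx A b \<longleftrightarrow> (\<forall>e>0. \<exists>q. \<forall>z\<in>A. norm (poly q z - 1 / (z - b)) < e)"

text \<open>
  Partial sums of the geometric series of \<open>1 / (z - b)\<close> in powers of \<open>z / b\<close>.
\<close>

lemma poly_approx_far:
  assumes R: "R > 0" "\<And>z. z \<in> A \<Longrightarrow> norm z \<le> R" and b: "norm b \<ge> 2 * R"
  shows "poly_approx A b"
  unfolding poly_approx_def
proof (intro allI impI)
  fix e :: real assume e: "e > 0"
  have "\<exists>N. (1/2) ^ N < e * R" using e R by (intro real_arch_pow_inv) auto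
  then obtain N where N: "(1/2) ^ N < e * R" by blast
  define q where "q = (\<Sum>k<N. monom (- (1 / b ^ Suc k)) k)"
  have b0: "b \<noteq> 0" using b R by auto
  have "norm (poly q z - 1 / (z - b)) < e" if z: "z \<in> A" for z
  proof -
    have nz: "norm (z - b) \<ge> R"
      using norm_triangle_ineq2[of b z] R(2)[OF z] b by (simp add: norm_minus_commute)
    hence zb: "z \<noteq> b" using R by auto
    have "poly q z = - (\<Sum>k<N. (z / b) ^ k) / b"
      by (simp add: q_def poly_sum poly_monom sum_negf sum_divide_distrib power_divide mult.commute)
    also have "(\<Sum>k<N. (z / b) ^ k) = (1 - (z / b) ^ N) / (1 - z / b)"
      using zb b0 by (subst sum_gp_strict) auto
    also have "- ((1 - (z / b) ^ N) / (1 - z / b)) / b = (1 - (z / b) ^ N) / (z - b)"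
      using zb b0 by (simp add: field_simps)
    finally have "poly q z - 1 / (z - b) = - ((z / b) ^ N / (z - b))"
      by (simp add: diff_divide_distrib)
    hence "norm (poly q z - 1 / (z - b)) = norm (z / b) ^ N / norm (z - b)"
      by (simp add: norm_divide norm_power)
    also have "\<dots> \<le> (1/2) ^ N / R"
    proof (intro frac_le power_mono nz)
      show "norm (z / b) \<le> 1/2"
        using R(2)[OF z] b b0 by (simp add: norm_divide field_simps)
    qed (use R in auto)
    also have "\<dots> < e" using N R by (simp add: field_simps)
    finally show ?thesis .
  qed
  thus "\<exists>q. \<forall>z\<in>A. norm (poly q z - 1 / (z - b)) < e" by blast
qed

text \<open>
  Pole pushing: \<open>1 / (z - b')\<close> is a geometric series in \<open>w = 1 / (z - b)\<close>. A partial sum is a polynomial \<open>p\<close> in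
  \<open>w\<close>, and it may be composed with a polynomial that approximates \<open>w\<close>.
\<close>

lemma poly_approx_step:
  assumes app: "poly_approx A b" and d: "d > 0" "\<And>z. z \<in> A \<Longrightarrow> norm (z - b) \<ge> d"
    and close: "norm (b' - b) \<le> d / 2"
  shows "poly_approx A b'"
  unfolding poly_approx_def
proof (intro allI impI)
  fix e :: real assume e: "e > 0"
  define c where "c = b' - b"
  have "\<exists>N. (1/2) ^ N < e * d / 4" using e d by (intro real_arch_pow_inv) auto
  then obtain N where N: "(1/2) ^ N < e * d / 4" by blast
  define p where "p = (\<Sum>k<N. monom (c ^ k) (Suc k))"
  have "uniformly_continuous_on (cball 0 (1 / d + 1)) (poly p)"
    by (intro compact_uniformly_continuous continuous_intros) auto
  then obtain e' where e': "e' > 0" "\<And>x y. x \<in> cball 0 (1 / d + 1) \<Longrightarrow> y \<in> cball 0 (1 / d + 1) \<Longrightarrow>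
      dist x y < e' \<Longrightarrow> dist (poly p x) (poly p y) < e / 2"
    unfolding uniformly_continuous_on_def using e by (metis half_gt_zero)
  obtain q where q: "\<And>z. z \<in> A \<Longrightarrow> norm (poly q z - 1 / (z - b)) < min e' 1"
    using app e'(1) unfolding poly_approx_def by (metis min_less_iff_conj zero_less_one)
  have "norm (poly (pcompose p q) z - 1 / (z - b')) < e" if z: "z \<in> A" for z
  proof -
    define w where "w = 1 / (z - b)"
    have nz: "norm (z - b) \<ge> d" using d(2)[OF z] .
    hence zb: "z \<noteq> b" using d(1) by auto
    have nw: "norm w \<le> 1 / d" using nz d(1) by (simp add: w_def norm_divide frac_le)
    have nz': "norm (z - b') \<ge> d / 2"
      using norm_triangle_ineq2[of "z - b" "b' - b"] nz close by simp
    hence zb': "z \<noteq> b'" using d(1) by auto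
    have cw: "norm (c * w) \<le> 1/2"
    proof -
      have "norm (c * w) \<le> d / 2 * (1 / d)"
        unfolding norm_mult using close nw d(1) by (intro mult_mono) (auto simp: c_def)
      thus ?thesis using d(1) by simp
    qed
    have eq: "1 - c * w = (z - b') * w" using zb by (simp add: c_def w_def field_simps)
    have cw1: "c * w \<noteq> 1" using cw by auto
    have w0: "w \<noteq> 0" using zb by (simp add: w_def)
    have "poly p w = w * (\<Sum>k<N. (c * w) ^ k)"
      by (simp add: p_def poly_sum poly_monom sum_distrib_left power_mult_distrib algebra_simps)
    also have "(\<Sum>k<N. (c * w) ^ k) = (1 - (c * w) ^ N) / (1 - c * w)"
      using cw1 by (subst sum_gp_strict) auto
    also have "w * \<dots> = (1 - (c * w) ^ N) / (z - b')"
      using w0 zb' by (simp add: eq)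
    finally have "poly p w - 1 / (z - b') = - ((c * w) ^ N / (z - b'))"
      by (simp add: diff_divide_distrib)
    hence "norm (poly p w - 1 / (z - b')) = norm (c * w) ^ N / norm (z - b')"
      by (simp add: norm_divide norm_power)
    also have "\<dots> \<le> (1/2) ^ N / (d / 2)"
      using cw nz' d(1) by (intro frac_le power_mono) auto
    also have "\<dots> < e / 2" using N d(1) by (simp add: field_simps)
    finally have 1: "norm (poly p w - 1 / (z - b')) < e / 2" .
    have qw: "norm (poly q z - w) < min e' 1" using q[OF z] by (simp add: w_def)
    have "norm (poly q z) \<le> norm (poly q z - w) + norm w" by (metis diff_add_cancel norm_triangle_ineq)
    hence "dist (poly p (poly q z)) (poly p w) < e / 2"
      using qw nw by (intro e'(2)) (auto simp: dist_norm)
    hence "norm (poly p (poly q z) - poly p w) < e / 2" by (simp add: dist_norm)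
    with 1 have "norm ((poly p (poly q z) - poly p w) + (poly p w - 1 / (z - b'))) < e"
      by (intro order_le_less_trans[OF norm_triangle_ineq]) simp
    thus ?thesis by (simp add: poly_pcompose)
  qed
  thus "\<exists>q. \<forall>z\<in>A. norm (poly q z - 1 / (z - b')) < e" by blast
qed

text \<open>
  If the ray from \<open>b\<close> in direction \<open>s\<close> keeps distance \<open>d\<close> from \<open>A\<close>, the pole can be pushed from a far point of
  the ray to \<open>b\<close> in steps of length \<open>d / 2\<close>.
\<close>

lemma poly_approx_ray:
  assumes A: "\<And>z. z \<in> A \<Longrightarrow> norm z \<le> R" and d: "d > 0" and s: "norm s = 1"
    and away: "\<And>t z. t \<ge> 0 \<Longrightarrow> z \<in> A \<Longrightarrow> norm (z - (b + of_real t * s)) \<ge> d"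
  shows "poly_approx A b"
proof -
  define x where "x n = b + of_real (real n * (d / 2)) * s" for n
  define R' where "R' = max R 1"
  obtain n where n: "real n * (d / 2) \<ge> 2 * R' + norm b"
    using real_arch_simple[of "(2 * R' + norm b) / (d / 2)"] d by (auto simp: field_simps)
  have "poly_approx A (x n)"
  proof (rule poly_approx_far[of R'])
    have "norm (of_real (real n * (d / 2)) * s) = real n * (d / 2)"
      using s d by (simp only: norm_mult norm_of_real) simp
    thus "2 * R' \<le> norm (x n)"
      using norm_diff_ineq[of "of_real (real n * (d / 2)) * s" b] n by (simp add: x_def add.commute)
  qed (auto simp: R'_def max_def intro: order_trans[OF A])
  hence "poly_approx A (x 0)"
  proof (induction n)
    case (Suc n)
    have "norm (x n - x (Suc n)) = d / 2"
    proof -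
      have "x n - x (Suc n) = - (of_real (d / 2) * s)" by (simp add: x_def algebra_simps add_divide_distrib)
      thus ?thesis using s d by (simp add: norm_mult)
    qed
    hence "poly_approx A (x n)"
      using away[of "real (Suc n) * (d / 2)"] d
      by (intro poly_approx_step[OF Suc.prems, of d]) (auto simp: x_def)
    thus ?case by (rule Suc.IH)
  qed
  thus ?thesis by (simp add: x_def)
qed

text \<open>
  Moving \<open>b\<close> vertically away from the real axis increases its distance to every disc with a real centre, so the
  vertical ray avoids \<open>A\<close>. If \<open>q\<close> approximates \<open>1 / (z - b)\<close> on \<open>A\<close>, then \<open>1 - (z - b) q(z)\<close> is small
  on \<open>A\<close> and equal to \<open>1\<close> at \<open>b\<close>.
\<close>

lemma real_centred_discs_peak:
  fixes b :: complex
  assumes A: "compact A"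
    and discs: "\<And>z. z \<in> A \<Longrightarrow> \<exists>x r. 0 \<le> r \<and> z \<in> cball (of_real x) r \<and> cball (of_real x) r \<subseteq> A"
    and b: "b \<notin> A"
  shows "\<exists>q. poly q b = 1 \<and> (\<forall>z\<in>A. norm (poly q z) \<le> 1 / 2)"
proof (cases "A = {}")
  case False
  obtain R where R: "\<And>z. z \<in> A \<Longrightarrow> norm z \<le> R"
    using compact_imp_bounded[OF A] unfolding bounded_iff by blast
  define d where "d = infdist b A"
  have d: "d > 0"
    unfolding d_def using b A False by (simp add: infdist_pos_not_in_closed compact_imp_closed)
  define s where "s = (if Im b \<ge> 0 then \<i> else - \<i>)"
  have ns: "norm s = 1" by (auto simp: s_def)
  have "poly_approx A b"
  proof (rule poly_approx_ray[OF R d ns])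
    fix t z assume t: "t \<ge> (0::real)" and z: "z \<in> A"
    obtain x r where xr: "0 \<le> r" "z \<in> cball (of_real x) r" "cball (of_real x) r \<subseteq> A"
      using discs[OF z] by blast
    have bx: "norm (b - of_real x) > r"
      using b xr by (metis dist_norm mem_cball not_le norm_minus_commute subsetD)
    have bx0: "b \<noteq> of_real x" using bx xr(1) by auto
    define p where "p = of_real x + of_real (r / norm (b - of_real x)) * (b - of_real x)"
    have "norm (of_real (r / norm (b - of_real x)) * (b - of_real x)) = r"
      using bx0 xr(1) by (simp add: norm_mult norm_divide)
    hence "p \<in> A" using xr by (auto simp: p_def dist_norm)
    hence "d \<le> dist b p" unfolding d_def by (rule infdist_le)
    also have "b - p = of_real (1 - r / norm (b - of_real x)) * (b - of_real x)"
      by (simp add: p_def algebra_simps)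
    hence "dist b p = norm (b - of_real x) - r"
    proof -
      have "0 \<le> 1 - r / norm (b - of_real x)" using bx bx0 by (simp add: divide_le_eq_1)
      hence "dist b p = (1 - r / norm (b - of_real x)) * norm (b - of_real x)"
        using \<open>b - p = _\<close> by (simp only: dist_norm norm_mult norm_of_real abs_of_nonneg)
      thus ?thesis using bx0 by (simp add: algebra_simps)
    qed
    also have "norm (b - of_real x) \<le> norm (b + of_real t * s - of_real x)"
    proof -
      have "\<bar>Im b\<bar> \<le> \<bar>Im (b + of_real t * s)\<bar>" using t by (auto simp: s_def)
      hence "(Im b)\<^sup>2 \<le> (Im (b + of_real t * s))\<^sup>2" by (simp only: abs_le_square_iff)
      thus ?thesis unfolding cmod_def by (intro real_sqrt_le_mono) (auto simp: s_def)
    qed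
    also have "\<dots> - r \<le> norm (z - (b + of_real t * s))"
    proof -
      have "norm (z - of_real x) \<le> r" using xr(2) by (simp add: dist_norm norm_minus_commute)
      thus ?thesis
        using dist_triangle[of "b + of_real t * s" "of_real x" z, unfolded dist_norm]
          norm_minus_commute[of z "b + of_real t * s"] by linarith
    qed
    finally show "d \<le> norm (z - (b + of_real t * s))" by simp
  qed
  moreover define M where "M = R + norm b + 1"
  have M: "M > 0" "\<And>z. z \<in> A \<Longrightarrow> norm (z - b) \<le> M"
  proof -
    fix z assume "z \<in> A"
    thus "norm (z - b) \<le> M" using R[of z] norm_triangle_ineq4[of z b] by (simp add: M_def)
  next
    obtain z where "z \<in> A" using False by blast
    hence "0 \<le> R" using R norm_ge_zero order_trans by blast
    thus "M > 0" using norm_ge_zero[of b] unfolding M_def by linarith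
  qed
  ultimately obtain q where q: "\<And>z. z \<in> A \<Longrightarrow> norm (poly q z - 1 / (z - b)) < 1 / (2 * M)"
    unfolding poly_approx_def by (meson divide_pos_pos mult_pos_pos zero_less_numeral zero_less_one)
  define p where "p = 1 - [:- b, 1:] * q"
  have "norm (poly p z) \<le> 1/2" if z: "z \<in> A" for z
  proof -
    have zb: "z \<noteq> b" using z b by auto
    have "poly p z = - ((z - b) * (poly q z - 1 / (z - b)))"
      using zb by (simp add: p_def field_simps)
    hence "norm (poly p z) = norm (z - b) * norm (poly q z - 1 / (z - b))"
      by (simp only: norm_minus_cancel norm_mult)
    also have "\<dots> \<le> M * (1 / (2 * M))"
      using M z q[OF z] by (intro mult_mono) auto
    finally show ?thesis using M by simp
  qed
  moreover have "poly p b = 1" by (simp add: p_def)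
  ultimately show ?thesis by blast
qed (auto intro: exI[of _ 1])

section \<open>A sequence of discs that is thin at its limit point\<close>

text \<open>
  The discs accumulate at \<open>2\<close>. Their radii decrease so fast that the union is thin there: with mass
  \<open>(1/2)^k / 32\<close> at the centre, the logarithmic potential on the \<open>k\<close>-th disc is at most
  \<open>(1/2)^k / 32 * ln (radius k) = - 3/4 * ln 4\<close>.
\<close>

definition centre :: "nat \<Rightarrow> real" where "centre k = 2 + (1/2) ^ k"
definition radius :: "nat \<Rightarrow> real" where "radius k = (1/4) ^ (24 * 2 ^ k)"
definition necklace :: "complex set" where
  "necklace = cball 0 1 \<union> {2} \<union> (\<Union>k. cball (of_real (centre k)) (radius k))"

lemma radius_pos: "radius k > 0" by (simp add: radius_def)

lemma radius_le: "radius k \<le> (1/2) ^ k"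
proof -
  have "k \<le> 2 * (24 * 2 ^ k)" using less_exp[of k] by linarith
  hence "(1/2 :: real) ^ (2 * (24 * 2 ^ k)) \<le> (1/2) ^ k" by (intro power_decreasing) auto
  moreover have "(1/4 :: real) = (1/2)\<^sup>2" by (simp add: power2_eq_square)
  ultimately show ?thesis unfolding radius_def by (simp only: power_mult)
qed

lemma power_half_le_1: "(1/2 :: real) ^ k \<le> 1" by (simp add: power_le_one)

lemma centre_bounds: "2 < centre k" "centre k \<le> 3"
  using power_half_le_1[of k] by (auto simp: centre_def)

lemma disc_near_2:
  fixes z :: complex
  assumes "z \<in> cball (of_real (centre k)) (radius k)"
  shows "norm (z - 2) \<le> 2 * (1/2) ^ k"
proof -
  have "norm (of_real (centre k) - (2::complex)) = (1/2) ^ k"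
  proof -
    have "of_real (centre k) - (2::complex) = of_real ((1/2) ^ k)" by (simp add: centre_def)
    thus ?thesis by (simp only: norm_of_real) simp
  qed
  thus ?thesis
    using assms radius_le[of k] norm_triangle_ineq[of "z - of_real (centre k)" "of_real (centre k) - 2"]
    by (simp add: dist_norm norm_minus_commute)
qed

lemma necklace_cases:
  assumes "z \<in> necklace"
  obtains "norm z \<le> 1" | "z = 2" | k where "z \<in> cball (of_real (centre k)) (radius k)"
  using assms by (auto simp: necklace_def)

lemma necklace_near_2_or_unit_disc: "z \<in> necklace \<Longrightarrow> norm z \<le> 1 \<or> norm (z - 2) \<le> 2"
proof (erule necklace_cases)
  fix k assume "z \<in> cball (of_real (centre k)) (radius k)"
  thus ?thesis using disc_near_2[of z k] power_half_le_1[of k] by linarith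
qed auto

lemma dist_necklace_le_4:
  assumes "z \<in> necklace" "2 \<le> c" "c \<le> 3"
  shows "norm (z - of_real c) \<le> 4"
  using necklace_near_2_or_unit_disc[OF assms(1)]
proof
  assume "norm z \<le> 1"
  thus ?thesis using norm_triangle_ineq4[of z "of_real c"] assms by simp
next
  assume z: "norm (z - 2) \<le> 2"
  have "norm (2 - of_real c :: complex) = c - 2"
    using assms by (metis abs_of_nonneg diff_ge_0_iff_ge norm_minus_commute norm_of_real of_real_diff of_real_numeral)
  thus ?thesis using z norm_triangle_ineq[of "z - 2" "2 - of_real c"] assms by simp
qed

lemma norm_necklace_le_4: "z \<in> necklace \<Longrightarrow> norm z \<le> 4"
  using necklace_near_2_or_unit_disc[of z] norm_triangle_ineq[of "z - 2" 2] by auto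

text \<open>
  The discs and their limit point form the intersection over \<open>N\<close> of the closed sets consisting of the first
  \<open>N\<close> discs and a small disc around \<open>2\<close> that contains all the others.
\<close>

lemma compact_necklace: "compact necklace"
proof -
  define B where "B N = (\<Union>k<N. cball (complex_of_real (centre k)) (radius k)) \<union> cball 2 (2 * (1/2) ^ N)" for N
  have "{2} \<union> (\<Union>k. cball (of_real (centre k)) (radius k)) = (\<Inter>N. B N)"
  proof (intro equalityI subsetI)
    fix z assume "z \<in> {2} \<union> (\<Union>k. cball (complex_of_real (centre k)) (radius k))"
    then consider "z = 2" | k where "z \<in> cball (of_real (centre k)) (radius k)" by auto
    thus "z \<in> (\<Inter>N. B N)"
    proof cases
      case (2 k)
      have "z \<in> B N" for N
      proof (cases "k < N")
        case False
        hence "(1/2 :: real) ^ k \<le> (1/2) ^ N" by (intro power_decreasing) auto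
        hence "norm (z - 2) \<le> 2 * (1/2) ^ N" using disc_near_2[OF 2] by linarith
        thus ?thesis by (simp add: B_def dist_norm norm_minus_commute)
      qed (use 2 in \<open>auto simp: B_def\<close>)
      thus ?thesis by blast
    qed (auto simp: B_def)
  next
    fix z assume z: "z \<in> (\<Inter>N. B N)"
    show "z \<in> {2} \<union> (\<Union>k. cball (complex_of_real (centre k)) (radius k))"
    proof (rule ccontr)
      assume n: "\<not> ?thesis"
      hence "norm (z - 2) / 2 > 0" by auto
      then obtain N where "(1/2 :: real) ^ N < norm (z - 2) / 2"
        using real_arch_pow_inv[of "norm (z - 2) / 2" "1/2"] by auto
      hence "z \<notin> cball 2 (2 * (1/2) ^ N)" by (simp add: dist_norm norm_minus_commute)
      thus False using z n by (auto simp: B_def)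
    qed
  qed
  moreover have "closed (\<Inter>N. B N)" unfolding B_def by (intro closed_INT ballI closed_Un closed_UN) auto
  ultimately have "closed necklace" unfolding necklace_def by (metis Un_assoc closed_Un closed_cball)
  moreover have "bounded necklace" unfolding bounded_iff using norm_necklace_le_4 by blast
  ultimately show ?thesis by (simp add: compact_eq_bounded_closed)
qed

lemma necklace_discs:
  assumes "z \<in> necklace"
  shows "\<exists>x r. 0 \<le> r \<and> (z \<noteq> 2 \<longrightarrow> 0 < r) \<and> z \<in> cball (of_real x) r \<and> cball (of_real x) r \<subseteq> necklace"
  using assms
proof (cases rule: necklace_cases)
  case 1
  thus ?thesis by (intro exI[of _ 0] exI[of _ 1]) (auto simp: necklace_def)
next
  case 2
  thus ?thesis by (intro exI[of _ 2] exI[of _ 0]) (auto simp: necklace_def)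
next
  case (3 k)
  thus ?thesis using radius_pos[of k]
    by (intro exI[of _ "centre k"] exI[of _ "radius k"]) (auto simp: necklace_def)
qed

section \<open>Logarithmic potentials that do not exceed 0 on the discs\<close>

text \<open>
  The logarithmic potential \<open>3/4 ln \<bar>z\<bar>\<close> of the unit disc is positive on the small discs. For the first \<open>N\<close> of
  them, masses \<open>(1/2)^k / 32\<close> at the centres push it below \<open>0\<close>; a mass of order \<open>1/N\<close> at \<open>2\<close> does so for
  all the others. Every logarithm is truncated at the scale of its disc, which keeps the function
  continuous. As \<open>N\<close> grows the last mass disappears, while the others cost a bounded amount near \<open>2\<close>.
\<close>

definition probe :: "nat \<Rightarrow> complex \<Rightarrow> real" where
  "probe N z = 3/4 * ln (max 1 (norm z))
     + (\<Sum>k<N. (1/2) ^ k / 32 * (ln (max (radius k) (norm (z - of_real (centre k)))) - ln 4))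
     + 3 / (2 * (real N + 1)) * (ln (max (2 * (1/2) ^ N) (norm (z - 2))) - ln 4)"

text \<open>
  Each summand after the first is at most \<open>0\<close> because all distances are at most \<open>4\<close>, and the first is at most
  \<open>3/4 ln 4\<close>. On each component other than the unit disc, one of the other summands compensates this.
\<close>

lemma probe_nonpos:
  assumes z: "z \<in> necklace"
  shows "probe N z \<le> 0"
proof -
  define T where "T k = (1/2) ^ k / 32 * (ln (max (radius k) (norm (z - of_real (centre k)))) - ln 4)" for k
  define L where "L = ln (max (2 * (1/2) ^ N) (norm (z - 2))) - ln 4"
  have p: "probe N z = 3/4 * ln (max 1 (norm z)) + (\<Sum>k<N. T k) + 3 / (2 * (real N + 1)) * L"
    by (simp add: probe_def T_def L_def)
  have T: "T k \<le> 0" for k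
  proof -
    have "max (radius k) (norm (z - of_real (centre k))) \<le> 4"
      using radius_le[of k] power_half_le_1[of k] dist_necklace_le_4[OF z, of "centre k"] centre_bounds[of k] by auto
    hence "ln (max (radius k) (norm (z - of_real (centre k)))) \<le> ln 4"
      using radius_pos[of k] by (intro ln_mono) (auto simp: less_max_iff_disj)
    thus ?thesis by (auto simp: T_def intro!: mult_nonneg_nonpos)
  qed
  have L: "L \<le> 0"
  proof -
    have "max (2 * (1/2) ^ N) (norm (z - 2)) \<le> 4"
      using power_half_le_1[of N] dist_necklace_le_4[OF z, of 2] by auto
    hence "ln (max (2 * (1/2) ^ N) (norm (z - 2))) \<le> ln 4"
      by (intro ln_mono) (auto simp: less_max_iff_disj)
    thus ?thesis by (simp add: L_def)
  qed
  have sum: "(\<Sum>k<N. T k) \<le> 0" using T by (intro sum_nonpos) auto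
  have L': "3 / (2 * (real N + 1)) * L \<le> 0" using L by (intro mult_nonneg_nonpos) auto
  have first: "3/4 * ln (max 1 (norm z)) \<le> 3/4 * ln 4"
    using norm_necklace_le_4[OF z] by (intro mult_left_mono ln_mono) auto
  have near: "probe N z \<le> 0" if "norm (z - 2) \<le> 2 * (1/2) ^ N"
  proof -
    have "L = ln (2 * (1/2) ^ N) - ln 4" using that by (simp add: L_def max_absorb1)
    also have "\<dots> = - (real N + 1) * ln 2"
    proof -
      have "ln (4::real) = 2 * ln 2" using ln_realpow[of 2 2] by simp
      thus ?thesis by (simp add: ln_mult ln_realpow ln_div algebra_simps)
    qed
    finally have "3 / (2 * (real N + 1)) * L = - (3/2 * ln 2)" by (simp add: field_simps)
    moreover have "ln (4::real) = 2 * ln 2" using ln_realpow[of 2 2] by simp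
    ultimately show ?thesis using first sum by (simp add: p)
  qed
  show ?thesis using z
  proof (cases rule: necklace_cases)
    case 1
    thus ?thesis using sum L' by (simp add: p max_absorb1)
  next
    case 2
    thus ?thesis using near by simp
  next
    case (3 k)
    show ?thesis
    proof (cases "k < N")
      case True
      have "(\<Sum>k<N. T k) = T k + (\<Sum>k\<in>{..<N} - {k}. T k)"
        using True by (simp add: sum.remove)
      also have "\<dots> \<le> T k + 0" using T by (intro add_left_mono sum_nonpos) auto
      also have "T k = (1/2) ^ k / 32 * (ln (radius k) - ln 4)"
        using 3 by (simp add: T_def max_absorb1 dist_norm norm_minus_commute)
      also have "ln (radius k) = - (24 * 2 ^ k) * ln 4"
        unfolding radius_def by (subst ln_realpow) (auto simp: ln_div)
      also have "(1/2) ^ k / 32 * (- (24 * 2 ^ k) * ln 4 - ln 4) = - (3/4 * ln 4) - (1/2) ^ k / 32 * ln (4::real)"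
        by (simp add: field_simps power_one_over)
      also have "\<dots> + 0 \<le> - (3/4 * ln 4)" by simp
      finally show ?thesis using first L' unfolding p by linarith
    next
      case False
      hence "(1/2 :: real) ^ k \<le> (1/2) ^ N" by (intro power_decreasing) auto
      thus ?thesis using disc_near_2[OF 3] by (intro near) linarith
    qed
  qed
qed

lemma sum_power_half: "(\<Sum>k<N. (1/2 :: real) ^ k) = 2 - 2 * (1/2) ^ N"
  by (induction N) auto

lemma sum_weighted_power_half: "(\<Sum>k<N. (1/2 :: real) ^ k * (real k + 2)) = 6 - 2 * (real N + 3) * (1/2) ^ N"
  by (induction N) (auto simp: algebra_simps)

text \<open>
  Since \<open>max r \<bar>z - c\<bar> \<le> 4 max 1 \<bar>z\<bar>\<close>, every summand is at most its mass times \<open>log_plus \<bar>z\<bar>\<close>. The masses add up to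
  at most \<open>3/4 + 1/16 + 3/16 = 1\<close>; the last bound is where \<open>N \<ge> 7\<close> enters.
\<close>

lemma probe_le_log_plus:
  assumes N: "N \<ge> 7"
  shows "probe N z \<le> ln (max 1 (norm z))"
proof -
  define L where "L = ln (max 1 (norm z))"
  have L: "L \<ge> 0" by (simp add: L_def)
  have b: "ln (max r (norm (z - of_real c))) - ln 4 \<le> L" if "0 < r" "r \<le> 4" "2 \<le> c" "c \<le> 3" for r c :: real
  proof -
    have "norm (z - of_real c) \<le> norm z + c"
      using norm_triangle_ineq4[of z "of_real c"] that by simp
    hence "max r (norm (z - of_real c)) \<le> 4 * max 1 (norm z)"
      using that by (auto simp: max_def)
    hence "ln (max r (norm (z - of_real c))) \<le> ln (4 * max 1 (norm z))"
      using that by (intro ln_mono) (auto simp: less_max_iff_disj)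
    also have "\<dots> = ln 4 + L" unfolding L_def by (intro ln_mult_pos) (auto simp: less_max_iff_disj)
    finally show ?thesis by simp
  qed
  have "probe N z \<le> 3/4 * L + (\<Sum>k<N. (1/2) ^ k / 32 * L) + 3 / (2 * (real N + 1)) * L"
    unfolding probe_def L_def[symmetric]
  proof (intro add_mono sum_mono mult_left_mono order_refl)
    fix k
    show "ln (max (radius k) (norm (z - of_real (centre k)))) - ln 4 \<le> L"
      using radius_pos[of k] radius_le[of k] power_half_le_1[of k] centre_bounds[of k] by (intro b) auto
    show "ln (max (2 * (1/2) ^ N) (norm (z - 2))) - ln 4 \<le> L"
      using b[of "2 * (1/2) ^ N" 2] power_half_le_1[of N] by simp
  qed auto
  also have "(\<Sum>k<N. (1/2) ^ k / 32 * L) = (2 - 2 * (1/2) ^ N) / 32 * L"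
    unfolding sum_power_half[symmetric] by (simp add: sum_distrib_right sum_divide_distrib)
  also have "\<dots> \<le> 1/16 * L" using L by (intro mult_right_mono) auto
  also have "3 / (2 * (real N + 1)) * L \<le> 3/16 * L"
    using N L by (intro mult_right_mono) (auto simp: field_simps)
  finally show ?thesis by (simp add: L_def)
qed

text \<open>
  Approaching \<open>2\<close> from the left, the distance to the \<open>k\<close>-th centre stays above \<open>(1/2)^k\<close>. So the \<open>k\<close>-th mass costs
  at most \<open>(1/2)^k / 32 * (k + 2) ln 2\<close>, and these costs add up to at most \<open>3/16 ln 2\<close>.
\<close>

lemma probe_left_of_2:
  assumes s: "0 < s" "s \<le> 1"
  shows "probe N (of_real (2 - s)) \<ge> 3/4 * ln (2 - s) - 3/16 * ln 2 + 3 / (2 * (real N + 1)) * (ln s - ln 4)"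
proof -
  have ln4: "ln (4::real) = 2 * ln 2" using ln_realpow[of 2 2] by simp
  have nrm: "norm (of_real (2 - s) - of_real c :: complex) = c - 2 + s" if "c \<ge> 2" for c
  proof -
    have "of_real (2 - s) - of_real c = (of_real (2 - s - c) :: complex)" by simp
    thus ?thesis using that s by (simp only: norm_of_real)
  qed
  have "(\<Sum>k<N. (1/2) ^ k * (real k + 2)) * (- ln 2 / 32)
      \<le> (\<Sum>k<N. (1/2) ^ k / 32 * (ln (max (radius k) (norm (of_real (2 - s) - of_real (centre k) :: complex))) - ln 4))"
    unfolding sum_distrib_right
  proof (rule sum_mono)
    fix k
    have "ln ((1/2) ^ k) \<le> ln (max (radius k) (norm (of_real (2 - s) - of_real (centre k) :: complex)))"
      using nrm[of "centre k"] s centre_bounds[of k] by (intro ln_mono) (auto simp: centre_def less_max_iff_disj)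
    moreover have "ln ((1/2 :: real) ^ k) = - real k * ln 2" by (simp add: ln_realpow ln_div)
    ultimately have "- ((real k + 2) * ln 2) \<le> ln (max (radius k) (norm (of_real (2 - s) - of_real (centre k) :: complex))) - ln 4"
      using ln4 by (simp add: algebra_simps)
    from mult_left_mono[OF this, of "(1/2) ^ k / 32"]
    show "(1/2) ^ k * (real k + 2) * (- ln 2 / 32)
        \<le> (1/2) ^ k / 32 * (ln (max (radius k) (norm (of_real (2 - s) - of_real (centre k) :: complex))) - ln 4)"
      by (simp add: algebra_simps)
  qed
  moreover have "- (3/16 * ln 2) \<le> (\<Sum>k<N. (1/2) ^ k * (real k + 2)) * (- ln 2 / (32::real))"
  proof -
    have "6 * (- ln 2 / 32) \<le> (\<Sum>k<N. (1/2) ^ k * (real k + 2)) * (- ln 2 / (32::real))"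
      unfolding sum_weighted_power_half by (intro mult_right_mono_neg) auto
    thus ?thesis by simp
  qed
  moreover have "3/4 * ln (2 - s) \<le> 3/4 * ln (max 1 (norm (of_real (2 - s) :: complex)))"
    using s by (intro mult_left_mono ln_mono) (auto simp: norm_of_real simp del: of_real_diff)
  moreover have "3 / (2 * (real N + 1)) * (ln s - ln 4)
      \<le> 3 / (2 * (real N + 1)) * (ln (max (2 * (1/2) ^ N) (norm (of_real (2 - s) - 2 :: complex))) - ln 4)"
    using s nrm[of 2] by (intro mult_left_mono diff_mono ln_mono) auto
  ultimately show ?thesis unfolding probe_def by linarith
qed

text \<open>
  The limit for \<open>N \<rightarrow> \<infinity>\<close> and then \<open>s \<rightarrow> 0\<close> of the preceding lower bound is \<open>(3/4 - 3/16) ln 2 = 9/16 ln 2\<close>, which leaves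
  \<open>ln 2 / 16\<close> for the two approximations.
\<close>

lemma probe_large_near_2:
  "eventually (\<lambda>s. \<exists>N\<ge>7. probe N (of_real (2 - s)) \<ge> 1/2 * ln 2) (at_right (0::real))"
proof -
  have "((\<lambda>s. 3/4 * ln (2 - s)) \<longlongrightarrow> 3/4 * ln (2 - 0)) (at_right (0::real))"
    by (intro tendsto_intros) auto
  moreover have "3/4 * ln 2 - ln 2 / 32 < 3/4 * ln (2 - 0 :: real)" by simp
  ultimately have "eventually (\<lambda>s. 3/4 * ln 2 - ln 2 / 32 < 3/4 * ln (2 - s)) (at_right (0::real))"
    by (rule order_tendstoD(1))
  moreover have "eventually (\<lambda>s. s \<in> {0<..<1}) (at_right (0::real))"
    by (rule eventually_at_right_real) simp
  ultimately show ?thesis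
  proof eventually_elim
    case (elim s)
    define M where "M = ln 4 - ln s"
    \<comment> \<open>This makes the last summand of the test function at least \<open>- ln 2 / 32\<close>; the first loses another \<open>ln 2 / 32\<close>.\<close>
    obtain n where n: "real n \<ge> 48 * M / ln 2" using real_arch_simple by blast
    define N where "N = max n 7"
    have "48 * M / ln 2 \<le> real N + 1" using n by (simp add: N_def)
    hence "3 / (2 * (real N + 1)) * M \<le> ln 2 / 32" by (simp add: field_simps)
    moreover have "3 / (2 * (real N + 1)) * (ln s - ln 4) = - (3 / (2 * (real N + 1)) * M)"
      by (simp only: M_def minus_mult_right minus_diff_eq)
    ultimately have "3 / (2 * (real N + 1)) * (ln s - ln 4) \<ge> - (ln 2 / 32)" by linarith
    hence "probe N (of_real (2 - s)) \<ge> 1/2 * ln 2"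
      using probe_left_of_2[of s N] elim by simp
    moreover have "N \<ge> 7" by (simp add: N_def)
    ultimately show ?case by blast
  qed
qed

lemma psh_cont_ln_max_coordinate:
  fixes i :: "'n::finite"
  assumes "r > 0"
  shows "psh_cont (\<lambda>z. ln (max r (norm (z $ i - c))))"
proof -
  define F :: "complex ^ 'n \<Rightarrow> complex ^ 'n" where "F z = (\<chi> j. if j = i then z $ i - c else 0)" for z
  define G :: "complex ^ 'n \<Rightarrow> complex ^ 'n" where "G z = (\<chi> j. if j = i then z $ i else 0)" for z
  have Fa: "F z = axis i (z $ i - c)" for z by (simp add: F_def axis_def vec_eq_iff)
  have "psh_cont (\<lambda>z. (\<lambda>s. ln (max r s)) (norm (F z)))"
  proof (rule psh_cont_radial[where G = G])
    show "continuous_on {0..} (\<lambda>s. ln (max r s))"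
      using assms by (intro continuous_intros ballI) (auto simp: max_def split: if_splits)
    have "continuous_on UNIV (\<lambda>z :: complex ^ 'n. if j = i then z $ i - c else 0)" for j
      by (cases "j = i") (auto intro!: continuous_intros)
    thus "continuous_on UNIV F" unfolding F_def by (rule continuous_on_vec_lambda)
    show "F (a + \<zeta> *s b) = F a + \<zeta> *s G b" for a b \<zeta>
      by (simp add: F_def G_def vec_eq_iff)
    show "ln (max r 0) \<le> ln (max r s)" if "s \<ge> 0" for s
      using assms that by (intro ln_mono) auto
    show "\<exists>\<kappa>\<ge>0. \<exists>\<eta>>0. \<forall>s\<ge>0. ln (max r s) \<ge> ln (max r t) + \<kappa> * (ln (max \<eta> s) - ln t)" if "t > 0" for t
    proof (cases "t < r")
      case True
      have "ln (max r t) \<le> ln (max r s)" for s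
        using True assms by (intro ln_mono) auto
      thus ?thesis using assms by (intro exI[of _ 0]) auto
    next
      case False
      thus ?thesis using assms by (intro exI[of _ 1]) (auto intro!: exI[of _ r] simp: max_def)
    qed
  qed
  moreover have "norm (F z) = norm (z $ i - c)" for z
    by (simp add: Fa norm_eq_sqrt_inner[of "axis i _"] inner_axis_axis flip: norm_eq_sqrt_inner)
  ultimately show ?thesis by simp
qed

lemma psh_cont_probe: "psh_cont (\<lambda>z :: complex ^ 'n::finite. probe N (z $ i))"
proof -
  have L: "psh_cont (\<lambda>z :: complex ^ 'n. a * (ln (max r (norm (z $ i - c))) - d))"
    if "r > 0" "a \<ge> 0" for a r c d
    using psh_cont_cmult[OF psh_cont_add[OF psh_cont_ln_max_coordinate[OF that(1)] psh_cont_const[of "- d"]] that(2)]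
    by simp
  show ?thesis
    unfolding probe_def
    using L[of 1 "3/4" 0 0] by (intro psh_cont_add psh_cont_sum L radius_pos) auto
qed

lemma probe_in_lelong_class:
  assumes "N \<ge> 7"
  shows "(\<lambda>z :: complex ^ 'n::finite. ereal (probe N (z $ i))) \<in> lelong_class 1"
  unfolding lelong_class_def
proof (intro CollectI conjI exI[of _ 0] allI)
  show "psh_on UNIV (\<lambda>z :: complex ^ 'n. ereal (probe N (z $ i)))"
    by (intro psh_cont_imp_psh_on psh_cont_probe)
  fix z :: "complex ^ 'n"
  have "probe N (z $ i) \<le> ln (max 1 (norm (z $ i)))" using assms by (rule probe_le_log_plus)
  also have "\<dots> \<le> ln (max 1 (norm z))"
    using Finite_Cartesian_Product.norm_nth_le[of z i] by (intro ln_mono) auto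
  finally show "ereal (probe N (z $ i)) \<le> ereal (1 * log_plus (norm z) + 0)"
    by (simp add: log_plus_eq_ln_max)
qed

section \<open>The compact set\<close>

text \<open>
  The product of the plane set with a closed unit polydisc in the other coordinates; the fibre over the point
  \<open>2\<close> is \<open>Z_set i\<close>.
\<close>

definition necklace_tube :: "'n \<Rightarrow> (complex ^ 'n::finite) set" where
  "necklace_tube i = {z. z $ i \<in> necklace \<and> (\<forall>j. j \<noteq> i \<longrightarrow> norm (z $ j) \<le> 1)}"

lemma norm_le_card_times:
  fixes x :: "complex ^ 'n::finite"
  assumes "\<And>j. norm (x $ j) \<le> B"
  shows "norm x \<le> real CARD('n) * B"
proof -
  have "norm x \<le> (\<Sum>j\<in>UNIV. norm (x $ j))"
    unfolding norm_vec_def by (rule L2_set_le_sum) auto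
  also have "\<dots> \<le> (\<Sum>j\<in>(UNIV :: 'n set). B)" using assms by (intro sum_mono)
  finally show ?thesis by simp
qed

lemma compact_necklace_tube: "compact (necklace_tube i :: (complex ^ 'n::finite) set)"
proof -
  have "necklace_tube i = (\<lambda>z. z $ i) -` necklace \<inter> (\<Inter>j\<in>-{i}. (\<lambda>z :: complex ^ 'n. z $ j) -` cball 0 1)"
    by (auto simp: necklace_tube_def)
  moreover have "closed ((\<lambda>z :: complex ^ 'n. z $ j) -` S)" if "closed S" for j S
    using that by (intro closed_vimage continuous_intros)
  ultimately have "closed (necklace_tube i :: (complex ^ 'n) set)"
    using compact_necklace by (auto intro!: closed_Int closed_INT simp: compact_imp_closed)
  moreover have "norm z \<le> real CARD('n) * 4" if "z \<in> necklace_tube i" for z :: "complex ^ 'n"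
  proof (rule norm_le_card_times)
    fix j
    show "norm (z $ j) \<le> 4"
      using that norm_necklace_le_4[of "z $ i"] by (cases "j = i") (force simp: necklace_tube_def)+
  qed
  hence "bounded (necklace_tube i :: (complex ^ 'n) set)" unfolding bounded_iff by blast
  ultimately show ?thesis by (simp add: compact_eq_bounded_closed)
qed

lemma complex_polynomial_fun_poly_coord:
  "complex_polynomial_fun (\<lambda>z :: complex ^ 'n::finite. poly q (z $ i))"
proof (induction q)
  case (pCons a q)
  have "complex_polynomial_fun (\<lambda>z :: complex ^ 'n. a + z $ i * poly q (z $ i))"
    by (rule complex_polynomial_fun.add[OF complex_polynomial_fun.const
          complex_polynomial_fun.mult[OF complex_polynomial_fun.coord pCons.IH]])
  thus ?case by simp
qed (simp add: complex_polynomial_fun.const)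

lemma notin_polynomial_hullI:
  assumes "complex_polynomial_fun p" "\<And>w. w \<in> K \<Longrightarrow> norm (p w) \<le> c" "c < norm (p z)"
  shows "z \<notin> polynomial_hull K"
proof
  assume "z \<in> polynomial_hull K"
  hence "ereal (norm (p z)) \<le> (SUP w\<in>K. ereal (norm (p w)))"
    using assms(1) by (auto simp: polynomial_hull_def)
  also have "\<dots> \<le> ereal c" using assms(2) by (intro SUP_least) auto
  finally show False using assms(3) by simp
qed

lemma polynomially_convex_necklace_tube: "polynomially_convex (necklace_tube i)"
  unfolding polynomially_convex_def
proof (intro equalityI subsetI)
  fix z assume z: "z \<in> polynomial_hull (necklace_tube i)"
  show "z \<in> necklace_tube i"
    unfolding necklace_tube_def
  proof (intro CollectI conjI allI impI)
    show "z $ i \<in> necklace"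
    proof (rule ccontr)
      assume "z $ i \<notin> necklace"
      then obtain q where q: "poly q (z $ i) = 1" "\<And>w. w \<in> necklace \<Longrightarrow> norm (poly q w) \<le> 1/2"
        using real_centred_discs_peak[OF compact_necklace] necklace_discs by metis
      have "z \<notin> polynomial_hull (necklace_tube i)"
        by (rule notin_polynomial_hullI[OF complex_polynomial_fun_poly_coord[of q i], of _ "1/2"])
           (use q(2)[of "_ $ i"] in \<open>simp_all add: q(1) necklace_tube_def\<close>)
      thus False using z by simp
    qed
    show "norm (z $ j) \<le> 1" if "j \<noteq> i" for j
    proof (rule ccontr)
      assume "\<not> norm (z $ j) \<le> 1"
      hence "z \<notin> polynomial_hull (necklace_tube i)"
        using that by (intro notin_polynomial_hullI[OF complex_polynomial_fun.coord[of j], of _ 1])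
          (auto simp: necklace_tube_def)
      thus False using z by simp
    qed
  qed
qed (auto simp: polynomial_hull_def intro: SUP_upper)

text \<open>
  The homothety with centre \<open>a\<close> and ratio \<open>t / r\<close> maps the disc into itself.
\<close>

lemma shrink_disc:
  fixes a x :: complex
  assumes "a \<in> cball x r" "0 < t" "t \<le> r"
  shows "\<exists>c. a \<in> cball c t \<and> cball c t \<subseteq> cball x r"
proof -
  define c where "c = a + of_real (t / r) * (x - a)"
  have r: "r > 0" using assms by simp
  have ax: "norm (x - a) \<le> r" using assms(1) by (simp add: dist_norm)
  have "norm (of_real (t / r) * (x - a)) = t / r * norm (x - a)"
    using assms r by (simp add: norm_mult norm_divide)
  also have "\<dots> \<le> t / r * r" using ax assms r by (intro mult_left_mono) auto
  finally have "a \<in> cball c t" using r by (simp add: c_def dist_norm)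
  moreover have "cball c t \<subseteq> cball x r"
  proof
    fix w assume w: "w \<in> cball c t"
    have "x - c = of_real (1 - t / r) * (x - a)" by (simp add: c_def algebra_simps)
    moreover have "0 \<le> 1 - t / r" using assms r by simp
    ultimately have "norm (x - c) = (1 - t / r) * norm (x - a)"
      by (simp only: norm_mult norm_of_real abs_of_nonneg)
    also have "\<dots> \<le> (1 - t / r) * r" using ax assms r by (intro mult_left_mono) auto
    finally have "norm (x - c) \<le> r - t" using r by (simp add: algebra_simps)
    thus "w \<in> cball x r"
      using w norm_triangle_ineq[of "x - c" "c - w"] by (simp add: dist_norm)
  qed
  ultimately show ?thesis by blast
qed

text \<open>
  Each coordinate of \<open>a\<close> lies in a disc of positive radius in the corresponding factor. Shrinking all of these discs
  towards \<open>a\<close> to one common radius gives a small polydisc that contains \<open>a\<close>, possibly on its boundary.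
\<close>

lemma polydisc_in_necklace_tube:
  fixes a :: "complex ^ 'n::finite"
  assumes a: "a \<in> necklace_tube i" "a $ i \<noteq> 2" and e: "e > 0"
  obtains c t where "t > 0" "\<forall>j. norm (a $ j - c $ j) \<le> t"
    "{z. \<forall>j. norm (z $ j - c $ j) \<le> t} \<subseteq> necklace_tube i \<inter> cball a e"
proof -
  obtain x r where xr: "r > 0" "a $ i \<in> cball (of_real x) r" "cball (of_real x) r \<subseteq> necklace"
    using necklace_discs[of "a $ i"] a by (auto simp: necklace_tube_def)
  define t where "t = min (min r 1) (e / (2 * real CARD('n)))"
  have t: "t > 0" "t \<le> r" "t \<le> 1" "real CARD('n) * (2 * t) \<le> e"
  proof -
    have "t \<le> e / (2 * real CARD('n))" by (simp add: t_def)
    thus "real CARD('n) * (2 * t) \<le> e" by (simp add: field_simps)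
  qed (use xr e in \<open>auto simp: t_def\<close>)
  have "\<exists>c. a $ j \<in> cball c t \<and> (if j = i then cball c t \<subseteq> necklace else cball c t \<subseteq> cball 0 1)" for j
  proof (cases "j = i")
    case True
    thus ?thesis using shrink_disc[OF xr(2) t(1,2)] xr(3) by auto
  next
    case False
    hence "a $ j \<in> cball 0 1" using a by (auto simp: necklace_tube_def)
    thus ?thesis using shrink_disc[OF _ t(1,3), of "a $ j" 0] False by auto
  qed
  then obtain c where c: "\<And>j. a $ j \<in> cball (c j) t"
    "\<And>j. if j = i then cball (c j) t \<subseteq> necklace else cball (c j) t \<subseteq> cball 0 1" by metis
  show ?thesis
  proof (rule that[of t "\<chi> j. c j"])
    have na: "norm (a $ j - (\<chi> j. c j) $ j) \<le> t" for j
      using c(1)[of j] by (simp add: dist_norm norm_minus_commute)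
    thus "\<forall>j. norm (a $ j - (\<chi> j. c j) $ j) \<le> t" by blast
    show "{z. \<forall>j. norm (z $ j - (\<chi> j. c j) $ j) \<le> t} \<subseteq> necklace_tube i \<inter> cball a e"
    proof
    fix z assume "z \<in> {z. \<forall>j. norm (z $ j - (\<chi> j. c j) $ j) \<le> t}"
    hence z: "norm (z $ j - (\<chi> j. c j) $ j) \<le> t" for j by blast
    hence zc: "z $ j \<in> cball (c j) t" for j by (simp add: dist_norm norm_minus_commute)
    have "z \<in> necklace_tube i"
      unfolding necklace_tube_def
    proof (intro CollectI conjI allI impI)
      show "z $ i \<in> necklace" using subsetD[OF _ zc[of i]] c(2)[of i] by simp
      show "norm (z $ j) \<le> 1" if "j \<noteq> i" for j
        using subsetD[OF _ zc[of j], of "cball 0 1"] c(2)[of j] that by simp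
    qed
    moreover have "norm (a - z) \<le> real CARD('n) * (2 * t)"
    proof (rule norm_le_card_times)
      fix j
      show "norm ((a - z) $ j) \<le> 2 * t"
        using na[of j] z[of j] norm_triangle_ineq4[of "a $ j - c j" "z $ j - c j"] by simp
    qed
    ultimately show "z \<in> necklace_tube i \<inter> cball a e" using t(4) by (simp add: dist_norm)
    qed
  qed (rule t(1))
qed

lemma locally_pluriregular_necklace_tube:
  assumes "a \<in> necklace_tube i" "a $ i \<noteq> 2"
  shows "locally_pluriregular_at (necklace_tube i) a"
  unfolding locally_pluriregular_at_def
proof (intro conjI allI impI assms(1))
  fix r :: real assume r: "r > 0"
  obtain c t where ct: "t > 0" "\<forall>j. norm (a $ j - c $ j) \<le> t"
    "{z. \<forall>j. norm (z $ j - c $ j) \<le> t} \<subseteq> necklace_tube i \<inter> cball a r"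
    by (rule polydisc_in_necklace_tube[OF assms r])
  show "extremal_fun_reg 1 (necklace_tube i \<inter> cball a r) (\<lambda>_. 0) a = 0"
    by (rule extremal_fun_reg_polydisc[OF ct(1) ct(3) ct(2)[rule_format]])
qed

lemma ball_near_regular_point:
  assumes "a \<in> necklace_tube i" "a $ i \<noteq> 2" "r > 0"
  shows "\<exists>c s. s > 0 \<and> ball c s \<subseteq> necklace_tube i \<inter> ball a r"
proof -
  have r: "r / 2 > 0" using assms by simp
  obtain c t where ct: "t > 0" "\<forall>j. norm (a $ j - c $ j) \<le> t"
    "{z. \<forall>j. norm (z $ j - c $ j) \<le> t} \<subseteq> necklace_tube i \<inter> cball a (r / 2)"
    by (rule polydisc_in_necklace_tube[OF assms(1,2) r])
  have "ball c t \<subseteq> necklace_tube i \<inter> cball a (r / 2)"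
  proof
    fix z assume "z \<in> ball c t"
    hence "norm (z $ j - c $ j) \<le> t" for j
      using Finite_Cartesian_Product.norm_nth_le[of "z - c" j] by (simp add: dist_norm norm_minus_commute)
    thus "z \<in> necklace_tube i \<inter> cball a (r / 2)" using ct(3) by blast
  qed
  moreover have "cball a (r / 2) \<subseteq> ball a r" using assms by auto
  ultimately show ?thesis using ct(1) by blast
qed

lemma nonpluripolar_necklace_tube: "nonpluripolar_everywhere (necklace_tube i)"
  unfolding nonpluripolar_everywhere_def
proof (intro ballI allI impI)
  fix a r assume a: "a \<in> necklace_tube i" and r: "(r::real) > 0"
  have "\<exists>c s. s > 0 \<and> ball c s \<subseteq> necklace_tube i \<inter> ball a r"
  proof (cases "a $ i = 2")
    case False
    thus ?thesis using ball_near_regular_point[OF a _ r] by blast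
  next
    case True
    obtain k where k: "(1/2 :: real) ^ k < r / 2" using real_arch_pow_inv[of "r / 2" "1/2"] r by auto
    \<comment> \<open>Over \<open>2\<close> itself there is no polydisc; a nearby point over the centre of a small disc has one.\<close>
    define a' where "a' = a + axis i (of_real ((1/2) ^ k))"
    have "a' $ i = of_real (centre k)" using True by (simp add: a'_def centre_def)
    moreover have "of_real (centre k) \<in> necklace"
      using radius_pos[of k] by (auto simp: necklace_def intro!: exI[of _ k])
    moreover have "a' $ j = a $ j" if "j \<noteq> i" for j using that by (simp add: a'_def axis_def)
    ultimately have a': "a' \<in> necklace_tube i" using a by (auto simp: necklace_tube_def)
    have "of_real (centre k) \<noteq> (2::complex)"
      using centre_bounds(1)[of k] by (metis of_real_eq_iff of_real_numeral less_irrefl)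
    hence ne: "a' $ i \<noteq> 2" using \<open>a' $ i = _\<close> by simp
    have "dist a a' = norm (complex_of_real ((1/2) ^ k))"
      unfolding dist_norm a'_def
      by (simp add: norm_eq_sqrt_inner[of "axis i _"] inner_axis_axis flip: norm_eq_sqrt_inner)
    hence "dist a a' < r / 2" using k by (simp only: norm_of_real) simp
    hence "ball a' (r / 2) \<subseteq> ball a r"
      by (simp add: ball_subset_ball_iff dist_commute)
    thus ?thesis using ball_near_regular_point[OF a' ne, of "r / 2"] r
      by (meson half_gt_zero inf_mono order_refl order_trans)
  qed
  thus "\<not> pluripolar (necklace_tube i \<inter> ball a r)" using not_pluripolar_if_ball_subset by blast
qed

text \<open>
  In a coordinate \<open>j \<noteq> i\<close> the set contains a full unit disc through \<open>a\<close>. If \<open>a $ j \<noteq> 0\<close>, the points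
  \<open>a $ j * (1 - r cis \<theta>)\<close> with \<open>\<bar>\<theta>\<bar> \<le> \<pi>/3\<close> and \<open>r \<le> 1\<close> stay in that disc, because
  \<open>\<bar>1 - r cis \<theta>\<bar>\<^sup>2 = 1 - 2 r cos \<theta> + r\<^sup>2 \<le> 1\<close>. This sector makes the set non-plurithin even over the point
  \<open>2\<close>, where the plane set is thin.
\<close>

lemma not_plurithin_necklace_tube:
  fixes a :: "complex ^ 'n::finite"
  assumes "CARD('n) \<ge> 2" and a: "a \<in> necklace_tube i"
  shows "\<not> plurithin_at (necklace_tube i) a"
proof -
  have "(UNIV :: 'n set) \<noteq> {i}"
  proof
    assume "(UNIV :: 'n set) = {i}"
    hence "CARD('n) = 1" by (metis card_1_singleton_iff One_nat_def)
    thus False using assms(1) by simp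
  qed
  then obtain j where j: "j \<noteq> i" by auto
  define \<beta> where "\<beta> = (if a $ j = 0 then 1 else - (a $ j))"
  have aj: "norm (a $ j) \<le> 1" using a j by (auto simp: necklace_tube_def)
  show ?thesis
  proof (rule not_plurithin_at_if_sector[of "axis j \<beta>"])
    show "axis j \<beta> \<noteq> 0" by (simp add: \<beta>_def axis_eq_0_iff)
    fix r \<theta> :: real assume r: "0 < r" "r \<le> 1" and \<theta>: "\<theta> \<in> {0..pi/3}"
    define z where "z = a + cis \<theta> *s (of_real r *s axis j \<beta>)"
    have "norm (z $ j) \<le> 1"
    proof (cases "a $ j = 0")
      case True
      thus ?thesis using r by (simp add: z_def \<beta>_def norm_mult)
    next
      case False
      have "cos \<theta> \<ge> cos (pi/3)" using \<theta> by (intro cos_monotone_0_pi_le) auto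
      hence "r * r \<le> r * (2 * cos \<theta>)" using r by (intro mult_left_mono) (auto simp: cos_60)
      moreover have "(norm (1 - cis \<theta> * of_real r))\<^sup>2 = (1 - r * cos \<theta>)\<^sup>2 + (r * sin \<theta>)\<^sup>2"
        by (simp add: cmod_power2 mult.commute)
      moreover have "\<dots> = 1 - r * (2 * cos \<theta>) + r * r * ((sin \<theta>)\<^sup>2 + (cos \<theta>)\<^sup>2)" by algebra
      ultimately have "(norm (1 - cis \<theta> * of_real r))\<^sup>2 \<le> 1\<^sup>2" by simp
      hence "norm (1 - cis \<theta> * of_real r) \<le> 1" by (rule power2_le_imp_le) simp
      moreover have "z $ j = a $ j * (1 - cis \<theta> * of_real r)"
        using False by (simp add: z_def \<beta>_def algebra_simps)
      ultimately show ?thesis using aj by (simp add: norm_mult mult_le_one)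
    qed
    moreover have "z $ k = a $ k" if "k \<noteq> j" for k using that by (simp add: z_def axis_def)
    ultimately have "z \<in> necklace_tube i" using a j unfolding necklace_tube_def by (auto) metis
    thus "a + cis \<theta> *s (of_real r *s axis j \<beta>) \<in> necklace_tube i" by (simp add: z_def)
  qed
qed

text \<open>
  At points with coordinate \<open>2 - s\<close>, a suitable test function reaches \<open>1/2 ln 2\<close>; the regularization sees these
  points as \<open>s \<rightarrow> 0\<close>. The surplus \<open>1/2 - 4/9 = 1/18\<close> pays for the variation of \<open>W\<close>.
\<close>

lemma usc_reg_ge_probe:
  fixes a :: "complex ^ 'n::finite"
  assumes a: "a $ i = 2" and c: "c > 0" and W: "continuous_on UNIV W"
    and f: "\<And>N z. N \<ge> 7 \<Longrightarrow> ereal (W z + c * probe N (z $ i)) \<le> f z"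
  shows "ereal (W a + 4/9 * c * ln 2) \<le> usc_reg f a"
proof (rule usc_reg_ge_frequently, rule ccontr)
  define z where "z s = a - axis i (complex_of_real s)" for s
  assume "\<not> frequently (\<lambda>z. ereal (W a + 4/9 * c * ln 2) \<le> f z) (nhds a)"
  hence ev: "eventually (\<lambda>z. \<not> ereal (W a + 4/9 * c * ln 2) \<le> f z) (nhds a)"
    by (simp add: not_frequently)
  have "continuous_on UNIV z"
    unfolding z_def axis_def
  proof (intro continuous_intros continuous_on_vec_lambda)
    show "continuous_on UNIV (\<lambda>s. if k = i then complex_of_real s else 0)" for k
      by (cases "k = i") (auto intro: continuous_intros)
  qed
  moreover have "z 0 = a" by (simp add: z_def axis_def vec_eq_iff)
  ultimately have lim: "(z \<longlongrightarrow> a) (at_right 0)"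
    by (metis UNIV_I continuous_on_eq_continuous_at isCont_def open_UNIV tendsto_within_subset subset_UNIV)
  have "((\<lambda>s. W (z s)) \<longlongrightarrow> W a) (at_right 0)"
    using lim W by (metis UNIV_I continuous_on_eq_continuous_at isCont_tendsto_compose open_UNIV)
  hence "eventually (\<lambda>s. W a - 1/18 * c * ln 2 < W (z s)) (at_right 0)"
    using c by (intro order_tendstoD(1)) auto
  moreover have "eventually (\<lambda>s. \<not> ereal (W a + 4/9 * c * ln 2) \<le> f (z s)) (at_right 0)"
    using ev lim by (rule eventually_compose_filterlim)
  ultimately have "eventually (\<lambda>s. False) (at_right (0::real))"
    using probe_large_near_2
  proof eventually_elim
    case (elim s)
    then obtain N where N: "N \<ge> 7" "probe N (of_real (2 - s)) \<ge> 1/2 * ln 2" by blast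
    have "z s $ i = of_real (2 - s)" using a by (simp add: z_def)
    hence "c * (1/2 * ln 2) \<le> c * probe N (z s $ i)"
      using N c by (intro mult_left_mono) auto
    hence "W a + 4/9 * c * ln 2 \<le> W (z s) + c * probe N (z s $ i)"
      using elim(1) by (simp add: algebra_simps)
    hence "ereal (W a + 4/9 * c * ln 2) \<le> f (z s)"
      using f[OF N(1), of "z s"] by (meson ereal_less_eq(3) order_trans)
    with elim(2) show False by simp
  qed
  thus False by (simp add: trivial_limit_at_right_real)
qed

lemma not_locally_pluriregular_necklace_tube:
  assumes "a $ i = 2"
  shows "\<not> locally_pluriregular_at (necklace_tube i) a"
proof
  assume "locally_pluriregular_at (necklace_tube i) a"
  hence "extremal_fun_reg 1 (necklace_tube i \<inter> cball a 1) (\<lambda>_. 0) a = 0"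
    by (simp add: locally_pluriregular_at_def)
  moreover have "ereal (0 + 4/9 * 1 * ln 2) \<le> usc_reg (extremal_fun 1 (necklace_tube i \<inter> cball a 1) (\<lambda>_. 0)) a"
  proof (rule usc_reg_ge_probe[OF assms])
    fix N z assume "(7::nat) \<le> N"
    thus "ereal (0 + 1 * probe N (z $ i)) \<le> extremal_fun 1 (necklace_tube i \<inter> cball a 1) (\<lambda>_. 0) z"
      unfolding extremal_fun_def
      by (intro SUP_upper2[of "\<lambda>z. ereal (probe N (z $ i))"])
         (auto simp: probe_in_lelong_class necklace_tube_def intro: probe_nonpos)
  qed auto
  ultimately show False by (simp add: extremal_fun_reg_def zero_ereal_def)
qed

section \<open>Extremal functions of the weight\<close>

lemma lelong_class_mono:
  assumes "u \<in> lelong_class \<tau>" "\<tau> \<le> \<delta>"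
  shows "u \<in> lelong_class \<delta>"
proof -
  have "\<tau> * log_plus (norm z) \<le> \<delta> * log_plus (norm z)" for z :: "complex ^ 'n"
    using assms(2) by (intro mult_right_mono) (auto simp: log_plus_eq_ln_max)
  hence "ereal (\<tau> * log_plus (norm z) + C) \<le> ereal (\<delta> * log_plus (norm z) + C)" for z :: "complex ^ 'n" and C
    by simp
  thus ?thesis using assms(1) unfolding lelong_class_def by (blast intro: order_trans)
qed

lemma weight_plus_probe_in_lelong_class:
  assumes "0 \<le> \<tau>" "\<tau> \<le> \<delta>" "N \<ge> 7"
  shows "(\<lambda>z :: complex ^ 'n::finite. ereal (weight \<tau> z + (\<delta> - \<tau>) * probe N (z $ i))) \<in> lelong_class \<delta>"
proof -
  obtain C where C: "\<And>z :: complex ^ 'n. weight \<tau> z \<le> \<tau> * log_plus (norm z) + C"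
  proof -
    have "(\<lambda>z :: complex ^ 'n. ereal (weight \<tau> z)) \<in> lelong_class_plus \<tau>"
      by (rule weight_in_lelong_class_plus[OF assms(1)])
    thus ?thesis using that by (auto simp: lelong_class_plus_def lelong_class_def)
  qed
  have "weight \<tau> z + (\<delta> - \<tau>) * probe N (z $ i) \<le> \<delta> * log_plus (norm z) + C" for z :: "complex ^ 'n"
  proof -
    have "probe N (z $ i) \<le> ln (max 1 (norm (z $ i)))" using assms(3) by (rule probe_le_log_plus)
    also have "\<dots> \<le> log_plus (norm z)"
      using Finite_Cartesian_Product.norm_nth_le[of z i]
      by (subst log_plus_eq_ln_max) (auto intro!: ln_mono)
    finally have "(\<delta> - \<tau>) * probe N (z $ i) \<le> (\<delta> - \<tau>) * log_plus (norm z)"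
      using assms by (intro mult_left_mono) auto
    thus ?thesis using C[of z] by (simp add: algebra_simps)
  qed
  moreover have "psh_on UNIV (\<lambda>z :: complex ^ 'n. ereal (weight \<tau> z + (\<delta> - \<tau>) * probe N (z $ i)))"
    using assms by (intro psh_cont_imp_psh_on psh_cont_add psh_cont_cmult psh_cont_weight psh_cont_probe) auto
  ultimately show ?thesis by (auto simp: lelong_class_def)
qed

text \<open>
  Let \<open>M > 1\<close> be the largest modulus of a coordinate of \<open>z\<close>. The circle \<open>\<zeta> z / M\<close> with \<open>\<bar>\<zeta>\<bar> = 1\<close> lies in the unit
  polydisc but not inside the open unit ball, so there the weight is \<open>\<tau> ln (norm z / M)\<close>; the Bernstein-Walsh
  inequality adds \<open>\<tau> ln M\<close>, and the sum is exactly the weight at \<open>z\<close>.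
\<close>

lemma weight_dominates:
  fixes u :: "complex ^ 'n::finite \<Rightarrow> ereal"
  assumes u: "u \<in> lelong_class \<tau>" and \<tau>: "\<tau> \<ge> 0"
    and le: "\<And>w. (\<And>j. norm (w $ j) \<le> 1) \<Longrightarrow> u w \<le> ereal (weight \<tau> w)"
  shows "u z \<le> ereal (weight \<tau> z)"
proof (cases "\<forall>j. norm (z $ j) \<le> 1")
  case True
  thus ?thesis using le by blast
next
  case False
  define M where "M = Max (range (\<lambda>j. norm (z $ j)))"
  have M: "norm (z $ j) \<le> M" for j by (simp add: M_def)
  have "M \<in> range (\<lambda>j. norm (z $ j))" unfolding M_def by (intro Max_in) auto
  then obtain j where j: "M = norm (z $ j)" by auto
  have M1: "M > 1" using False M by (meson not_le less_le_trans)
  have Mz: "M \<le> norm z" unfolding j by (rule Finite_Cartesian_Product.norm_nth_le)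
  have "u z \<le> ereal (\<tau> * ln (norm z / M) + \<tau> * ln M)"
  proof (rule lelong_class_rescale[OF u \<tau>, of M 0])
    fix \<zeta> :: complex assume \<zeta>: "norm \<zeta> = 1"
    define w where "w = (\<zeta> / of_real M) *s z"
    have nw: "norm w = norm z / M" using \<zeta> M1 by (simp add: w_def norm_vector_smult norm_divide)
    have "norm (w $ k) \<le> 1" for k
      using M[of k] M1 \<zeta> by (simp add: w_def norm_mult norm_divide)
    hence "u w \<le> ereal (weight \<tau> w)" by (rule le)
    also have "weight \<tau> w = \<tau> * ln (norm z / M)"
      using Mz M1 by (subst weight_outside) (auto simp: nw)
    finally show "u (0 + (\<zeta> / of_real M) *s (z - 0)) \<le> ereal (\<tau> * ln (norm z / M))" by (simp add: w_def)
  qed (use M1 in auto)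
  also have "\<tau> * ln (norm z / M) + \<tau> * ln M = \<tau> * ln (norm z)"
  proof -
    have "norm z > 0" "M > 0" using Mz M1 by linarith+
    hence "ln (norm z / M) = ln (norm z) - ln M" by (simp add: ln_div)
    thus ?thesis by (simp only: right_diff_distrib diff_add_cancel)
  qed
  also have "\<dots> = weight \<tau> z" using Mz M1 by (simp add: weight_outside)
  finally show ?thesis .
qed

lemma unit_polydisc_subset_necklace_tube: "(\<And>j. norm (w $ j) \<le> 1) \<Longrightarrow> w \<in> necklace_tube i"
  by (simp add: necklace_tube_def necklace_def)

lemma extremal_fun_weight:
  fixes z :: "complex ^ 'n::finite"
  assumes "\<tau> \<ge> 0"
  shows "extremal_fun \<tau> (necklace_tube i) (weight \<tau>) z = ereal (weight \<tau> z)"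
  unfolding extremal_fun_def
proof (intro antisym SUP_least)
  fix u assume u: "u \<in> {u \<in> lelong_class \<tau>. \<forall>w\<in>necklace_tube i. u w \<le> ereal (weight \<tau> w)}"
  show "u z \<le> ereal (weight \<tau> z)"
  proof (rule weight_dominates[OF _ assms])
    fix w :: "complex ^ 'n" assume "\<And>j. norm (w $ j) \<le> 1"
    hence "w \<in> necklace_tube i" by (rule unit_polydisc_subset_necklace_tube)
    thus "u w \<le> ereal (weight \<tau> w)" using u by blast
  qed (use u in blast)
next
  show "ereal (weight \<tau> z) \<le> (SUP u\<in>{u \<in> lelong_class \<tau>. \<forall>w\<in>necklace_tube i. u w \<le> ereal (weight \<tau> w)}. u z)"
    using weight_in_lelong_class_plus[OF assms]
    by (intro SUP_upper2[of "\<lambda>z. ereal (weight \<tau> z)"]) (auto simp: lelong_class_plus_def)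
qed

lemma extremal_fun_reg_weight:
  fixes z :: "complex ^ 'n::finite"
  assumes "\<tau> \<ge> 0"
  shows "extremal_fun_reg \<tau> (necklace_tube i) (weight \<tau>) z = ereal (weight \<tau> z)"
proof -
  have "continuous_on UNIV (weight \<tau> :: complex ^ 'n \<Rightarrow> real)"
    using assms by (rule continuous_on_weight)
  hence "isCont (weight \<tau>) z" by (simp add: continuous_on_eq_continuous_at)
  hence "((\<lambda>z. ereal (weight \<tau> z)) \<longlongrightarrow> ereal (weight \<tau> z)) (nhds z)"
    by (intro tendsto_intros) (simp add: tendsto_at_iff_tendsto_nhds continuous_at)
  thus ?thesis
    unfolding extremal_fun_reg_def usc_reg_def extremal_fun_weight[OF assms]
    by (intro lim_imp_Limsup) simp
qed

lemma extremal_fun_weight_on_tube: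
  assumes "0 \<le> \<tau>" "\<tau> \<le> \<delta>" "z \<in> necklace_tube i"
  shows "extremal_fun \<delta> (necklace_tube i) (weight \<tau>) z = ereal (weight \<tau> z)"
  unfolding extremal_fun_def
proof (intro antisym SUP_least)
  show "ereal (weight \<tau> z) \<le> (SUP u\<in>{u \<in> lelong_class \<delta>. \<forall>w\<in>necklace_tube i. u w \<le> ereal (weight \<tau> w)}. u z)"
    using weight_in_lelong_class_plus[OF assms(1)] assms(2)
    by (intro SUP_upper2[of "\<lambda>z. ereal (weight \<tau> z)"])
       (auto simp: lelong_class_plus_def intro: lelong_class_mono)
qed (use assms in auto)

text \<open>
  The point \<open>axis i 2\<close> is twice a point of the unit polydisc whose circle has norm \<open>1\<close>, where the weight
  vanishes. Its own weight is \<open>\<tau> ln 2\<close>, which exceeds this bound if \<open>\<delta> < \<tau>\<close>.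
\<close>

lemma extremal_fun_weight_less:
  fixes i :: "'n::finite"
  assumes "0 \<le> \<delta>"
  shows "extremal_fun \<delta> (necklace_tube i) (weight \<tau>) (axis i 2) \<le> ereal (\<delta> * ln 2)"
  unfolding extremal_fun_def
proof (rule SUP_least)
  fix u assume u: "u \<in> {u \<in> lelong_class \<delta>. \<forall>w\<in>necklace_tube i. u w \<le> ereal (weight \<tau> w)}"
  have "u (axis i 2) \<le> ereal (0 + \<delta> * ln 2)"
  proof (rule lelong_class_rescale[of _ _ _ 0])
    fix \<zeta> :: complex assume \<zeta>: "norm \<zeta> = 1"
    define w :: "complex ^ 'n" where "w = (\<zeta> / of_real 2) *s axis i 2"
    have w: "w = axis i \<zeta>" by (simp add: w_def vec_eq_iff axis_def)
    have nw: "norm w = 1"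
      unfolding w using \<zeta> by (simp add: norm_eq_sqrt_inner[of "axis i _"] inner_axis_axis flip: norm_eq_sqrt_inner)
    have "w \<in> necklace_tube i"
      using Finite_Cartesian_Product.norm_nth_le[of w] nw by (intro unit_polydisc_subset_necklace_tube) simp
    hence "u w \<le> ereal (weight \<tau> w)" using u by blast
    also have "weight \<tau> w = 0" by (simp add: weight_outside nw)
    finally show "u (0 + (\<zeta> / of_real 2) *s (axis i 2 - 0)) \<le> ereal 0" by (simp add: w_def)
  qed (use u assms in auto)
  thus "u (axis i 2) \<le> ereal (\<delta> * ln 2)" by simp
qed

text \<open>
  The competitors are the weight plus \<open>(\<delta> - \<tau>)\<close> times a test function: the latter has unit growth and does not
  exceed \<open>0\<close> on the set.
\<close>

lemma extremal_fun_reg_weight_gap: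
  fixes a :: "complex ^ 'n::finite"
  assumes a: "a $ i = 2" and \<tau>: "0 \<le> \<tau>" "\<tau> < \<delta>"
  shows "ereal (weight \<tau> a + 4/9 * (\<delta> - \<tau>) * ln 2) \<le> extremal_fun_reg \<delta> (necklace_tube i) (weight \<tau>) a"
  unfolding extremal_fun_reg_def
proof (rule usc_reg_ge_probe[OF a])
  show "continuous_on UNIV (weight \<tau> :: complex ^ 'n \<Rightarrow> real)"
    using \<tau>(1) by (rule continuous_on_weight)
  fix N and z :: "complex ^ 'n" assume N: "(7::nat) \<le> N"
  have "weight \<tau> w + (\<delta> - \<tau>) * probe N (w $ i) \<le> weight \<tau> w" if "w \<in> necklace_tube i" for w :: "complex ^ 'n"
    using that \<tau> probe_nonpos[of "w $ i" N] by (simp add: necklace_tube_def mult_nonneg_nonpos)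
  thus "ereal (weight \<tau> z + (\<delta> - \<tau>) * probe N (z $ i)) \<le> extremal_fun \<delta> (necklace_tube i) (weight \<tau>) z"
    unfolding extremal_fun_def using weight_plus_probe_in_lelong_class[of \<tau> \<delta> N i] \<tau> N
    by (intro SUP_upper2[of "\<lambda>z. ereal (weight \<tau> z + (\<delta> - \<tau>) * probe N (z $ i))"]) auto
qed (use \<tau> in simp)

theorem theorem1p2:
  fixes i :: "'n::finite"
  assumes "CARD('n) \<ge> 2"
  shows "\<exists>K :: (complex ^ 'n) set.
    compact K \<and> polynomially_convex K \<and>
    nonpluripolar_everywhere K \<and> (\<forall>a\<in>K. \<not> plurithin_at K a) \<and>
    Z_set i \<subseteq> K \<and>
    {a. locally_pluriregular_at K a} = K - Z_set i \<and>
    (\<forall>\<tau>>0. \<exists>\<Psi> :: complex ^ 'n \<Rightarrow> real.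
       C_infinity \<Psi> \<and> (\<lambda>z. ereal (\<Psi> z)) \<in> lelong_class_plus \<tau> \<and>
       Lambda K \<Psi> = {\<tau>..} \<and>
       Lambda_reg K \<Psi> = {\<tau>} \<and>
       (\<forall>a\<in>Z_set i. \<forall>\<delta>>\<tau>.
          extremal_fun_reg \<delta> K \<Psi> a - ereal (\<Psi> a) \<ge> ereal (4/9 * (\<delta> - \<tau>) * ln 2) \<and>
          4/9 * (\<delta> - \<tau>) * ln 2 > 0) \<and>
       (\<forall>z. nonneg_11_form (complex_hessian \<Psi> z)) \<and>
       (\<exists>U. open U \<and> Z_set i \<subseteq> U \<and>
          (\<forall>z\<in>U. rank (complex_hessian \<Psi> z) = CARD('n) - 1)))"
proof (intro exI[of _ "necklace_tube i"] conjI allI impI)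
  let ?K = "necklace_tube i :: (complex ^ 'n) set"
  show "compact ?K" by (rule compact_necklace_tube)
  show "polynomially_convex ?K" by (rule polynomially_convex_necklace_tube)
  show "nonpluripolar_everywhere ?K" by (rule nonpluripolar_necklace_tube)
  show "\<forall>a\<in>?K. \<not> plurithin_at ?K a" using not_plurithin_necklace_tube[OF assms] by blast
  show Z: "Z_set i \<subseteq> ?K" by (auto simp: Z_set_def necklace_tube_def necklace_def)
  have KZ: "?K - Z_set i = {a \<in> ?K. a $ i \<noteq> 2}" by (auto simp: Z_set_def necklace_tube_def)
  show "{a. locally_pluriregular_at ?K a} = ?K - Z_set i"
    unfolding KZ
    using locally_pluriregular_necklace_tube[of _ i] not_locally_pluriregular_necklace_tube[of _ i]
    by (auto simp: locally_pluriregular_at_def[of ?K])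
  fix \<tau> :: real assume \<tau>: "\<tau> > 0"
  let ?\<Psi> = "weight \<tau> :: complex ^ 'n \<Rightarrow> real"
  have gap: "ereal (?\<Psi> a + 4/9 * (\<delta> - \<tau>) * ln 2) \<le> extremal_fun_reg \<delta> ?K ?\<Psi> a"
    if "a \<in> Z_set i" "\<delta> > \<tau>" for a \<delta>
    using that \<tau> by (intro extremal_fun_reg_weight_gap) (auto simp: Z_set_def)
  have pZ: "axis i 2 \<in> Z_set i" by (auto simp: Z_set_def axis_def)
  have \<Psi>p: "?\<Psi> (axis i 2) = \<tau> * ln 2"
  proof -
    have "norm (axis i (2::complex)) = 2"
      by (simp add: norm_eq_sqrt_inner[of "axis i _"] inner_axis_axis flip: norm_eq_sqrt_inner)
    thus ?thesis by (simp add: weight_outside)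
  qed
  have Lam: "Lambda ?K ?\<Psi> = {\<tau>..}"
  proof (intro equalityI subsetI)
    fix \<delta> assume \<delta>: "\<delta> \<in> Lambda ?K ?\<Psi>"
    hence "ereal (?\<Psi> (axis i 2)) = extremal_fun \<delta> ?K ?\<Psi> (axis i 2)" using pZ Z by (auto simp: Lambda_def)
    also have "\<dots> \<le> ereal (\<delta> * ln 2)"
      using \<delta> by (intro extremal_fun_weight_less) (auto simp: Lambda_def)
    finally show "\<delta> \<in> {\<tau>..}" by (simp add: \<Psi>p)
  qed (use \<tau> in \<open>auto simp: Lambda_def extremal_fun_weight_on_tube\<close>)
  show "\<exists>\<Psi> :: complex ^ 'n \<Rightarrow> real.
       C_infinity \<Psi> \<and> (\<lambda>z. ereal (\<Psi> z)) \<in> lelong_class_plus \<tau> \<and>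
       Lambda ?K \<Psi> = {\<tau>..} \<and>
       Lambda_reg ?K \<Psi> = {\<tau>} \<and>
       (\<forall>a\<in>Z_set i. \<forall>\<delta>>\<tau>.
          extremal_fun_reg \<delta> ?K \<Psi> a - ereal (\<Psi> a) \<ge> ereal (4/9 * (\<delta> - \<tau>) * ln 2) \<and>
          4/9 * (\<delta> - \<tau>) * ln 2 > 0) \<and>
       (\<forall>z. nonneg_11_form (complex_hessian \<Psi> z)) \<and>
       (\<exists>U. open U \<and> Z_set i \<subseteq> U \<and>
          (\<forall>z\<in>U. rank (complex_hessian \<Psi> z) = CARD('n) - 1))"
  proof (intro exI[of _ ?\<Psi>] conjI ballI allI impI)
    show "C_infinity ?\<Psi>" by (rule C_infinity_weight)
    show "(\<lambda>z. ereal (?\<Psi> z)) \<in> lelong_class_plus \<tau>" using \<tau> by (intro weight_in_lelong_class_plus) simp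
    show "Lambda ?K ?\<Psi> = {\<tau>..}" by (rule Lam)
    show "Lambda_reg ?K ?\<Psi> = {\<tau>}"
    proof (intro equalityI subsetI)
      fix \<delta> assume \<delta>: "\<delta> \<in> Lambda_reg ?K ?\<Psi>"
      show "\<delta> \<in> {\<tau>}"
      proof (rule ccontr)
        assume "\<delta> \<notin> {\<tau>}"
        hence "\<delta> > \<tau>" using \<delta> Lam by (auto simp: Lambda_reg_def)
        moreover have "extremal_fun_reg \<delta> ?K ?\<Psi> (axis i 2) = ereal (?\<Psi> (axis i 2))"
          using \<delta> pZ Z by (auto simp: Lambda_reg_def)
        ultimately show False using gap[OF pZ, of \<delta>] by (simp add: mult_le_0_iff)
      qed
    next
      fix \<delta> assume "\<delta> \<in> {\<tau>}"
      thus "\<delta> \<in> Lambda_reg ?K ?\<Psi>" using Lam \<tau> by (simp add: Lambda_reg_def extremal_fun_reg_weight)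
    qed
    show "ereal (4/9 * (\<delta> - \<tau>) * ln 2) \<le> extremal_fun_reg \<delta> ?K ?\<Psi> a - ereal (?\<Psi> a)"
      if "a \<in> Z_set i" "\<delta> > \<tau>" for a \<delta>
      using gap[OF that] by (simp add: ereal_le_minus_iff add.commute)
    show "4/9 * (\<delta> - \<tau>) * ln 2 > 0" if "\<delta> > \<tau>" for \<delta> using that by simp
    show "nonneg_11_form (complex_hessian ?\<Psi> z)" for z
      using \<tau> by (intro nonneg_complex_hessian_weight) simp
    have "Z_set i \<subseteq> - cball (0 :: complex ^ 'n) 1"
    proof
      fix a :: "complex ^ 'n" assume "a \<in> Z_set i"
      thus "a \<in> - cball 0 1"
        using Finite_Cartesian_Product.norm_nth_le[of a i] by (auto simp: Z_set_def)
    qed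
    moreover have "rank (complex_hessian ?\<Psi> z) = CARD('n) - 1" if "z \<in> - cball 0 1" for z
      using that \<tau> by (intro rank_complex_hessian_weight) auto
    ultimately show "\<exists>U. open U \<and> Z_set i \<subseteq> U \<and> (\<forall>z\<in>U. rank (complex_hessian ?\<Psi> z) = CARD('n) - 1)"
      by (intro exI[of _ "- cball (0 :: complex ^ 'n) 1"]) auto
  qed
qed

end
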